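(* Let $n,t$ be integers with $2\leq t\leq n$, let $\mathbb{K}$ be a field, $R=\mathbb{K}[x_1,\ldots,x_n]$, and let $I=I_t(L_n)\subset R$ be the $t$-path ideal of the line graph $L_n$. Then the following statements are equivalent: (1) $I^s$ has a linear resolution for some $s\geq 1$; (2) $I^s$ has a linear resolution for all $s\geq 1$; (3) $t\leq n\leq 2t$; (4) $I^s$ has linear quotients for some $s\geq 1$; (5) $I^s$ has linear quotients for all $s\geq 1$; (6) $I^s$ is quasi-linear for some $s\geq 1$; (7) $I^s$ is quasi-linear for all $s\geq 1$.
   Context: The line graph $L_n$ (of length $n-1$) is the graph with vertex set $\{x_1,\ldots,x_n\}$ and edge set $\{\{x_j,x_{j+1}\}\mid j=1,\ldots,n-1\}$. For $2\leq t\leq n$, its $t$-path ideal is the squarefree monomial ideal $I_t(L_n)=(u_1,\ldots,u_{n-t+1})\subset R$, where $u_i=x_ix_{i+1}\cdots x_{i+t-1}$ for $i=1,\ldots,n-t+1$. For a monomial ideal $J$, $G(J)$ denotes its minimal set of monomial generators. Let $J$ be a monomial ideal of $R$ generated in a single degree $d$. - $J$ has a linear resolution if $\beta_{i,i+j}(J)=0$ for all $i$ and all $j\neq d$, where $\beta_{i,j}(J)$ are the graded Betti numbers of $J$ over $R$. - $J$ has linear quotients if the elements of $G(J)$ can be ordered as $f_1,\ldots,f_p$ such that for each $j=2,\ldots,p$ the colon ideal $(f_1,\ldots,f_{j-1}):f_j$ is generated by a subset of the variables. - $J$ is quasi-linear if for each $u\in G(J)$ the colon ideal $J\setminus_u:u$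 is generated by a (possibly empty) subset of the variables, where $J\setminus_u$ is the ideal generated by $G(J)\setminus\{u\}$. *)

theory Defs
  imports "HOL-Library.Poly_Mapping" "HOL-Algebra.Ideal_Product"
begin

section \<open>The polynomial ring in \<open>x\<^sub>1, \<dots>, x\<^sub>n\<close> over a field\<close>

text \<open>
  A polynomial is a finitely supported map from exponent vectors (finitely supported maps from
  variable indices to exponents) to coefficients; its arithmetic is the convolution arithmetic of
  \<^theory>\<open>HOL-Library.Poly_Mapping\<close>. The number of variables is a parameter of the
  carrier, not of the type.
\<close>

type_synonym 'k mpoly = "(nat \<Rightarrow>\<^sub>0 nat) \<Rightarrow>\<^sub>0 'k"

definition poly_ring :: "nat \<Rightarrow> 'k::field mpoly ring" where
  "poly_ring n =
     \<lparr>carrier = {p. \<forall>m\<in>Poly_Mapping.keys p. Poly_Mapping.keys m \<subseteq> {1..n}},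
      mult = (*), one = 1, zero = 0, add = (+)\<rparr>"

definition var :: "nat \<Rightarrow> 'k::field mpoly" where
  "var i = Poly_Mapping.single (Poly_Mapping.single i 1) 1"

definition exp_degree :: "(nat \<Rightarrow>\<^sub>0 nat) \<Rightarrow> nat" where
  "exp_degree m = (\<Sum>i\<in>Poly_Mapping.keys m. Poly_Mapping.lookup m i)"

definition monomials :: "nat \<Rightarrow> 'k::field mpoly set" where
  "monomials n = {Poly_Mapping.single m 1 |m. Poly_Mapping.keys m \<subseteq> {1..n}}"

text \<open>Zero is homogeneous of every degree.\<close>

definition homogeneous :: "nat \<Rightarrow> 'k::field mpoly \<Rightarrow> bool" where
  "homogeneous d p \<longleftrightarrow> (\<forall>m\<in>Poly_Mapping.keys p. exp_degree m = d)"

lemma poly_ring_cring: "cring (poly_ring n :: 'k::field mpoly ring)"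
proof -
  let ?R = "poly_ring n :: 'k mpoly ring"
  have sel: "mult ?R = (*)" "one ?R = 1" "zero ?R = 0" "add ?R = (+)"
    by (simp_all add: poly_ring_def)
  have carr: "p \<in> carrier ?R \<longleftrightarrow> (\<forall>m\<in>Poly_Mapping.keys p. Poly_Mapping.keys m \<subseteq> {1..n})" for p
    by (simp add: poly_ring_def)
  have add: "p + q \<in> carrier ?R" if "p \<in> carrier ?R" "q \<in> carrier ?R" for p q
    using that keys_add[of p q] unfolding carr by blast
  have mult: "p * q \<in> carrier ?R" if pq: "p \<in> carrier ?R" "q \<in> carrier ?R" for p q
    unfolding carr
  proof
    fix m assume "m \<in> Poly_Mapping.keys (p * q)"
    then obtain a b where "m = a + b" "a \<in> Poly_Mapping.keys p" "b \<in> Poly_Mapping.keys q"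
      using keys_mult[of p q] by blast
    then show "Poly_Mapping.keys m \<subseteq> {1..n}"
      using keys_add[of a b] pq unfolding carr by blast
  qed
  have zero: "0 \<in> carrier ?R" and one: "1 \<in> carrier ?R"
    by (simp_all add: carr)
  have minus: "- p \<in> carrier ?R" if "p \<in> carrier ?R" for p
    using that by (simp add: carr)
  have "abelian_group ?R"
  proof (rule abelian_groupI, unfold sel)
    fix p assume "p \<in> carrier ?R"
    then show "\<exists>q\<in>carrier ?R. q + p = 0"
      by (intro bexI[of _ "- p"] minus) simp_all
  qed (simp_all only: add zero ac_simps add_0_left add_0_right)
  moreover have "Group.comm_monoid ?R"
    by (rule comm_monoidI, unfold sel)
       (simp_all only: mult one ac_simps mult_1_left mult_1_right)
  ultimately show ?thesis
    by (rule cringI) (simp only: sel distrib_right)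
qed


section \<open>Monomial ideals\<close>

text \<open>The generators are \<open>u\<^sub>i = x\<^sub>i x\<^sub>i\<^sub>+\<^sub>1 \<cdots> x\<^sub>i\<^sub>+\<^sub>t\<^sub>-\<^sub>1\<close> for \<open>1 \<le> i \<le> n - t + 1\<close>.\<close>

definition line_path_ideal :: "nat \<Rightarrow> nat \<Rightarrow> 'k::field mpoly set" where
  "line_path_ideal n t = Idl\<^bsub>poly_ring n\<^esub> ((\<lambda>i. \<Prod>j\<in>{i..<i + t}. var j) ` {1..n - t + 1})"

definition ideal_power :: "nat \<Rightarrow> 'k::field mpoly set \<Rightarrow> nat \<Rightarrow> 'k mpoly set" where
  "ideal_power n J s = J [^]\<^bsub>ideals_set (poly_ring n)\<^esub> s"

definition minimal_monomial_gens :: "nat \<Rightarrow> 'k::field mpoly set \<Rightarrow> 'k mpoly set" where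
  "minimal_monomial_gens n J =
     (THE G. G \<subseteq> monomials n \<and> Idl\<^bsub>poly_ring n\<^esub> G = J \<and>
             (\<forall>G'. G' \<subset> G \<longrightarrow> Idl\<^bsub>poly_ring n\<^esub> G' \<noteq> J))"

definition monomial_ideal_generated_in_degree :: "nat \<Rightarrow> nat \<Rightarrow> 'k::field mpoly set \<Rightarrow> bool" where
  "monomial_ideal_generated_in_degree n d J \<longleftrightarrow>
     (\<exists>M. M \<subseteq> monomials n \<and> (\<forall>u\<in>M. homogeneous d u) \<and> J = Idl\<^bsub>poly_ring n\<^esub> M)"

definition colon :: "nat \<Rightarrow> 'k::field mpoly set \<Rightarrow> 'k mpoly \<Rightarrow> 'k mpoly set" where
  "colon n J f = {r \<in> carrier (poly_ring n). r * f \<in> J}"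

definition generated_by_variables :: "nat \<Rightarrow> 'k::field mpoly set \<Rightarrow> bool" where
  "generated_by_variables n J \<longleftrightarrow> (\<exists>V\<subseteq>{1..n}. J = Idl\<^bsub>poly_ring n\<^esub> (var ` V))"

definition has_linear_quotients :: "nat \<Rightarrow> 'k::field mpoly set \<Rightarrow> bool" where
  "has_linear_quotients n J \<longleftrightarrow>
     (\<exists>fs. distinct fs \<and> set fs = minimal_monomial_gens n J \<and>
           (\<forall>j. 1 \<le> j \<and> j < length fs \<longrightarrow>
              generated_by_variables n (colon n (Idl\<^bsub>poly_ring n\<^esub> (set (take j fs))) (fs ! j))))"

definition quasi_linear :: "nat \<Rightarrow> 'k::field mpoly set \<Rightarrow> bool" where
  "quasi_linear n J \<longleftrightarrow>
     (\<forall>u\<in>minimal_monomial_gens n J.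
        generated_by_variables n (colon n (Idl\<^bsub>poly_ring n\<^esub> (minimal_monomial_gens n J - {u})) u))"


section \<open>Minimal graded free resolutions and graded Betti numbers\<close>

text \<open>
  For \<open>b :: nat \<Rightarrow> nat\<close>, the set \<open>graded_free n b\<close> is the graded free module
  \<open>\<Oplus>\<^sub>j R(-j)\<^bsup>b j\<^esup>\<close>: its basis elements are indexed by the pairs \<open>(j, k)\<close> with
  \<open>k < b j\<close>, the one with index \<open>(j, k)\<close> has degree \<open>j\<close>, and an element is its coordinate vector.
\<close>

type_synonym 'k fvec = "nat \<times> nat \<Rightarrow> 'k mpoly"

definition graded_free :: "nat \<Rightarrow> (nat \<Rightarrow> nat) \<Rightarrow> 'k::field fvec set" where
  "graded_free n b =
     {v. finite {e. v e \<noteq> 0} \<and> (\<forall>e. v e \<in> carrier (poly_ring n)) \<and>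
         (\<forall>j k. b j \<le> k \<longrightarrow> v (j, k) = 0)}"

text \<open>An \<open>R\<close>-linear map out of a free module is given by the images of the basis elements.\<close>

definition lin_to_ring :: "('k::field) fvec \<Rightarrow> 'k fvec \<Rightarrow> 'k mpoly" where
  "lin_to_ring g v = (\<Sum>e | v e \<noteq> 0. v e * g e)"

definition lin_to_free :: "(nat \<times> nat \<Rightarrow> ('k::field) fvec) \<Rightarrow> 'k fvec \<Rightarrow> 'k fvec" where
  "lin_to_free D v = (\<lambda>e'. \<Sum>e | v e \<noteq> 0. v e * D e e')"

text \<open>
  The complex
  \<open>\<cdots> \<longrightarrow> F\<^sub>2 \<longrightarrow> F\<^sub>1 \<longrightarrow> F\<^sub>0 \<longrightarrow> J \<longrightarrow> 0\<close> with \<open>F\<^sub>i = \<Oplus>\<^sub>j R(-j)\<^bsup>b i j\<^esup>\<close>,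
  where \<open>g\<close> describes the augmentation \<open>F\<^sub>0 \<longrightarrow> J\<close> and \<open>D i\<close> the differential
  \<open>F\<^sub>i\<^sub>+\<^sub>1 \<longrightarrow> F\<^sub>i\<close>. The conditions on \<open>exp_degree\<close> say that all maps are homogeneous of degree 0.
  The resolution is minimal if the entries of all differentials lie in the maximal ideal
  \<open>(x\<^sub>1, \<dots>, x\<^sub>n)\<close>, i.e. have no constant term. That only finitely many
  \<open>b i j\<close> are nonzero for each \<open>i\<close> is not required; it is automatic because \<open>R\<close> is Noetherian.
\<close>

definition minimal_graded_free_resolution ::
  "nat \<Rightarrow> 'k::field mpoly set \<Rightarrow> (nat \<Rightarrow> nat \<Rightarrow> nat) \<Rightarrow> 'k fvec \<Rightarrow>
     (nat \<Rightarrow> nat \<times> nat \<Rightarrow> 'k fvec) \<Rightarrow> bool" where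
  "minimal_graded_free_resolution n J b g D \<longleftrightarrow>
     (\<forall>j k. k < b 0 j \<longrightarrow> g (j, k) \<in> carrier (poly_ring n) \<and> homogeneous j (g (j, k))) \<and>
     (\<forall>i j k. k < b (Suc i) j \<longrightarrow>
        D i (j, k) \<in> graded_free n (b i) \<and>
        (\<forall>j' k'. (\<forall>m\<in>Poly_Mapping.keys (D i (j, k) (j', k')). exp_degree m + j' = j) \<and>
                 Poly_Mapping.lookup (D i (j, k) (j', k')) 0 = 0)) \<and>
     lin_to_ring g ` graded_free n (b 0) = J \<and>
     {v \<in> graded_free n (b 0). lin_to_ring g v = 0} = lin_to_free (D 0) ` graded_free n (b 1) \<and>
     (\<forall>i. {v \<in> graded_free n (b (Suc i)). lin_to_free (D i) v = (\<lambda>_. 0)} =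
          lin_to_free (D (Suc i)) ` graded_free n (b (Suc (Suc i))))"

text \<open>
  \<open>graded_betti n J i j\<close> is \<open>\<beta>\<^sub>i\<^sub>,\<^sub>j(J)\<close>. Minimal graded free resolutions of a graded ideal exist
  and are unique up to isomorphism, so the choice is immaterial.
\<close>

definition graded_betti :: "nat \<Rightarrow> 'k::field mpoly set \<Rightarrow> nat \<Rightarrow> nat \<Rightarrow> nat" where
  "graded_betti n J = (SOME b. \<exists>g D. minimal_graded_free_resolution n J b g D)"

text \<open>
  The second index is \<open>l = i + j\<close>; quantifying over \<open>l\<close> instead of over a natural number
  \<open>j\<close> also covers negative \<open>j\<close>.
\<close>

definition has_linear_resolution :: "nat \<Rightarrow> 'k::field mpoly set \<Rightarrow> bool" where
  "has_linear_resolution n J \<longleftrightarrow>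
     (\<exists>d. monomial_ideal_generated_in_degree n d J \<and>
          (\<forall>i l. l \<noteq> i + d \<longrightarrow> graded_betti n J i l = 0))"

end

theory Submission
  imports Defs "HOL-Library.Function_Algebras" "HOL.Vector_Spaces"
begin

text \<open>
  All three properties of \<open>I\<^sup>s\<close> are read off the exponent vectors of its generators, the products
  of \<open>s\<close> path monomials. For \<open>n > 2t\<close>, the generators \<open>u\<^sub>1\<^sup>s\<close> and \<open>u\<^sub>1\<^sup>s\<^sup>-\<^sup>1 u\<^sub>t\<^sub>+\<^sub>2\<close> violate
  quasi-linearity: no variable \<open>x\<^sub>p\<close> with \<open>p \<ge> t + 2\<close> takes \<open>u\<^sub>1\<^sup>s\<close> into the ideal of the other
  generators. For \<open>n \<le> 2t\<close>, sorting the generators by decreasing degree in \<open>x\<^sub>1, \<dots>, x\<^sub>t\<close> gives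
  linear quotients, since a generator can be improved by replacing a factor \<open>u\<^sub>p\<^sub>+\<^sub>1\<close> with \<open>u\<^sub>p\<close>,
  that is, \<open>x\<^sub>p\<^sub>+\<^sub>t\<close> with \<open>x\<^sub>p\<close>.

  Linear quotients make the Koszul homology of the ideal vanish outside degree \<open>d\<close>, by a cone
  construction on each quotient \<open>R/(V)\<close> of the filtration; dimension shifting along an arbitrary
  minimal resolution carries this over to the graded Betti numbers. Conversely, both linear quotients
  and a linear resolution imply quasi-linearity: the former by walking down the order, the latter
  because the relations between two generators are generated by linear ones.
\<close>

section \<open>Exponent vectors\<close>

text \<open>\<open>graded_betti\<close> selects an unspecified minimal resolution. A statement about
  it therefore needs an existence proof, without which the selected numbers are unconstrained, and
  an argument valid for every minimal resolution. Existence is a degreewise Nakayama argument: each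
  degree of a graded submodule is finite-dimensional over the field, and generators are chosen
  minimally modulo what lower degrees produce. Vanishing of Koszul homology is a property of the
  submodule alone, so it can be passed from a module to the kernel of whichever minimal cover was
  selected. The ideal is embedded in the free module of rank one, which lets the augmentation and
  the differentials be treated alike.

  The bound 2t has a counting origin: for n \<le> 2t, every window of length t contains exactly one
  of x_l and x_(l+t) when 1 \<le> l \<le> t, so the exponents at the first t variables determine a
  generator of a given power. For n > 2t, a window can start at t + 2, and the variable x_(t+1) is
  then missing from it and from the first window; this gap blocks moves by one variable.\<close>

abbreviation lookup :: "('a \<Rightarrow>\<^sub>0 'b::zero) \<Rightarrow> 'a \<Rightarrow> 'b" where
  "lookup \<equiv> Poly_Mapping.lookup"

abbreviation keys :: "('a \<Rightarrow>\<^sub>0 'b::zero) \<Rightarrow> 'a set" where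
  "keys \<equiv> Poly_Mapping.keys"

abbreviation monom :: "(nat \<Rightarrow>\<^sub>0 nat) \<Rightarrow> 'k::field mpoly" where
  "monom m \<equiv> Poly_Mapping.single m 1"

definition unit_exp :: "nat \<Rightarrow> (nat \<Rightarrow>\<^sub>0 nat)" where
  "unit_exp i = Poly_Mapping.single i 1"

definition divides_exp :: "(nat \<Rightarrow>\<^sub>0 nat) \<Rightarrow> (nat \<Rightarrow>\<^sub>0 nat) \<Rightarrow> bool" (infix "\<preceq>" 50) where
  "a \<preceq> m \<longleftrightarrow> (\<forall>i. lookup a i \<le> lookup m i)"

definition exps :: "nat \<Rightarrow> (nat \<Rightarrow>\<^sub>0 nat) set" where
  "exps n = {m. keys m \<subseteq> {1..n}}"

definition upset :: "nat \<Rightarrow> (nat \<Rightarrow>\<^sub>0 nat) set \<Rightarrow> (nat \<Rightarrow>\<^sub>0 nat) set" where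
  "upset n E = {m \<in> exps n. \<exists>a\<in>E. a \<preceq> m}"

text \<open>A monomial ideal is spanned over the field by its monomials, so membership is a
  condition on the support alone. \<open>Idl_monom\<close> identifies this set with the generated
  ideal.\<close>

definition mon_ideal :: "nat \<Rightarrow> (nat \<Rightarrow>\<^sub>0 nat) set \<Rightarrow> 'k::field mpoly set" where
  "mon_ideal n E = {p. keys p \<subseteq> upset n E}"

lemma divides_exp_refl [simp]: "a \<preceq> a"
  by (simp add: divides_exp_def)

lemma divides_exp_trans: "a \<preceq> b \<Longrightarrow> b \<preceq> c \<Longrightarrow> a \<preceq> c"
  by (meson divides_exp_def order_trans)

lemma divides_exp_add [simp]: "a \<preceq> a + b" "a \<preceq> b + a"
  by (simp_all add: divides_exp_def lookup_add)

lemma divides_exp_antisym: "a \<preceq> b \<Longrightarrow> b \<preceq> a \<Longrightarrow> a = b"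
  by (rule poly_mapping_eqI) (simp add: divides_exp_def order_antisym)

lemma divides_exp_diff_add: "a \<preceq> m \<Longrightarrow> m - a + a = m"
  by (rule poly_mapping_eqI) (simp add: divides_exp_def lookup_add lookup_minus)

lemma lookup_unit_exp: "lookup (unit_exp i) j = (if i = j then 1 else 0)"
  by (simp add: unit_exp_def lookup_single when_def)

lemma unit_exp_divides_iff: "unit_exp i \<preceq> m \<longleftrightarrow> 0 < lookup m i"
proof
  assume "unit_exp i \<preceq> m"
  then have "lookup (unit_exp i) i \<le> lookup m i"
    unfolding divides_exp_def by blast
  then show "0 < lookup m i"
    by (simp add: lookup_unit_exp)
qed (auto simp: divides_exp_def lookup_unit_exp)

lemma exps_iff: "m \<in> exps n \<longleftrightarrow> (\<forall>i. lookup m i \<noteq> 0 \<longrightarrow> 1 \<le> i \<and> i \<le> n)"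
  by (auto simp: exps_def in_keys_iff subset_iff)

lemma exps_add_iff: "a + b \<in> exps n \<longleftrightarrow> a \<in> exps n \<and> b \<in> exps n"
  by (auto simp: exps_iff lookup_add)

lemma unit_exp_in_exps_iff: "unit_exp i \<in> exps n \<longleftrightarrow> i \<in> {1..n}"
  by (auto simp: exps_iff lookup_unit_exp)

lemma zero_in_exps [simp]: "0 \<in> exps n"
  by (simp add: exps_iff)

lemma exps_diff: "m \<in> exps n \<Longrightarrow> m - a \<in> exps n"
  by (auto simp: exps_iff lookup_minus)

lemma exp_degree_superset:
  "finite A \<Longrightarrow> keys m \<subseteq> A \<Longrightarrow> exp_degree m = (\<Sum>i\<in>A. lookup m i)"
  unfolding exp_degree_def by (rule sum.mono_neutral_left) (auto simp: in_keys_iff)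

lemma exp_degree_add: "exp_degree (a + b) = exp_degree a + exp_degree b"
proof -
  let ?A = "keys a \<union> keys b"
  have "exp_degree (a + b) = (\<Sum>i\<in>?A. lookup (a + b) i)"
    by (rule exp_degree_superset) (use keys_add[of a b] in auto)
  moreover have "exp_degree a = (\<Sum>i\<in>?A. lookup a i)" "exp_degree b = (\<Sum>i\<in>?A. lookup b i)"
    by (rule exp_degree_superset; simp)+
  ultimately show ?thesis
    by (simp add: lookup_add sum.distrib)
qed

lemma exp_degree_unit_exp [simp]: "exp_degree (unit_exp i) = 1"
  by (simp add: exp_degree_def unit_exp_def)

lemma exp_degree_zero [simp]: "exp_degree 0 = 0"
  by (simp add: exp_degree_def)

lemma exp_degree_eq_0_iff: "exp_degree m = 0 \<longleftrightarrow> m = 0"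
proof
  assume "exp_degree m = 0"
  then have "\<forall>i\<in>keys m. lookup m i = 0"
    by (simp add: exp_degree_def)
  then show "m = 0"
    by (intro poly_mapping_eqI) (auto simp: in_keys_iff)
qed simp

lemma divides_exp_degree_eq:
  assumes "a \<preceq> m" "exp_degree m \<le> exp_degree a"
  shows "a = m"
proof -
  have "exp_degree m = exp_degree (m - a) + exp_degree a"
    using divides_exp_diff_add[OF assms(1)] exp_degree_add by metis
  then have "m - a = 0"
    using assms(2) exp_degree_eq_0_iff by simp
  then show ?thesis
    using divides_exp_diff_add[OF assms(1)] by simp
qed

lemma divides_exp_degree_le: "a \<preceq> m \<Longrightarrow> exp_degree a \<le> exp_degree m"
  by (metis divides_exp_diff_add exp_degree_add le_add2)

lemma exp_nonzero_split:
  assumes "m \<noteq> 0"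
  obtains i a where "m = unit_exp i + a" "0 < lookup m i"
proof -
  obtain i where "lookup m i \<noteq> 0"
    using assms by (metis lookup_zero poly_mapping_eqI)
  then have "unit_exp i \<preceq> m"
    by (simp add: unit_exp_divides_iff)
  then have "m = unit_exp i + (m - unit_exp i)"
    by (metis divides_exp_diff_add add.commute)
  then show ?thesis
    using that \<open>lookup m i \<noteq> 0\<close> by blast
qed

lemma finite_exps_degree: "finite {m \<in> exps n. exp_degree m \<le> d}"
proof -
  let ?B = "{f. \<forall>i. (i \<in> {1..n} \<longrightarrow> f i \<in> {0..d}) \<and> (i \<notin> {1..n} \<longrightarrow> f i = (0::nat))}"
  have "lookup ` {m \<in> exps n. exp_degree m \<le> d} \<subseteq> ?B"
  proof clarsimp
    fix m i assume m: "m \<in> exps n" "exp_degree m \<le> d"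
    have "exp_degree m = (\<Sum>i\<in>{1..n}. lookup m i)"
      by (rule exp_degree_superset) (use m in \<open>auto simp: exps_def\<close>)
    then show "(Suc 0 \<le> i \<and> i \<le> n \<longrightarrow> lookup m i \<le> d) \<and> ((Suc 0 \<le> i \<longrightarrow> \<not> i \<le> n) \<longrightarrow> lookup m i = 0)"
      using m member_le_sum[of i "{1..n}" "lookup m"] by (fastforce simp: exps_iff)
  qed
  moreover have "finite ?B"
    by (rule finite_set_of_finite_funs) auto
  ultimately have "finite (lookup ` {m \<in> exps n. exp_degree m \<le> d})"
    by (rule finite_subset)
  then show ?thesis
    by (rule finite_imageD) (auto simp: inj_on_def intro: poly_mapping_eqI)
qed

lemma upset_add: "m \<in> upset n E \<Longrightarrow> a \<in> exps n \<Longrightarrow> a + m \<in> upset n E"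
  unfolding upset_def mem_Collect_eq exps_add_iff using divides_exp_trans divides_exp_add(2) by blast

lemma subset_upset: "E \<subseteq> exps n \<Longrightarrow> E \<subseteq> upset n E"
  unfolding upset_def using divides_exp_refl by blast


section \<open>Coefficients\<close>

lemma in_poly_ring_iff: "p \<in> carrier (poly_ring n) \<longleftrightarrow> keys p \<subseteq> exps n"
  by (auto simp: poly_ring_def exps_def)

lemma poly_ring_sel:
  "mult (poly_ring n) = (*)" "one (poly_ring n) = 1" "zero (poly_ring n) = 0" "add (poly_ring n) = (+)"
  by (simp_all add: poly_ring_def)

lemma sum_single_keys: "(\<Sum>m\<in>keys p. Poly_Mapping.single m (lookup p m)) = p"
proof (rule poly_mapping_eqI)
  fix k
  show "lookup (\<Sum>m\<in>keys p. Poly_Mapping.single m (lookup p m)) k = lookup p k"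
    by (simp add: lookup_sum lookup_single when_def sum.delta in_keys_iff)
qed

text \<open>Subtraction of exponent vectors is truncated, so \<open>m - a\<close> is the true
  quotient only under \<open>a \<preceq> m\<close>; hence the guard.\<close>

lemma lookup_single_mult:
  fixes p :: "'k::field mpoly"
  shows "lookup (Poly_Mapping.single a c * p) m = (if a \<preceq> m then c * lookup p (m - a) else 0)"
proof -
  have eq: "a + k = m \<longleftrightarrow> a \<preceq> m \<and> k = m - a" for k
    by (metis add.commute add_diff_cancel_left' divides_exp_add(1) divides_exp_diff_add)
  have "Poly_Mapping.single a c * p =
      (\<Sum>k\<in>keys p. Poly_Mapping.single (a + k) (c * lookup p k))"
    by (subst sum_single_keys[of p, symmetric]) (simp add: sum_distrib_left mult_single)
  then have "lookup (Poly_Mapping.single a c * p) m =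
      (\<Sum>k\<in>keys p. if a \<preceq> m \<and> k = m - a then c * lookup p k else 0)"
    by (simp add: lookup_sum lookup_single when_def eq)
  also have "\<dots> = (if a \<preceq> m then c * lookup p (m - a) else 0)"
    by (auto simp: sum.delta in_keys_iff)
  finally show ?thesis .
qed

lemma var_monom: "var i = monom (unit_exp i)"
  by (simp add: var_def unit_exp_def)

lemma lookup_var_mult:
  fixes p :: "'k::field mpoly"
  shows "lookup (var i * p) m = (if 0 < lookup m i then lookup p (m - unit_exp i) else 0)"
  unfolding var_monom lookup_single_mult unit_exp_divides_iff by simp

lemma lookup_const_mult [simp]:
  fixes p :: "'k::field mpoly"
  shows "lookup (Poly_Mapping.single 0 c * p) m = c * lookup p m"
  by (simp add: lookup_single_mult divides_exp_def)

lemma monom_mult: "monom a * monom b = (monom (a + b) :: 'k::field mpoly)"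
  by (simp add: mult_single)

lemma keys_monom [simp]: "keys (monom m :: 'k::field mpoly) = {m}"
  by simp

lemma monom_in_mon_ideal_iff: "(monom m :: 'k::field mpoly) \<in> mon_ideal n E \<longleftrightarrow> m \<in> upset n E"
  by (simp add: mon_ideal_def)

lemma monom_eq_iff [simp]: "(monom a :: 'k::field mpoly) = monom b \<longleftrightarrow> a = b"
  by (metis keys_monom singleton_inject)

lemma inj_monom: "inj (monom :: _ \<Rightarrow> 'k::field mpoly)"
  by (simp add: inj_def)

lemma keys_mult_sub: "m \<in> keys (p * q) \<Longrightarrow> \<exists>a\<in>keys p. \<exists>b\<in>keys q. m = a + b"
  for p q :: "'k::field mpoly"
  using keys_mult[of p q] by blast


section \<open>Monomial ideals\<close>

lemma mon_ideal_ideal: "ideal (mon_ideal n E :: 'k::field mpoly set) (poly_ring n)"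
proof -
  let ?R = "poly_ring n :: 'k mpoly ring"
  interpret cring ?R by (rule poly_ring_cring)
  have sub: "mon_ideal n E \<subseteq> carrier ?R"
    by (auto simp: mon_ideal_def in_poly_ring_iff upset_def)
  have l: "r * p \<in> mon_ideal n E" if "p \<in> mon_ideal n E" "r \<in> carrier ?R" for r p
    using that keys_mult_sub[of _ r p] upset_add
    by (fastforce simp: mon_ideal_def in_poly_ring_iff)
  have add: "p + q \<in> mon_ideal n E" if "p \<in> mon_ideal n E" "q \<in> mon_ideal n E" for p q :: "'k mpoly"
    using that keys_add[of p q] by (auto simp: mon_ideal_def)
  show ?thesis
  proof (rule idealI[OF local.ring_axioms])
    show "subgroup (mon_ideal n E) (add_monoid ?R)"
    proof (rule add.subgroupI)
      show "(mon_ideal n E :: 'k mpoly set) \<noteq> {}"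
        by (auto simp: mon_ideal_def intro!: exI[of _ 0])
      fix p assume p: "p \<in> (mon_ideal n E :: 'k mpoly set)"
      have m: "- p \<in> mon_ideal n E"
        using p by (simp add: mon_ideal_def keys_def)
      have "\<ominus>\<^bsub>?R\<^esub> p = - p"
        using m p sub by (intro minus_equality) (auto simp: poly_ring_sel)
      then show "\<ominus>\<^bsub>?R\<^esub> p \<in> mon_ideal n E"
        using m by simp
    qed (use sub add in \<open>auto simp: poly_ring_sel\<close>)
  qed (use l in \<open>auto simp: poly_ring_sel mult.commute\<close>)
qed

lemma ideal_sum_mem:
  assumes "ideal J (poly_ring n :: 'k::field mpoly ring)" "\<And>i. i \<in> A \<Longrightarrow> f i \<in> J"
  shows "sum f A \<in> J"
proof -
  interpret J: ideal J "poly_ring n :: 'k mpoly ring" by fact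
  have "0 \<in> J" "\<And>p q. p \<in> J \<Longrightarrow> q \<in> J \<Longrightarrow> p + q \<in> J"
    using additive_subgroup.zero_closed[OF J.additive_subgroup_axioms]
      additive_subgroup.a_closed[OF J.additive_subgroup_axioms]
    by (simp_all add: poly_ring_sel)
  then show ?thesis
    using assms(2) by (induction A rule: infinite_finite_induct) auto
qed

lemma monom_in_poly_ring_iff: "(Poly_Mapping.single m c :: 'k::field mpoly) \<in> carrier (poly_ring n) \<longleftrightarrow> c = 0 \<or> m \<in> exps n"
  by (simp add: in_poly_ring_iff)

lemma Idl_monom:
  assumes "E \<subseteq> exps n"
  shows "Idl\<^bsub>poly_ring n\<^esub> (monom ` E) = (mon_ideal n E :: 'k::field mpoly set)"
proof -
  let ?R = "poly_ring n :: 'k mpoly ring"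
  interpret cring ?R by (rule poly_ring_cring)
  have car: "monom ` E \<subseteq> carrier ?R"
    using assms by (auto simp: monom_in_poly_ring_iff)
  have "monom ` E \<subseteq> (mon_ideal n E :: 'k mpoly set)"
    using subset_upset[OF assms] by (auto simp: mon_ideal_def)
  then have 1: "Idl\<^bsub>?R\<^esub> (monom ` E) \<subseteq> mon_ideal n E"
    by (rule genideal_minimal[OF mon_ideal_ideal])
  \<comment> \<open>Each term of \<open>p\<close> is a ring multiple of a generating monomial, and
    \<open>p\<close> is the sum of its terms.\<close>
  have "p \<in> Idl\<^bsub>?R\<^esub> (monom ` E)" if p: "p \<in> mon_ideal n E" for p
  proof -
    interpret I: ideal "Idl\<^bsub>?R\<^esub> (monom ` E)" ?R
      by (rule genideal_ideal[OF car])
    have "Poly_Mapping.single m (lookup p m) \<in> Idl\<^bsub>?R\<^esub> (monom ` E)" if "m \<in> keys p" for m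
    proof -
      have "m \<in> upset n E"
        using that p by (auto simp: mon_ideal_def)
      then obtain a where a: "a \<in> E" "a \<preceq> m" "m \<in> exps n"
        by (auto simp: upset_def)
      then have "monom a \<in> Idl\<^bsub>?R\<^esub> (monom ` E)"
        using genideal_self[OF car] by blast
      moreover have "Poly_Mapping.single (m - a) (lookup p m) \<in> carrier ?R"
        using a by (simp add: monom_in_poly_ring_iff exps_diff)
      ultimately have "Poly_Mapping.single (m - a) (lookup p m) * monom a \<in> Idl\<^bsub>?R\<^esub> (monom ` E)"
        using I.I_l_closed by (simp add: poly_ring_sel)
      then show ?thesis
        using a by (simp add: mult_single divides_exp_diff_add)
    qed
    then have "(\<Sum>m\<in>keys p. Poly_Mapping.single m (lookup p m)) \<in> Idl\<^bsub>?R\<^esub> (monom ` E)"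
      by (rule ideal_sum_mem[OF I.is_ideal])
    then show ?thesis
      by (simp add: sum_single_keys)
  qed
  then show ?thesis
    using 1 by blast
qed

lemma monomials_eq: "monomials n = monom ` exps n"
  by (auto simp: monomials_def exps_def)

text \<open>Generators of equal degree cannot properly divide each other, so every monomial
  generating set of the ideal contains all of them. This gives both minimality and the uniqueness
  demanded by the description operator.\<close>

lemma minimal_monomial_gens_mon_ideal:
  assumes E: "E \<subseteq> exps n" and deg: "\<And>a. a \<in> E \<Longrightarrow> exp_degree a = d"
  shows "minimal_monomial_gens n (mon_ideal n E :: 'k::field mpoly set) = monom ` E"
  unfolding minimal_monomial_gens_def
proof (rule the_equality)
  let ?J = "mon_ideal n E :: 'k mpoly set"
  have key: "E \<subseteq> E'" if "E' \<subseteq> exps n" and eq: "Idl\<^bsub>poly_ring n\<^esub> (monom ` E') = ?J" for E'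
  proof
    fix a assume a: "a \<in> E"
    have mi: "mon_ideal n E' = ?J"
      using Idl_monom[OF that(1), where 'k = 'k] eq by simp
    have up: "m \<in> upset n E' \<longleftrightarrow> m \<in> upset n E" for m
      using monom_in_mon_ideal_iff[where 'k = 'k] mi by metis
    have "a \<in> upset n E'"
      using a subset_upset[OF E] up by blast
    then obtain a' where a': "a' \<in> E'" "a' \<preceq> a"
      by (auto simp: upset_def)
    then have "a' \<in> upset n E"
      using subset_upset[OF that(1)] up by blast
    then obtain a'' where a'': "a'' \<in> E" "a'' \<preceq> a'"
      by (auto simp: upset_def)
    have "a'' = a"
      by (rule divides_exp_degree_eq) (use a a' a'' deg divides_exp_trans in auto)
    then have "a' = a"
      using a' a'' divides_exp_antisym by blast
    then show "a \<in> E'"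
      using a' by simp
  qed
  show "monom ` E \<subseteq> monomials n \<and> Idl\<^bsub>poly_ring n\<^esub> (monom ` E) = ?J \<and>
      (\<forall>G'. G' \<subset> monom ` E \<longrightarrow> Idl\<^bsub>poly_ring n\<^esub> G' \<noteq> ?J)"
  proof (intro conjI allI impI notI)
    show "monom ` E \<subseteq> monomials n"
      using E by (auto simp: monomials_eq)
    show "Idl\<^bsub>poly_ring n\<^esub> (monom ` E) = ?J"
      by (rule Idl_monom[OF E])
    fix G' :: "'k mpoly set" assume G': "G' \<subset> monom ` E" "Idl\<^bsub>poly_ring n\<^esub> G' = ?J"
    obtain E' where E': "G' = monom ` E'" "E' \<subseteq> E"
      using G'(1) by (meson psubsetE subset_imageE)
    then have "E \<subseteq> E'"
      using key[of E'] G' E by blast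
    then show False
      using E' G' by blast
  qed
  fix G :: "'k mpoly set"
  assume G: "G \<subseteq> monomials n \<and> Idl\<^bsub>poly_ring n\<^esub> G = ?J \<and>
      (\<forall>G'. G' \<subset> G \<longrightarrow> Idl\<^bsub>poly_ring n\<^esub> G' \<noteq> ?J)"
  then obtain E' where E': "G = monom ` E'" "E' \<subseteq> exps n"
    unfolding monomials_eq by (meson subset_imageE)
  then have "E \<subseteq> E'"
    using key[of E'] G by blast
  then have "monom ` E \<subseteq> G"
    using E' by blast
  moreover have "\<not> monom ` E \<subset> G"
    using G Idl_monom[OF E, where 'k = 'k] by blast
  ultimately show "G = monom ` E"
    by blast
qed

text \<open>The colon ideal of a monomial ideal by \<open>e\<close> is generated by the quotients
  \<open>lcm(f, e) / e\<close>. It is generated by variables iff each such quotient is divisible by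
  a variable that itself lies in the colon ideal; \<open>p\<close> divides the quotient exactly when
  \<open>e\<close> has the smaller exponent there.\<close>

lemma generated_by_variables_colon_iff:
  assumes F: "F \<subseteq> exps n" and e: "e \<in> exps n"
  shows "generated_by_variables n (colon n (mon_ideal n F :: 'k::field mpoly set) (monom e)) \<longleftrightarrow>
    (\<forall>f\<in>F. \<exists>p. lookup e p < lookup f p \<and> (\<exists>w\<in>F. w \<preceq> e + unit_exp p))"
    (is "?L \<longleftrightarrow> ?R")
proof -
  let ?C = "colon n (mon_ideal n F :: 'k mpoly set) (monom e)"
  have keys_mult_monom: "keys (r * monom e) = (\<lambda>m. m + e) ` keys r" for r :: "'k mpoly"
  proof (intro subset_antisym subsetI)
    fix m assume "m \<in> keys (r * monom e)"
    then show "m \<in> (\<lambda>m. m + e) ` keys r"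
      using keys_mult_sub[of m r "monom e"] by auto
  next
    fix m assume "m \<in> (\<lambda>m. m + e) ` keys r"
    then obtain k where k: "k \<in> keys r" "m = k + e"
      by blast
    then show "m \<in> keys (r * monom e)"
      using lookup_single_mult[of e 1 r m] by (simp add: in_keys_iff mult.commute)
  qed
  have C: "r \<in> ?C \<longleftrightarrow> keys r \<subseteq> exps n \<and> (\<forall>m\<in>keys r. m + e \<in> upset n F)" for r
    by (auto simp: colon_def in_poly_ring_iff mon_ideal_def keys_mult_monom)
  have Cm: "monom m \<in> ?C \<longleftrightarrow> m \<in> exps n \<and> (\<exists>w\<in>F. w \<preceq> m + e)" for m
    using e by (auto simp: C upset_def exps_add_iff)
  have gen: "Idl\<^bsub>poly_ring n\<^esub> (var ` V) = (mon_ideal n (unit_exp ` V) :: 'k mpoly set)" if "V \<subseteq> {1..n}" for V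
  proof -
    have "unit_exp ` V \<subseteq> exps n"
      using that by (auto simp: unit_exp_in_exps_iff)
    moreover have "var ` V = (monom ` unit_exp ` V :: 'k mpoly set)"
      by (simp add: image_image var_monom)
    ultimately show ?thesis
      using Idl_monom by metis
  qed
  have up: "m \<in> upset n (unit_exp ` V) \<longleftrightarrow> m \<in> exps n \<and> (\<exists>i\<in>V. 0 < lookup m i)" for m V
    by (auto simp: upset_def unit_exp_divides_iff)
  show ?thesis
  proof
    assume ?L
    then obtain V where V: "V \<subseteq> {1..n}" "?C = mon_ideal n (unit_exp ` V)"
      by (auto simp: generated_by_variables_def gen)
    have iff: "m \<in> exps n \<and> (\<exists>w\<in>F. w \<preceq> m + e) \<longleftrightarrow> m \<in> exps n \<and> (\<exists>i\<in>V. 0 < lookup m i)" for m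
      using Cm[of m] unfolding V(2) monom_in_mon_ideal_iff up by simp
    show ?R
    proof
      fix f assume f: "f \<in> F"
      \<comment> \<open>Truncated subtraction makes \<open>f - e\<close> the exponent of
        \<open>lcm(f, e) / e\<close>, so this monomial lies in the colon ideal.\<close>
      have "f \<preceq> (f - e) + e"
        by (auto simp: divides_exp_def lookup_add lookup_minus)
      moreover have "f - e \<in> exps n"
        using f F by (blast intro: exps_diff)
      ultimately obtain i where i: "i \<in> V" "0 < lookup (f - e) i"
        using iff[of "f - e"] f by blast
      have "unit_exp i \<in> exps n"
        using i V(1) by (auto simp: unit_exp_in_exps_iff)
      moreover have "0 < lookup (unit_exp i) i"
        by (simp add: lookup_unit_exp)
      ultimately obtain w where "w \<in> F" "w \<preceq> unit_exp i + e"
        using iff[of "unit_exp i"] i by blast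
      then show "\<exists>p. lookup e p < lookup f p \<and> (\<exists>w\<in>F. w \<preceq> e + unit_exp p)"
        using i by (auto simp: lookup_minus add.commute)
    qed
  next
    assume R: ?R
    \<comment> \<open>All variables in the colon ideal; a generating set of variables can only be
      this one.\<close>
    define V where "V = {i \<in> {1..n}. \<exists>w\<in>F. w \<preceq> e + unit_exp i}"
    have h: "m + e \<in> upset n F \<longleftrightarrow> m \<in> upset n (unit_exp ` V)" if m: "m \<in> exps n" for m
    proof
      assume "m + e \<in> upset n F"
      then obtain f where f: "f \<in> F" "f \<preceq> m + e"
        by (auto simp: upset_def)
      then obtain p where p: "lookup e p < lookup f p" "\<exists>w\<in>F. w \<preceq> e + unit_exp p"
        using R by blast
      have "p \<in> {1..n}"
        using p f F by (fastforce simp: exps_iff)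
      moreover have "0 < lookup m p"
      proof -
        have "lookup f p \<le> lookup m p + lookup e p"
          using f by (auto simp: divides_exp_def lookup_add)
        then show ?thesis
          using p by simp
      qed
      ultimately show "m \<in> upset n (unit_exp ` V)"
        using m p by (auto simp: up V_def)
    next
      assume "m \<in> upset n (unit_exp ` V)"
      then obtain i w where i: "0 < lookup m i" "w \<in> F" "w \<preceq> e + unit_exp i"
        by (auto simp: up V_def)
      have "e + unit_exp i \<preceq> m + e"
        using i by (auto simp: divides_exp_def lookup_add lookup_unit_exp)
      then have "w \<preceq> m + e"
        using i divides_exp_trans by blast
      then show "m + e \<in> upset n F"
        using i m e by (auto simp: upset_def exps_add_iff)
    qed
    have "upset n (unit_exp ` V) \<subseteq> exps n"
      by (simp add: upset_def)
    then have "keys r \<subseteq> exps n \<and> (\<forall>m\<in>keys r. m + e \<in> upset n F) \<longleftrightarrow>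
        keys r \<subseteq> upset n (unit_exp ` V)" for r :: "'k mpoly"
      using h[of "_ :: nat \<Rightarrow>\<^sub>0 nat"] by fast
    then have "r \<in> ?C \<longleftrightarrow> r \<in> mon_ideal n (unit_exp ` V)" for r
      unfolding C by (simp add: mon_ideal_def)
    then have "?C = mon_ideal n (unit_exp ` V)"
      by blast
    also have "\<dots> = Idl\<^bsub>poly_ring n\<^esub> (var ` V)"
      by (rule gen[symmetric]) (auto simp: V_def)
    finally have "?C = Idl\<^bsub>poly_ring n\<^esub> (var ` V)" .
    then show ?L
      unfolding generated_by_variables_def by (intro exI[of _ V]) (auto simp: V_def)
  qed
qed

section \<open>Exponents of powers of monomial ideals\<close>

fun sums_of :: "(nat \<Rightarrow>\<^sub>0 nat) set \<Rightarrow> nat \<Rightarrow> (nat \<Rightarrow>\<^sub>0 nat) set" where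
  "sums_of E 0 = {0}"
| "sums_of E (Suc s) = {a + b |a b. a \<in> sums_of E s \<and> b \<in> E}"

lemma sums_of_exps: "E \<subseteq> exps n \<Longrightarrow> sums_of E s \<subseteq> exps n"
  by (induction s) (auto simp: exps_add_iff)

lemma ideal_prod_mon_ideal:
  assumes E: "E \<subseteq> exps n" and F: "F \<subseteq> exps n"
  shows "ideal_prod (poly_ring n) (mon_ideal n E) (mon_ideal n F :: 'k::field mpoly set) =
    mon_ideal n {a + b |a b. a \<in> E \<and> b \<in> F}" (is "_ = mon_ideal n ?S")
proof
  let ?R = "poly_ring n :: 'k mpoly ring"
  interpret cring ?R by (rule poly_ring_cring)
  have id: "ideal (ideal_prod ?R (mon_ideal n E) (mon_ideal n F)) ?R"
    by (rule ideal_prod_is_ideal[OF mon_ideal_ideal mon_ideal_ideal])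
  have S: "?S \<subseteq> exps n"
    using E F by (auto simp: exps_add_iff)
  have "monom ` ?S \<subseteq> ideal_prod ?R (mon_ideal n E) (mon_ideal n F)"
  proof clarify
    fix a b assume ab: "a \<in> E" "b \<in> F"
    have "monom a \<in> (mon_ideal n E :: 'k mpoly set)" "monom b \<in> (mon_ideal n F :: 'k mpoly set)"
      using ab subset_upset E F by (auto simp: monom_in_mon_ideal_iff)
    then have "monom a \<otimes>\<^bsub>?R\<^esub> monom b \<in> ideal_prod ?R (mon_ideal n E) (mon_ideal n F)"
      by (rule ideal_prod.prod)
    then show "monom (a + b) \<in> ideal_prod ?R (mon_ideal n E) (mon_ideal n F)"
      by (simp add: poly_ring_sel monom_mult)
  qed
  then show "mon_ideal n ?S \<subseteq> ideal_prod ?R (mon_ideal n E) (mon_ideal n F)"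
    using genideal_minimal[OF id] unfolding Idl_monom[OF S, symmetric] by simp
  show "ideal_prod ?R (mon_ideal n E) (mon_ideal n F) \<subseteq> mon_ideal n ?S"
  proof
    fix p assume "p \<in> ideal_prod ?R (mon_ideal n E) (mon_ideal n F)"
    then show "p \<in> mon_ideal n ?S"
    proof induction
      case (prod i j)
      have "m \<in> upset n ?S" if m: "m \<in> keys (i * j)" for m
      proof -
        obtain a b where ab: "a \<in> keys i" "b \<in> keys j" "m = a + b"
          using keys_mult_sub[OF m] by blast
        then have "a \<in> upset n E" "b \<in> upset n F"
          using prod by (auto simp: mon_ideal_def)
        then obtain a' b' where "a' \<in> E" "a' \<preceq> a" "b' \<in> F" "b' \<preceq> b" "a \<in> exps n" "b \<in> exps n"
          by (auto simp: upset_def)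
        moreover from this have "a' + b' \<preceq> m"
          using ab by (auto simp: divides_exp_def lookup_add add_mono)
        ultimately show ?thesis
          using ab by (auto simp: upset_def exps_add_iff)
      qed
      then show ?case
        by (auto simp: mon_ideal_def poly_ring_sel)
    next
      case (sum s1 s2)
      then show ?case
        using keys_add[of s1 s2] by (auto simp: mon_ideal_def poly_ring_sel)
    qed
  qed
qed

lemma ideal_power_mon_ideal:
  assumes E: "E \<subseteq> exps n"
  shows "ideal_power n (mon_ideal n E :: 'k::field mpoly set) s = mon_ideal n (sums_of E s)"
proof (induction s)
  case 0
  have "carrier (poly_ring n) = (mon_ideal n {0} :: 'k mpoly set)"
    by (auto simp: mon_ideal_def upset_def in_poly_ring_iff divides_exp_def)
  then show ?case
    by (simp add: ideal_power_def ideals_set_def nat_pow_def)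
next
  case (Suc s)
  then show ?case
    using ideal_prod_mon_ideal[OF sums_of_exps[OF E] E, of s, where 'k = 'k]
    by (simp add: ideal_power_def ideals_set_def nat_pow_def)
qed

section \<open>Combinatorial linear quotients\<close>

text \<open>This is quasi-linearity in terms of exponents. When all of \<open>E\<close> has one
  degree, the divisor \<open>w\<close> of \<open>u + unit_exp p\<close> arises from \<open>u\<close>
  by exchanging one variable for \<open>x_p\<close>, a variable in which \<open>v\<close> exceeds
  \<open>u\<close>.\<close>

definition linear_steps :: "(nat \<Rightarrow>\<^sub>0 nat) set \<Rightarrow> bool" where
  "linear_steps E \<longleftrightarrow> (\<forall>u\<in>E. \<forall>v\<in>E - {u}. \<exists>p. lookup u p < lookup v p \<and>
     (\<exists>w\<in>E - {u}. w \<preceq> u + unit_exp p))"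

text \<open>In contrast to \<open>linear_steps\<close>, only divisors that come earlier in the list
  count. For \<open>j = 0\<close> the condition is vacuous, which matches the start at the second
  generator.\<close>

definition linear_quotient_order :: "(nat \<Rightarrow>\<^sub>0 nat) list \<Rightarrow> bool" where
  "linear_quotient_order es \<longleftrightarrow> (\<forall>j<length es. \<forall>i<j. \<exists>p. lookup (es ! j) p < lookup (es ! i) p \<and>
     (\<exists>k<j. es ! k \<preceq> es ! j + unit_exp p))"

lemma quasi_linear_mon_ideal_iff:
  assumes E: "E \<subseteq> exps n" and deg: "\<And>a. a \<in> E \<Longrightarrow> exp_degree a = d"
  shows "quasi_linear n (mon_ideal n E :: 'k::field mpoly set) \<longleftrightarrow> linear_steps E"
proof -
  have "monom ` E - {monom u} = (monom ` (E - {u}) :: 'k mpoly set)" for u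
    by (auto simp: inj_image_mem_iff)
  then have "Idl\<^bsub>poly_ring n\<^esub> (monom ` E - {monom u}) = (mon_ideal n (E - {u}) :: 'k mpoly set)" for u
    using Idl_monom[of "E - {u}" n, where 'k = 'k] E by (metis Diff_subset subset_trans)
  moreover have "generated_by_variables n (colon n (mon_ideal n (E - {u}) :: 'k mpoly set) (monom u)) \<longleftrightarrow>
    (\<forall>v\<in>E - {u}. \<exists>p. lookup u p < lookup v p \<and> (\<exists>w\<in>E - {u}. w \<preceq> u + unit_exp p))" if "u \<in> E" for u
    by (rule generated_by_variables_colon_iff) (use E that in auto)
  ultimately show ?thesis
    unfolding quasi_linear_def minimal_monomial_gens_mon_ideal[OF E deg, simplified] linear_steps_def
    by simp
qed

lemma has_linear_quotients_mon_ideal_iff: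
  assumes E: "E \<subseteq> exps n" and deg: "\<And>a. a \<in> E \<Longrightarrow> exp_degree a = d"
  shows "has_linear_quotients n (mon_ideal n E :: 'k::field mpoly set) \<longleftrightarrow>
    (\<exists>es. distinct es \<and> set es = E \<and> linear_quotient_order es)"
proof -
  have main: "(\<forall>j. 1 \<le> j \<and> j < length fs \<longrightarrow>
        generated_by_variables n (colon n (Idl\<^bsub>poly_ring n\<^esub> (set (take j fs))) (fs ! j))) \<longleftrightarrow>
      linear_quotient_order es"
    if es: "set es = E" and fs: "fs = map monom es" for es and fs :: "'k mpoly list"
  proof -
    have "generated_by_variables n (colon n (Idl\<^bsub>poly_ring n\<^esub> (set (take j fs))) (fs ! j)) \<longleftrightarrow>
        (\<forall>i<j. \<exists>p. lookup (es ! j) p < lookup (es ! i) p \<and> (\<exists>k<j. es ! k \<preceq> es ! j + unit_exp p))"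
      if j: "j < length es" for j
    proof -
      have sub: "set (take j es) \<subseteq> exps n"
        using E es set_take_subset by fastforce
      have "set (take j fs) = monom ` set (take j es)" "fs ! j = monom (es ! j)"
        using j by (simp_all add: fs take_map)
      then have "generated_by_variables n (colon n (Idl\<^bsub>poly_ring n\<^esub> (set (take j fs))) (fs ! j)) \<longleftrightarrow>
        (\<forall>f\<in>set (take j es). \<exists>p. lookup (es ! j) p < lookup f p \<and>
          (\<exists>w\<in>set (take j es). w \<preceq> es ! j + unit_exp p))"
        using generated_by_variables_colon_iff[OF sub, of "es ! j", where 'k = 'k] Idl_monom[OF sub, where 'k = 'k] E es j
        by (auto simp: subset_iff)
      also have "set (take j es) = (\<lambda>i. es ! i) ` {..<j}"
        using j by (simp add: nth_image[symmetric] lessThan_atLeast0)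
      finally show ?thesis
        unfolding ball_simps bex_simps by (simp add: Ball_def Bex_def)
    qed
    then show ?thesis
      unfolding linear_quotient_order_def using fs by (metis One_nat_def Suc_leI length_map not_less_zero zero_less_iff_neq_zero)
  qed
  have gens: "minimal_monomial_gens n (mon_ideal n E) = (monom ` E :: 'k mpoly set)"
    by (rule minimal_monomial_gens_mon_ideal[OF E deg])
  show ?thesis
  proof
    assume "has_linear_quotients n (mon_ideal n E :: 'k mpoly set)"
    then obtain fs :: "'k mpoly list" where fs: "distinct fs" "set fs = monom ` E"
      and lq: "\<forall>j. 1 \<le> j \<and> j < length fs \<longrightarrow>
        generated_by_variables n (colon n (Idl\<^bsub>poly_ring n\<^esub> (set (take j fs))) (fs ! j))"
      unfolding has_linear_quotients_def gens by blast
    have "\<exists>es. fs = map monom es"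
      unfolding ex_map_conv using fs(2) by blast
    then obtain es where es: "fs = map monom es" ..
    have "set es = E"
      using fs(2) es by (simp add: inj_image_eq_iff[OF inj_monom])
    moreover have "distinct es"
      using fs(1) es by (simp add: distinct_map)
    ultimately show "\<exists>es. distinct es \<and> set es = E \<and> linear_quotient_order es"
      using main[OF _ es] lq by blast
  next
    assume "\<exists>es. distinct es \<and> set es = E \<and> linear_quotient_order es"
    then obtain es where es: "distinct es" "set es = E" "linear_quotient_order es"
      by blast
    have "distinct (map (monom :: _ \<Rightarrow> 'k mpoly) es)"
      using es(1) inj_monom[where 'k = 'k] by (simp add: distinct_map inj_on_def)
    then show "has_linear_quotients n (mon_ideal n E :: 'k mpoly set)"
      unfolding has_linear_quotients_def gens
      using main[OF es(2) refl] es by (intro exI[of _ "map monom es"]) simp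
  qed
qed

text \<open>Equal degrees leave a quotient of degree 1, that is, one variable.\<close>

lemma divides_unit_exp_step:
  assumes "a \<preceq> b + unit_exp p" "exp_degree a = exp_degree b"
  obtains q where "a + unit_exp q = b + unit_exp p"
proof -
  let ?r = "b + unit_exp p - a"
  have r: "?r + a = b + unit_exp p"
    by (rule divides_exp_diff_add[OF assms(1)])
  then have "exp_degree ?r + exp_degree a = exp_degree b + 1"
    by (metis exp_degree_add exp_degree_unit_exp)
  then have deg: "exp_degree ?r = 1"
    using assms(2) by simp
  then have "?r \<noteq> 0"
    using exp_degree_zero by force
  then obtain q c where q: "?r = unit_exp q + c"
    using exp_nonzero_split by blast
  then have "exp_degree c = 0"
    using deg by (simp add: exp_degree_add)
  then have "?r = unit_exp q"
    using q exp_degree_eq_0_iff by simp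
  then show ?thesis
    using r that by (simp add: add.commute)
qed

text \<open>Following the colon conditions, two generators are joined by linear moves inside the
  divisors of their least common multiple; the first move is what quasi-linearity asks for.\<close>

lemma linear_quotient_order_linear_steps:
  assumes lq: "linear_quotient_order es" and dist: "distinct es"
    and deg: "\<And>a. a \<in> set es \<Longrightarrow> exp_degree a = d"
  shows "linear_steps (set es)"
proof -
  have step: "\<exists>p. lookup (es ! i) p < lookup (es ! j) p \<and> (\<exists>w\<in>set es - {es ! i}. w \<preceq> es ! i + unit_exp p)"
    if "i < length es" "j < length es" "i \<noteq> j" for i j
    using that
  \<comment> \<open>\<open>i\<close> stays fixed and \<open>j\<close> decreases: a move from
    \<open>es ! j\<close> reaches an earlier element, until the walk meets \<open>es ! i\<close> or
    passes in front of it, where the colon condition at \<open>i\<close> applies directly.\<close>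
  proof (induction "i + j" arbitrary: j rule: less_induct)
    case less
    show ?case
    proof (cases "j < i")
      case True
      then obtain p k where "lookup (es ! i) p < lookup (es ! j) p" "k < i" "es ! k \<preceq> es ! i + unit_exp p"
        using lq less.prems unfolding linear_quotient_order_def by blast
      moreover from this have "es ! k \<in> set es - {es ! i}"
        using dist less.prems by (auto simp: nth_eq_iff_index_eq)
      ultimately show ?thesis
        by blast
    next
      case False
      then have "i < j"
        using less.prems by simp
      then obtain p k where p: "lookup (es ! j) p < lookup (es ! i) p" "k < j" "es ! k \<preceq> es ! j + unit_exp p"
        using lq less.prems unfolding linear_quotient_order_def by blast
      show ?thesis
      proof (cases "k = i")
        case True
        \<comment> \<open>The walk has arrived at \<open>es ! i\<close>, so the last move is read
          backwards: \<open>es ! i\<close> times \<open>x_q\<close> equals \<open>es ! j\<close>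
          times \<open>x_p\<close>, and \<open>es ! j\<close> serves as the divisor.\<close>
        have "exp_degree (es ! i) = exp_degree (es ! j)"
          using deg less.prems by simp
        then obtain q where q: "es ! i + unit_exp q = es ! j + unit_exp p"
          using divides_unit_exp_step p(3) True by blast
        have "lookup (es ! i) q + 1 = lookup (es ! j) q + (if p = q then 1 else 0)"
          using arg_cong[OF q, of "\<lambda>m. lookup m q"] by (simp add: lookup_add lookup_unit_exp)
        moreover have "lookup (es ! i) p + (if p = q then 1 else 0) = lookup (es ! j) p + 1"
          using arg_cong[OF q, of "\<lambda>m. lookup m p"] by (auto simp: lookup_add lookup_unit_exp)
        ultimately have "lookup (es ! i) q < lookup (es ! j) q"
          using p(1) by (auto split: if_splits)
        moreover have "es ! j \<preceq> es ! i + unit_exp q"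
          unfolding q by simp
        moreover have "es ! j \<in> set es - {es ! i}"
          using dist less.prems by (auto simp: nth_eq_iff_index_eq)
        ultimately show ?thesis
          by blast
      next
        case False
        have "\<exists>p. lookup (es ! i) p < lookup (es ! k) p \<and> (\<exists>w\<in>set es - {es ! i}. w \<preceq> es ! i + unit_exp p)"
          by (rule less.hyps) (use False less.prems p(2) in auto)
        then obtain p' w where p': "lookup (es ! i) p' < lookup (es ! k) p'"
          "w \<in> set es - {es ! i}" "w \<preceq> es ! i + unit_exp p'"
          by blast
        \<comment> \<open>\<open>es ! k\<close> can exceed \<open>es ! j\<close> only at
          \<open>p\<close>, by one, and \<open>es ! j\<close> is below \<open>es ! i\<close> there;
          hence a variable in which \<open>es ! k\<close> exceeds \<open>es ! i\<close> is also one
          in which \<open>es ! j\<close> does.\<close>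
        have "lookup (es ! k) p' \<le> lookup (es ! j) p' + (if p = p' then 1 else 0)"
          using p(3) by (auto simp: divides_exp_def lookup_add lookup_unit_exp dest: spec[of _ p'])
        then have "lookup (es ! i) p' < lookup (es ! j) p'"
          using p' p(1) by (auto split: if_splits)
        then show ?thesis
          using p' by blast
      qed
    qed
  qed
  show ?thesis
    unfolding linear_steps_def
  proof (intro ballI)
    fix u v assume "u \<in> set es" "v \<in> set es - {u}"
    then obtain i j where "i < length es" "j < length es" "u = es ! i" "v = es ! j" "i \<noteq> j"
      by (auto simp: in_set_conv_nth)
    then show "\<exists>p. lookup u p < lookup v p \<and> (\<exists>w\<in>set es - {u}. w \<preceq> u + unit_exp p)"
      using step by blast
  qed
qed

text \<open>The list is ordered by decreasing \<open>\<phi>\<close>. An element in front of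
  \<open>u\<close> may tie with it, so the hypothesis covers \<open>\<phi> u \<le> \<phi> v\<close>;
  the divisor \<open>w\<close> has strictly larger weight, which places it in front of
  \<open>u\<close> however ties are broken.\<close>

lemma ex_linear_quotient_order:
  fixes \<phi> :: "(nat \<Rightarrow>\<^sub>0 nat) \<Rightarrow> nat"
  assumes "finite E"
    and step: "\<And>u v. u \<in> E \<Longrightarrow> v \<in> E \<Longrightarrow> u \<noteq> v \<Longrightarrow> \<phi> u \<le> \<phi> v \<Longrightarrow>
      \<exists>p. lookup u p < lookup v p \<and> (\<exists>w\<in>E. \<phi> u < \<phi> w \<and> w \<preceq> u + unit_exp p)"
  shows "\<exists>es. distinct es \<and> set es = E \<and> linear_quotient_order es"
proof -
  obtain xs where xs: "set xs = E" "distinct xs"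
    using finite_distinct_list[OF assms(1)] by blast
  define es where "es = rev (sort_key \<phi> xs)"
  have es: "set es = E" "distinct es"
    by (simp_all add: es_def xs)
  have "sorted (rev (map \<phi> es))"
    by (simp add: es_def rev_map[symmetric])
  then have mono: "\<phi> (es ! j) \<le> \<phi> (es ! i)" if "i \<le> j" "j < length es" for i j
    using sorted_rev_nth_mono[of "map \<phi> es" i j] that by simp
  have "linear_quotient_order es"
    unfolding linear_quotient_order_def
  proof (intro allI impI)
    fix j i assume ij: "j < length es" "i < j"
    then have "es ! j \<in> E" "es ! i \<in> E" "es ! j \<noteq> es ! i" "\<phi> (es ! j) \<le> \<phi> (es ! i)"
      using es mono by (auto simp: nth_eq_iff_index_eq)
    then obtain p w where p: "lookup (es ! j) p < lookup (es ! i) p" "w \<in> E" "\<phi> (es ! j) < \<phi> w"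
      "w \<preceq> es ! j + unit_exp p"
      using step by meson
    then obtain k where k: "k < length es" "w = es ! k"
      using es by (metis in_set_conv_nth)
    then have "k < j"
      using p mono[of j k] by (meson leD leI)
    then show "\<exists>p. lookup (es ! j) p < lookup (es ! i) p \<and> (\<exists>k<j. es ! k \<preceq> es ! j + unit_exp p)"
      using p k by blast
  qed
  then show ?thesis
    using es by blast
qed


section \<open>Path monomials\<close>

definition path_exp :: "nat \<Rightarrow> nat \<Rightarrow> (nat \<Rightarrow>\<^sub>0 nat)" where
  "path_exp t i = (\<Sum>j\<in>{i..<i + t}. unit_exp j)"

lemma lookup_path_exp: "lookup (path_exp t i) j = (if i \<le> j \<and> j < i + t then 1 else 0)"
  by (simp add: path_exp_def lookup_sum lookup_unit_exp)

lemma path_exp_in_exps: "1 \<le> i \<Longrightarrow> i + t \<le> n + 1 \<Longrightarrow> path_exp t i \<in> exps n"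
  by (auto simp: exps_iff lookup_path_exp split: if_splits)

lemma exp_degree_path_exp [simp]: "exp_degree (path_exp t i) = t"
proof -
  have "exp_degree (path_exp t i) = (\<Sum>j\<in>{i..<i + t}. lookup (path_exp t i) j)"
    by (rule exp_degree_superset) (auto simp: in_keys_iff lookup_path_exp split: if_splits)
  also have "\<dots> = (\<Sum>j\<in>{i..<i + t}. 1)"
    by (rule sum.cong) (simp_all add: lookup_path_exp)
  finally show ?thesis
    by simp
qed

lemma prod_var: "(\<Prod>j\<in>A. var j) = (monom (\<Sum>j\<in>A. unit_exp j) :: 'k::field mpoly)"
  by (induction A rule: infinite_finite_induct) (simp_all add: var_monom monom_mult)

lemma line_path_ideal_eq:
  assumes "t \<le> n"
  shows "line_path_ideal n t = (mon_ideal n (path_exp t ` {1..n - t + 1}) :: 'k::field mpoly set)"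
proof -
  have sub: "path_exp t ` {1..n - t + 1} \<subseteq> exps n"
    using assms by (auto intro!: path_exp_in_exps)
  show ?thesis
    unfolding line_path_ideal_def Idl_monom[OF sub, symmetric] prod_var path_exp_def[symmetric] image_image ..
qed

lemma sums_of_SucI: "a \<in> sums_of E s \<Longrightarrow> b \<in> E \<Longrightarrow> a + b \<in> sums_of E (Suc s)"
  by auto

lemma exp_degree_sums_of:
  assumes "\<And>a. a \<in> E \<Longrightarrow> exp_degree a = d" "b \<in> sums_of E s"
  shows "exp_degree b = s * d"
  using assms(2) by (induction s arbitrary: b) (auto simp: exp_degree_add assms(1))

text \<open>\<open>c i\<close> is the multiplicity of the factor \<open>u_i\<close>, and
  \<open>m\<close> is the number of path monomials. Multiplicities make it easy to remove one factor
  and put in another.\<close>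

definition path_sum :: "nat \<Rightarrow> nat \<Rightarrow> (nat \<Rightarrow> nat) \<Rightarrow> nat \<Rightarrow> (nat \<Rightarrow>\<^sub>0 nat) \<Rightarrow> bool" where
  "path_sum t m c s a \<longleftrightarrow> (\<Sum>i\<in>{1..m}. c i) = s \<and>
     (\<forall>j. lookup a j = (\<Sum>i\<in>{1..m}. lookup (path_exp t i) j * c i))"

lemma sum_fun_upd_add:
  fixes c g :: "nat \<Rightarrow> nat"
  assumes "finite A" "i \<in> A"
  shows "(\<Sum>x\<in>A. g x * (c(i := Suc (c i))) x) = (\<Sum>x\<in>A. g x * c x) + g i"
proof -
  have "(\<Sum>x\<in>A. g x * (c(i := Suc (c i))) x) = g i * Suc (c i) + (\<Sum>x\<in>A - {i}. g x * c x)"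
    using assms by (subst sum.remove[OF assms]) (auto intro!: sum.cong)
  then show ?thesis
    using sum.remove[OF assms, of "\<lambda>x. g x * c x"] by simp
qed

lemma path_sum_add:
  assumes "i \<in> {1..m}"
  shows "path_sum t m (c(i := Suc (c i))) (Suc s) (a + path_exp t i) \<longleftrightarrow> path_sum t m c s a"
  using sum_fun_upd_add[OF _ assms, of "\<lambda>x. lookup (path_exp t x) _" c]
    sum_fun_upd_add[OF _ assms, of "\<lambda>_. 1" c]
  unfolding path_sum_def by (simp add: lookup_add del: fun_upd_apply)

lemma path_sum_remove:
  assumes i: "i \<in> {1..m}" and ps: "path_sum t m c s a" and c: "0 < c i"
  obtains b where "a = b + path_exp t i" "path_sum t m (c(i := c i - 1)) (s - 1) b"
proof -
  let ?c = "c(i := c i - 1)"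
  have "lookup (path_exp t i) j \<le> lookup a j" for j
  proof -
    have "lookup (path_exp t i) j \<le> lookup (path_exp t i) j * c i"
      using c by simp
    also have "\<dots> \<le> (\<Sum>i\<in>{1..m}. lookup (path_exp t i) j * c i)"
      by (rule member_le_sum[OF i]) auto
    also have "\<dots> = lookup a j"
      using ps by (simp add: path_sum_def)
    finally show ?thesis .
  qed
  then have a: "a = a - path_exp t i + path_exp t i"
    by (simp add: divides_exp_diff_add divides_exp_def)
  have "c i \<le> s"
    using ps i member_le_sum[of i "{1..m}" c] by (auto simp: path_sum_def)
  then have s: "s = Suc (s - 1)"
    using c by simp
  have "c = ?c(i := Suc (?c i))"
    using c by auto
  then have "path_sum t m (?c(i := Suc (?c i))) (Suc (s - 1)) (a - path_exp t i + path_exp t i)"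
    using ps a s by simp
  then have "path_sum t m ?c (s - 1) (a - path_exp t i)"
    using path_sum_add[OF i] by blast
  then show ?thesis
    using that a by blast
qed

lemma sums_of_path_exp_iff:
  "a \<in> sums_of (path_exp t ` {1..m}) s \<longleftrightarrow> (\<exists>c. path_sum t m c s a)"
proof (induction s arbitrary: a)
  case 0
  have "path_sum t m (\<lambda>_. 0) 0 0"
    by (simp add: path_sum_def)
  moreover have "a = 0" if "path_sum t m c 0 a" for c
    using that by (intro poly_mapping_eqI) (auto simp: path_sum_def)
  ultimately show ?case
    by auto
next
  case (Suc s)
  show ?case
  proof
    assume "a \<in> sums_of (path_exp t ` {1..m}) (Suc s)"
    then obtain b i where "a = b + path_exp t i" "b \<in> sums_of (path_exp t ` {1..m}) s" "i \<in> {1..m}"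
      by auto
    then show "\<exists>c. path_sum t m c (Suc s) a"
      using Suc path_sum_add by blast
  next
    assume "\<exists>c. path_sum t m c (Suc s) a"
    then obtain c where c: "path_sum t m c (Suc s) a" ..
    then have "\<exists>i\<in>{1..m}. c i \<noteq> 0"
      unfolding path_sum_def by (metis nat.distinct(1) sum.neutral)
    then obtain i where i: "i \<in> {1..m}" "0 < c i"
      by blast
    then obtain b where b: "a = b + path_exp t i" "path_sum t m (c(i := c i - 1)) s b"
      using path_sum_remove[OF i(1) c i(2)] by auto
    then have "b \<in> sums_of (path_exp t ` {1..m}) s"
      using Suc by blast
    then show "a \<in> sums_of (path_exp t ` {1..m}) (Suc s)"
      unfolding b(1) using i(1) by (intro sums_of_SucI) auto
  qed
qed

section \<open>The case n > 2t\<close>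

text \<open>With a window starting at t + 1 the pair would not serve: \<open>u_1\<close> times
  \<open>x_(t+1)\<close> is a multiple of \<open>u_2\<close>. With the start at t + 2, for which n >
  2t leaves room, every variable in which \<open>?v\<close> exceeds \<open>?u\<close> has index at
  least t + 2, and a window through it contains a second variable beyond t because t \<ge>
  2.\<close>

lemma not_linear_steps_path:
  assumes t: "2 \<le> t" and n: "2 * t < n" and s: "1 \<le> s"
  shows "\<not> linear_steps (sums_of (path_exp t ` {1..n - t + 1}) s)"
proof
  let ?E = "path_exp t ` {1..n - t + 1}"
  assume ls: "linear_steps (sums_of ?E s)"
  have "\<exists>u\<in>sums_of ?E r. \<forall>j. lookup u j = r * lookup (path_exp t 1) j" for r
  proof (induction r)
    case (Suc r)
    then obtain u where u: "u \<in> sums_of ?E r" "\<forall>j. lookup u j = r * lookup (path_exp t 1) j"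
      by blast
    have "u + path_exp t 1 \<in> sums_of ?E (Suc r)"
      using u(1) by (intro sums_of_SucI) auto
    then show ?case
      using u(2) by (intro bexI[of _ "u + path_exp t 1"]) (auto simp: lookup_add)
  qed simp
  then obtain z where z: "z \<in> sums_of ?E (s - 1)" "\<And>j. lookup z j = (s - 1) * lookup (path_exp t 1) j"
    by meson
  let ?u = "z + path_exp t 1" and ?v = "z + path_exp t (t + 2)"
  have s': "s = Suc (s - 1)"
    using s by simp
  have mem: "z + path_exp t i \<in> sums_of ?E s" if "i \<in> {1..n - t + 1}" for i
    unfolding s'[THEN arg_cong, of "sums_of ?E"] using z(1) that by (intro sums_of_SucI) auto
  have u: "?u \<in> sums_of ?E s"
    by (rule mem) simp
  have v: "?v \<in> sums_of ?E s"
    by (rule mem) (use n t in simp)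
  have "lookup ?u (t + 2) \<noteq> lookup ?v (t + 2)"
    using t by (simp add: lookup_add lookup_path_exp)
  then have "?v \<noteq> ?u"
    by metis
  then obtain p w where p: "lookup ?u p < lookup ?v p" and w: "w \<in> sums_of ?E s" "w \<noteq> ?u"
    and wp: "w \<preceq> ?u + unit_exp p"
    using ls u v unfolding linear_steps_def by blast
  have p2: "t + 2 \<le> p"
    using p by (auto simp: lookup_add lookup_path_exp split: if_splits)
  have le: "lookup w j \<le> lookup ?u j + (if p = j then 1 else 0)" for j
    using wp by (auto simp: divides_exp_def lookup_add lookup_unit_exp dest: spec[of _ j])
  have zero: "lookup w j = 0" if "t < j" "j \<noteq> p" for j
    using le[of j] that z(2)[of j] by (simp add: lookup_add lookup_path_exp)
  \<comment> \<open>Otherwise \<open>w\<close> divides \<open>?u\<close>, and equal degrees force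
    \<open>w = ?u\<close>.\<close>
  have "lookup w p \<noteq> 0"
  proof
    assume "lookup w p = 0"
    then have "w \<preceq> ?u"
      using le unfolding divides_exp_def by (metis add.right_neutral le0)
    moreover have "exp_degree w = exp_degree ?u"
      using exp_degree_sums_of[of ?E t] w(1) u by (metis (no_types, lifting) exp_degree_path_exp imageE)
    ultimately show False
      using divides_exp_degree_eq w(2) by auto
  qed
  moreover obtain c where c: "path_sum t (n - t + 1) c s w"
    using w(1) sums_of_path_exp_iff by blast
  ultimately have "\<exists>i\<in>{1..n - t + 1}. lookup (path_exp t i) p * c i \<noteq> 0"
    unfolding path_sum_def by (metis (no_types, lifting) sum.neutral)
  then obtain i where i: "i \<in> {1..n - t + 1}" "lookup (path_exp t i) p \<noteq> 0" "c i \<noteq> 0"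
    by auto
  \<comment> \<open>A neighbour of \<open>p\<close> inside the window at \<open>i\<close>: the left
    one unless the window starts at \<open>p\<close>. It lies beyond t since
    \<open>t + 2 \<le> p\<close>, whereas \<open>w\<close> has no variable beyond t except
    \<open>p\<close>.\<close>
  define p' where "p' = (if i < p then p - 1 else p + 1)"
  have "lookup (path_exp t i) p' \<noteq> 0" "t < p'" "p' \<noteq> p"
    using i(2) p2 t by (auto simp: p'_def lookup_path_exp split: if_splits)
  moreover from this have "(\<Sum>i\<in>{1..n - t + 1}. lookup (path_exp t i) p' * c i) = 0"
    using zero[of p'] c unfolding path_sum_def by metis
  then have "lookup (path_exp t i) p' * c i = 0"
    using i(1) by (simp only: sum_eq_0_iff finite_atLeastAtMost)
  ultimately show False
    using i(3) by simp
qed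

section \<open>The case n \<le> 2t\<close>

lemma ex_linear_quotient_order_path:
  assumes tn: "t \<le> n" and n: "n \<le> 2 * t"
  defines "E \<equiv> path_exp t ` {1..n - t + 1}"
  shows "\<exists>es. distinct es \<and> set es = sums_of E s \<and> linear_quotient_order es"
proof (rule ex_linear_quotient_order)
  let ?m = "n - t + 1"
  define \<phi> where "\<phi> a = (\<Sum>l\<in>{1..t}. lookup a l)" for a :: "nat \<Rightarrow>\<^sub>0 nat"
  have E: "E \<subseteq> exps n"
    using tn by (auto simp: E_def intro!: path_exp_in_exps)
  have "sums_of E s \<subseteq> {m \<in> exps n. exp_degree m \<le> s * t}"
    using sums_of_exps[OF E, of s] exp_degree_sums_of[of E t _ s] E_def by fastforce
  then show "finite (sums_of E s)"
    using finite_exps_degree finite_subset by blast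
  have low: "lookup a l = (\<Sum>i\<in>{1..?m}. if i \<le> l then c i else 0)" if "path_sum t ?m c s a" "l \<in> {1..t}" for a c l
    using that by (auto simp: path_sum_def lookup_path_exp intro!: sum.cong)
  have mono: "lookup a l \<le> lookup a l'" if "path_sum t ?m c s a" "l \<in> {1..t}" "l' \<in> {1..t}" "l \<le> l'" for a c l l'
    unfolding low[OF that(1,2)] low[OF that(1,3)] using that(4) by (intro sum_mono) auto
  \<comment> \<open>The bound \<open>n \<le> 2 * t\<close> gives \<open>i \<le> t + 1\<close> for
    every factor \<open>u_i\<close>. Such a window contains \<open>x_l\<close> if
    \<open>i \<le> l\<close> and \<open>x_(l+t)\<close> otherwise, never both, so each of the
    \<open>s\<close> factors is counted once.\<close>
  have high: "lookup a (l + t) + lookup a l = s" if ps: "path_sum t ?m c s a" and l: "l \<in> {1..t}" for a c l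
  proof -
    have "lookup a (l + t) = (\<Sum>i\<in>{1..?m}. if i \<le> l then 0 else c i)"
      using ps l n unfolding path_sum_def by (auto simp: lookup_path_exp intro!: sum.cong)
    then have "lookup a (l + t) + lookup a l = (\<Sum>i\<in>{1..?m}. (if i \<le> l then 0 else c i) + (if i \<le> l then c i else 0))"
      using low[OF ps l] by (simp add: sum.distrib)
    also have "\<dots> = (\<Sum>i\<in>{1..?m}. c i)"
      by (rule sum.cong) auto
    finally show ?thesis
      using ps by (simp add: path_sum_def)
  qed
  fix u v assume u: "u \<in> sums_of E s" and v: "v \<in> sums_of E s" and "u \<noteq> v" and le: "\<phi> u \<le> \<phi> v"
  obtain c where c: "path_sum t ?m c s u"
    using u sums_of_path_exp_iff unfolding E_def by blast
  obtain c' where c': "path_sum t ?m c' s v"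
    using v sums_of_path_exp_iff unfolding E_def by blast
  \<comment> \<open>If \<open>v\<close> nowhere exceeds \<open>u\<close> on the first t variables,
    then \<open>\<phi> u \<le> \<phi> v\<close> forces equality there, and \<open>high\<close>
    extends it to all variables, contradicting \<open>u \<noteq> v\<close>.\<close>
  have "\<exists>l\<in>{1..t}. lookup u l < lookup v l"
  proof (rule ccontr)
    assume "\<not> ?thesis"
    then have vu: "\<And>l. l \<in> {1..t} \<Longrightarrow> lookup v l \<le> lookup u l"
      by (meson not_le)
    have eq: "lookup v l = lookup u l" if "l \<in> {1..t}" for l
    proof (rule ccontr)
      assume "lookup v l \<noteq> lookup u l"
      then have "lookup v l < lookup u l"
        using vu[OF that] by simp
      then have "\<phi> v < \<phi> u"
        unfolding \<phi>_def using vu that by (intro sum_strict_mono_ex1) auto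
      then show False
        using le by simp
    qed
    have "lookup u j = lookup v j" for j
    proof -
      consider "j \<in> {1..t}" | "j - t \<in> {1..t}" "j = j - t + t" | "j = 0 \<or> n < j"
        using n by fastforce
      then show ?thesis
      proof cases
        case 2
        then show ?thesis
          using high[OF c, of "j - t"] high[OF c', of "j - t"] eq[of "j - t"] by simp
      next
        case 3
        moreover have "u \<in> exps n" "v \<in> exps n"
          using u v sums_of_exps[OF E] by blast+
        ultimately show ?thesis
          unfolding exps_iff by (metis One_nat_def not_less_eq_eq not_le le0)
      qed (simp add: eq)
    qed
    then show False
      using \<open>u \<noteq> v\<close> poly_mapping_eqI by metis
  qed
  then obtain l where l: "l \<in> {1..t}" "lookup u l < lookup v l" ..
  have "lookup u l < s"
    using l high[OF c' l(1)] by simp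
  have "\<exists>i. l < i \<and> i \<le> ?m \<and> 0 < c i"
  proof (rule ccontr)
    assume "\<not> ?thesis"
    then have "(\<Sum>i\<in>{1..?m}. if i \<le> l then c i else 0) = (\<Sum>i\<in>{1..?m}. c i)"
      by (intro sum.cong) auto
    then show False
      using low[OF c l(1)] c \<open>lookup u l < s\<close> by (simp add: path_sum_def)
  qed
  \<comment> \<open>With the least factor index beyond \<open>l\<close>, the exponents of
    \<open>u\<close> are constant from \<open>l\<close> to \<open>q - 1\<close>, while those of
    \<open>v\<close> do not decrease. So \<open>v\<close> still exceeds \<open>u\<close> at
    \<open>q - 1\<close>, the variable gained by replacing the factor \<open>u_q\<close> with its
    left neighbour.\<close>
  then obtain q where q: "l < q" "q \<le> ?m" "0 < c q"
    and min: "\<forall>i<q. \<not> (l < i \<and> i \<le> ?m \<and> 0 < c i)"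
    using exists_least_iff[of "\<lambda>i. l < i \<and> i \<le> ?m \<and> 0 < c i"] by blast
  have least: "c i = 0" if "l < i" "i < q" for i
    using min[rule_format, of i] that q(2) by simp
  define p where "p = q - 1"
  have p: "q = Suc p" "l \<le> p" "p \<in> {1..t}" "p \<in> {1..?m}" "q \<in> {1..?m}"
    using q l n by (auto simp: p_def)
  have "lookup u p = lookup u l"
    unfolding low[OF c p(3)] low[OF c l(1)] using least p(1,2) by (intro sum.cong) auto
  then have up: "lookup u p < lookup v p"
    using l(2) mono[OF c' l(1) p(3,2)] by simp
  obtain b where b: "u = b + path_exp t q" "path_sum t ?m (c(q := c q - 1)) (s - 1) b"
    using path_sum_remove[OF p(5) c q(3)] by blast
  let ?w = "b + path_exp t p"
  have w: "?w \<in> sums_of E s"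
  proof -
    have "s = Suc (s - 1)"
      using \<open>lookup u l < s\<close> by simp
    moreover have "b \<in> sums_of E (s - 1)"
      using b(2) sums_of_path_exp_iff unfolding E_def by blast
    ultimately show ?thesis
      using p(4) sums_of_SucI[of b E "s - 1" "path_exp t p"] by (simp add: E_def)
  qed
  \<comment> \<open>Neighbouring windows differ by trading \<open>x_(p+t)\<close> for
    \<open>x_p\<close>. Since \<open>p + t\<close> exceeds t, the trade raises \<open>\<phi>\<close>
    by one.\<close>
  have wu: "?w + unit_exp (p + t) = u + unit_exp p"
  proof -
    have "path_exp t p + unit_exp (p + t) = path_exp t q + unit_exp p"
      using p(1,3) by (intro poly_mapping_eqI) (auto simp: lookup_add lookup_path_exp lookup_unit_exp)
    then show ?thesis
      unfolding b(1) by (simp add: add.assoc)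
  qed
  have "?w \<preceq> u + unit_exp p"
    unfolding wu[symmetric] by (rule divides_exp_add)
  moreover have "\<phi> u < \<phi> ?w"
  proof -
    have eq: "lookup ?w x + lookup (unit_exp (p + t)) x = lookup u x + lookup (unit_exp p) x" for x
      using arg_cong[OF wu, of "\<lambda>m. lookup m x"] by (simp add: lookup_add)
    have "lookup ?w x = lookup u x + lookup (unit_exp p) x" if "x \<in> {1..t}" for x
      using that p(3) eq[of x] by (auto simp: lookup_unit_exp split: if_splits)
    then have "\<phi> ?w = \<phi> u + (\<Sum>x\<in>{1..t}. if p = x then 1 else 0)"
      by (simp add: \<phi>_def sum.distrib lookup_unit_exp)
    then show ?thesis
      using p(3) by simp
  qed
  ultimately show "\<exists>p. lookup u p < lookup v p \<and> (\<exists>w\<in>sums_of E s. \<phi> u < \<phi> w \<and> w \<preceq> u + unit_exp p)"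
    using up w by blast
qed

section \<open>The Koszul complex\<close>

text \<open>The sign of sorting \<open>i\<close> into \<open>T\<close> in the exterior algebra,
  where a set stands for the wedge product of its elements in increasing order.\<close>

definition ksign :: "nat \<Rightarrow> nat set \<Rightarrow> 'k::field" where
  "ksign i T = (- 1) ^ card {t \<in> T. t < i}"

text \<open>A Koszul chain assigns a coefficient to every set \<open>S\<close> of variables; all homological degrees
  are treated at once.\<close>

definition koszul :: "nat \<Rightarrow> (nat set \<Rightarrow> 'k::field mpoly) \<Rightarrow> nat set \<Rightarrow> 'k mpoly" where
  "koszul n z T = (\<Sum>i\<in>{1..n} - T. Poly_Mapping.single 0 (ksign i T) * (var i * z (insert i T)))"

lemma ksign_square [simp]: "ksign i T * ksign i T = (1 :: 'k::field)"
  by (simp add: ksign_def power_mult_distrib[symmetric])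

lemma ksign_square_left [simp]: "ksign i T * (ksign i T * c) = (c :: 'k::field)"
  by (simp add: mult.assoc[symmetric])

lemma ksign_insert:
  assumes "finite U" "i \<notin> U"
  shows "(ksign l (insert i U) :: 'k::field) = (if i < l then - ksign l U else ksign l U)"
proof (cases "i < l")
  case True
  then have "{t \<in> insert i U. t < l} = insert i {t \<in> U. t < l}"
    by auto
  then show ?thesis
    using assms True by (simp add: ksign_def)
next
  case False
  then have "{t \<in> insert i U. t < l} = {t \<in> U. t < l}"
    by auto
  then show ?thesis
    using False by (simp add: ksign_def)
qed

lemma ksign_swap:
  assumes "finite U" "i \<notin> U" "l \<notin> U" "i \<noteq> l"
  shows "ksign i U * ksign l (insert i U) = - (ksign l U * ksign i (insert l U) :: 'k::field)"
  using assms by (auto simp: ksign_insert)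

lemma lookup_koszul:
  "lookup (koszul n z T :: 'k::field mpoly) m = (\<Sum>i\<in>{1..n} - T. ksign i T *
     (if 0 < lookup m i then lookup (z (insert i T)) (m - unit_exp i) else 0))"
  by (simp add: koszul_def lookup_sum lookup_var_mult)

lemma keys_koszul:
  assumes "m \<in> keys (koszul n z T)"
  obtains i k where "i \<in> {1..n} - T" "k \<in> keys (z (insert i T))" "m = k + unit_exp i"
proof -
  have "\<exists>i\<in>{1..n} - T. ksign i T *
     (if 0 < lookup m i then lookup (z (insert i T)) (m - unit_exp i) else 0) \<noteq> 0"
    using assms unfolding in_keys_iff lookup_koszul by (metis (no_types, lifting) sum.neutral)
  then obtain i where i: "i \<in> {1..n} - T" "0 < lookup m i" "lookup (z (insert i T)) (m - unit_exp i) \<noteq> 0"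
    by (auto split: if_splits)
  then show ?thesis
    using that[of i "m - unit_exp i"] divides_exp_diff_add[of "unit_exp i" m]
    by (simp add: in_keys_iff unit_exp_divides_iff)
qed

lemma koszul_add: "koszul n (\<lambda>S. z S + w S) T = koszul n z T + koszul n w T"
  by (simp add: koszul_def sum.distrib[symmetric] algebra_simps)

lemma koszul_diff: "koszul n (\<lambda>S. z S - w S) T = koszul n z T - koszul n w T"
  by (simp add: koszul_def sum_subtractf[symmetric] algebra_simps)

lemma koszul_zero [simp]: "koszul n (\<lambda>S. 0) T = 0"
  by (simp add: koszul_def)

lemma koszul_cong:
  assumes "\<And>S. S \<subseteq> {1..n} \<Longrightarrow> z S = w S" "T \<subseteq> {1..n}"
  shows "koszul n z T = koszul n w T"
  unfolding koszul_def
proof (intro sum.cong refl)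
  fix i assume "i \<in> {1..n} - T"
  then have "insert i T \<subseteq> {1..n}"
    using assms(2) by auto
  then show "Poly_Mapping.single 0 (ksign i T) * (var i * z (insert i T)) =
      Poly_Mapping.single 0 (ksign i T) * (var i * w (insert i T))"
    using assms(1) by simp
qed

text \<open>Induction on the index set cancels the pairs directly. Showing only that the sum equals
  its own negative would not suffice in characteristic 2.\<close>

lemma sum_antisymmetric:
  fixes g :: "'a \<Rightarrow> 'a \<Rightarrow> 'b::ab_group_add"
  assumes "finite A" "\<And>i l. i \<in> A \<Longrightarrow> l \<in> A \<Longrightarrow> i \<noteq> l \<Longrightarrow> g i l = - g l i"
  shows "(\<Sum>i\<in>A. \<Sum>l\<in>A - {i}. g i l) = 0"
  using assms
proof (induction A rule: finite_induct)
  case (insert a A)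
  have IH: "(\<Sum>i\<in>A. \<Sum>l\<in>A - {i}. g i l) = 0"
    by (rule insert.IH, rule insert.prems) auto
  have "(\<Sum>l\<in>insert a A - {i}. g i l) = g i a + (\<Sum>l\<in>A - {i}. g i l)" if "i \<in> A" for i
    using insert.hyps that by (auto simp: insert_Diff_if)
  then have "(\<Sum>i\<in>insert a A. \<Sum>l\<in>insert a A - {i}. g i l) =
      (\<Sum>l\<in>A. g a l) + (\<Sum>i\<in>A. g i a + (\<Sum>l\<in>A - {i}. g i l))"
    using insert.hyps by simp
  also have "\<dots> = (\<Sum>l\<in>A. g a l + g l a)"
    using IH by (simp add: sum.distrib)
  also have "\<dots> = 0"
  proof (rule sum.neutral, rule ballI)
    fix l assume "l \<in> A"
    moreover from this have "a \<noteq> l"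
      using insert.hyps by blast
    ultimately show "g a l + g l a = 0"
      using insert.prems[of a l] by simp
  qed
  finally show ?case .
qed simp

lemma koszul_koszul:
  fixes z :: "nat set \<Rightarrow> 'k::field mpoly"
  assumes T: "T \<subseteq> {1..n}"
  shows "koszul n (koszul n z) T = 0"
proof -
  let ?A = "{1..n} - T"
  have single_mult: "Poly_Mapping.single 0 (a * b) =
      Poly_Mapping.single 0 a * (Poly_Mapping.single 0 b :: 'k mpoly)" for a b
    by (simp add: mult_single)
  define g where "g i l = Poly_Mapping.single 0 (ksign i T * ksign l (insert i T)) *
    (var i * (var l * z (insert l (insert i T))))" for i l
  have "koszul n (koszul n z) T = (\<Sum>i\<in>?A. \<Sum>l\<in>?A - {i}. g i l)"
    unfolding koszul_def
  proof (rule sum.cong[OF refl])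
    fix i assume "i \<in> ?A"
    have "{1..n} - insert i T = ?A - {i}"
      by auto
    then show "Poly_Mapping.single 0 (ksign i T) * (var i *
        (\<Sum>l\<in>{1..n} - insert i T. Poly_Mapping.single 0 (ksign l (insert i T)) *
          (var l * z (insert l (insert i T))))) = (\<Sum>l\<in>?A - {i}. g i l)"
      by (simp add: g_def sum_distrib_left single_mult mult_ac)
  qed
  also have "\<dots> = 0"
  proof (rule sum_antisymmetric)
    fix i l assume il: "i \<in> ?A" "l \<in> ?A" "i \<noteq> l"
    have "(ksign i T * ksign l (insert i T) :: 'k) = - (ksign l T * ksign i (insert l T))"
      using il T by (intro ksign_swap) (auto intro: finite_subset)
    then show "g i l = - g l i"
      unfolding g_def by (simp add: single_uminus insert_commute mult_ac)
  qed simp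
  finally show ?thesis .
qed

text \<open>If \<open>(f\<^sub>1, \<dots>, f\<^sub>r\<^sub>-\<^sub>1) : f\<close> is generated by the variables in \<open>V\<close>, then adding \<open>f\<close> to
  \<open>(f\<^sub>1, \<dots>, f\<^sub>r\<^sub>-\<^sub>1)\<close> adds a shifted copy of \<open>R/(V)\<close>; the slice consists of its basis monomials.\<close>

definition slice :: "nat set \<Rightarrow> (nat \<Rightarrow>\<^sub>0 nat) \<Rightarrow> (nat \<Rightarrow>\<^sub>0 nat) \<Rightarrow> bool" where
  "slice V f m \<longleftrightarrow> f \<preceq> m \<and> keys (m - f) \<inter> V = {}"

text \<open>In the multidegree \<open>m + S\<close>, the homotopy is the cone with apex the least variable
  outside \<open>V\<close> that occurs in this degree relative to \<open>f\<close>.\<close>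

definition apex :: "nat set \<Rightarrow> (nat \<Rightarrow>\<^sub>0 nat) \<Rightarrow> (nat \<Rightarrow>\<^sub>0 nat) \<Rightarrow> nat set \<Rightarrow> nat" where
  "apex V f m S = Min ((keys (m - f) \<union> S) - V)"

text \<open>The cone moves the apex variable from the monomial into the set. This preserves the
  multidegree, so \<open>(m, S)\<close> and the term of \<open>z\<close> that is read here have the
  same apex.\<close>

definition homotopy ::
  "nat set \<Rightarrow> (nat \<Rightarrow>\<^sub>0 nat) \<Rightarrow> (nat set \<Rightarrow> 'k::field mpoly) \<Rightarrow> nat set \<Rightarrow> 'k mpoly" where
  "homotopy V f z S = Abs_poly_mapping (\<lambda>m.
     if slice V f m \<and> (keys (m - f) \<union> S) - V \<noteq> {} \<and> apex V f m S \<in> S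
     then ksign (apex V f m S) (S - {apex V f m S}) *
       lookup (z (S - {apex V f m S})) (m + unit_exp (apex V f m S)) else 0)"

lemma lookup_homotopy:
  assumes "finite S"
  shows "lookup (homotopy V f z S :: 'k::field mpoly) m =
    (if slice V f m \<and> (keys (m - f) \<union> S) - V \<noteq> {} \<and> apex V f m S \<in> S
     then ksign (apex V f m S) (S - {apex V f m S}) *
       lookup (z (S - {apex V f m S})) (m + unit_exp (apex V f m S)) else 0)"
  unfolding homotopy_def
proof (subst lookup_Abs_poly_mapping)
  let ?c = "\<lambda>m. if slice V f m \<and> (keys (m - f) \<union> S) - V \<noteq> {} \<and> apex V f m S \<in> S
     then ksign (apex V f m S) (S - {apex V f m S}) *
       lookup (z (S - {apex V f m S})) (m + unit_exp (apex V f m S)) else 0"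
  have "{m. ?c m \<noteq> 0} \<subseteq> (\<Union>i\<in>S. (\<lambda>k. k - unit_exp i) ` keys (z (S - {i})))"
  proof
    fix m assume "m \<in> {m. ?c m \<noteq> 0}"
    then have "apex V f m S \<in> S" "m + unit_exp (apex V f m S) \<in> keys (z (S - {apex V f m S}))"
      by (auto simp: in_keys_iff split: if_splits)
    then show "m \<in> (\<Union>i\<in>S. (\<lambda>k. k - unit_exp i) ` keys (z (S - {i})))"
      by (intro UN_I[of "apex V f m S"] image_eqI[of _ _ "m + unit_exp (apex V f m S)"]) simp_all
  qed
  then show "finite {m. ?c m \<noteq> 0}"
    by (rule finite_subset) (use assms in auto)
qed simp

lemma keys_homotopy:
  assumes "finite S" "m \<in> keys (homotopy V f z S)"
  obtains i where "slice V f m" "i \<in> S" "m + unit_exp i \<in> keys (z (S - {i}))"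
  using assms by (auto simp: in_keys_iff lookup_homotopy split: if_splits)

text \<open>Restriction to the slice gives the Koszul complex of a shifted \<open>R/(V)\<close>,
  where the homotopy identity \<open>dh + hd = 1\<close> becomes \<open>dh = 1\<close> on cycles. It
  fails only where no variable outside \<open>V\<close> occurs relative to \<open>f\<close>, which
  forces \<open>m = f\<close>; \<open>notf\<close> removes this case. By \<open>cl\<close>, a
  variable multiple of a monomial off the slice does not re-enter it, so the restriction of a cycle
  is again a cycle.\<close>

lemma koszul_homotopy:
  fixes z :: "nat set \<Rightarrow> 'k::field mpoly"
  assumes T: "T \<subseteq> {1..n}" and m: "m \<in> exps n" "slice V f m"
    and cyc: "\<And>S. S \<subseteq> {1..n} \<Longrightarrow> koszul n z S = 0"
    and notf: "\<And>S. S \<subseteq> {1..n} \<Longrightarrow> f \<notin> keys (z S)"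
    and cl: "\<And>S k i. S \<subseteq> {1..n} \<Longrightarrow> k \<in> keys (z S) \<Longrightarrow> i \<in> {1..n} \<Longrightarrow>
      slice V f (k + unit_exp i) \<Longrightarrow> slice V f k"
  shows "lookup (koszul n (homotopy V f z) T) m = lookup (z T) m"
proof (cases "(keys (m - f) \<union> T) - V = {}")
  case True
  then have "keys (m - f) = {}"
    using m(2) unfolding slice_def by blast
  then have "m - f = 0"
    by simp
  then have mf: "m = f"
    using m(2) divides_exp_diff_add[of f m] by (simp add: slice_def)
  \<comment> \<open>Every monomial of the homotopy is a multiple of \<open>f\<close>, so the
    differential, which multiplies by a variable, never reaches \<open>f\<close> itself.\<close>
  have "m \<notin> keys (koszul n (homotopy V f z) T)"
  proof
    assume "m \<in> keys (koszul n (homotopy V f z) T)"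
    then obtain i k where i: "i \<in> {1..n} - T" "k \<in> keys (homotopy V f z (insert i T))" "m = k + unit_exp i"
      by (rule keys_koszul)
    have "finite (insert i T)"
      using T finite_subset by blast
    then have "slice V f k"
      using i(2) by (rule keys_homotopy)
    then have "lookup f i \<le> lookup k i"
      by (simp add: slice_def divides_exp_def)
    then show False
      using i(3) mf by (simp add: lookup_add lookup_unit_exp)
  qed
  then show ?thesis
    using notf[OF T] mf by (simp add: in_keys_iff)
next
  case False
  define i0 where "i0 = apex V f m T"
  have finT: "finite T"
    using T finite_subset by blast
  have fm: "f \<preceq> m"
    using m by (simp add: slice_def)
  have i0: "i0 \<in> (keys (m - f) \<union> T) - V"
    unfolding i0_def apex_def by (rule Min_in) (use False finT in auto)
  have "keys (m - f) \<subseteq> {1..n}"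
    using m(1) exps_diff[of m n f] by (simp add: exps_def)
  then have i0n: "i0 \<in> {1..n}"
    using i0 T by blast
  \<comment> \<open>Moving \<open>i\<close> from the monomial into \<open>T\<close> keeps the
    multidegree, hence \<open>i0\<close> remains the apex.\<close>
  have inner: "(if 0 < lookup m i then lookup (homotopy V f z (insert i T)) (m - unit_exp i) else 0) =
      (if i \<in> keys (m - f) \<and> i0 \<in> insert i T
       then ksign i0 (insert i T - {i0}) * lookup (z (insert i T - {i0})) (m - unit_exp i + unit_exp i0) else 0)"
    if "i \<in> {1..n} - T" for i
  proof (cases "i \<in> keys (m - f)")
    case True
    then have lt: "lookup f i < lookup m i"
      by (simp add: in_keys_iff lookup_minus)
    have "f \<preceq> m - unit_exp i"
      using fm lt by (auto simp: divides_exp_def lookup_minus lookup_unit_exp)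
    moreover have sub: "keys (m - unit_exp i - f) \<subseteq> keys (m - f)"
      by (auto simp: in_keys_iff lookup_minus)
    ultimately have "slice V f (m - unit_exp i)"
      using m(2) by (auto simp: slice_def)
    moreover have "keys (m - f) \<subseteq> insert i (keys (m - unit_exp i - f))"
      by (auto simp: in_keys_iff lookup_minus lookup_unit_exp split: if_splits)
    then have "keys (m - unit_exp i - f) \<union> insert i T = keys (m - f) \<union> T"
      using sub True by blast
    ultimately show ?thesis
      using True lt False finT by (simp add: lookup_homotopy apex_def i0_def)
  next
    case False
    then have le: "lookup m i \<le> lookup f i"
      by (simp add: in_keys_iff lookup_minus)
    have "\<not> slice V f (m - unit_exp i)" if "0 < lookup m i"
    proof
      assume "slice V f (m - unit_exp i)"
      then have "lookup f i \<le> lookup (m - unit_exp i) i"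
        by (simp add: slice_def divides_exp_def)
      then show False
        using le that by (simp add: lookup_minus lookup_unit_exp)
    qed
    then show ?thesis
      using False finT by (simp add: lookup_homotopy)
  qed
  have LHS: "lookup (koszul n (homotopy V f z) T) m = (\<Sum>i\<in>{1..n} - T. ksign i T *
      (if i \<in> keys (m - f) \<and> i0 \<in> insert i T
       then ksign i0 (insert i T - {i0}) * lookup (z (insert i T - {i0})) (m - unit_exp i + unit_exp i0) else 0))"
    unfolding lookup_koszul by (rule sum.cong) (simp_all only: inner)
  show ?thesis
  proof (cases "i0 \<in> T")
    case False
    then have i0k: "i0 \<in> keys (m - f)"
      using i0 by blast
    then have "unit_exp i0 \<preceq> m"
      by (simp add: unit_exp_divides_iff in_keys_iff lookup_minus)
    then have mm: "m - unit_exp i0 + unit_exp i0 = m"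
      by (rule divides_exp_diff_add)
    \<comment> \<open>With \<open>i0\<close> outside \<open>T\<close>, only the summand
      \<open>i = i0\<close> inserts the apex; its two signs multiply to 1.\<close>
    have "lookup (koszul n (homotopy V f z) T) m = (\<Sum>i\<in>{1..n} - T. if i = i0 then lookup (z T) m else 0)"
      unfolding LHS
    proof (rule sum.cong[OF refl])
      fix i assume "i \<in> {1..n} - T"
      show "ksign i T * (if i \<in> keys (m - f) \<and> i0 \<in> insert i T
       then ksign i0 (insert i T - {i0}) * lookup (z (insert i T - {i0})) (m - unit_exp i + unit_exp i0) else 0) =
         (if i = i0 then lookup (z T) m else 0)"
        using False i0k mm by auto
    qed
    also have "\<dots> = lookup (z T) m"
      using i0n False by simp
    finally show ?thesis .
  next
    case True
    \<comment> \<open>Here the apex already lies in \<open>T\<close>. The cycle condition is used at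
      \<open>T\<close> without \<open>i0\<close>, in the same multidegree.\<close>
    define U where "U = T - {i0}"
    have U: "i0 \<notin> U" "T = insert i0 U" "finite U" "U \<subseteq> {1..n}"
      using True T finT by (auto simp: U_def)
    define s where "s = (\<Sum>i\<in>{1..n} - T. if i \<in> keys (m - f)
      then ksign i U * lookup (z (insert i U)) (m - unit_exp i + unit_exp i0) else 0)"
    have comm: "m + unit_exp i0 - unit_exp i = m - unit_exp i + unit_exp i0" if "0 < lookup m i" for i
      using that by (intro poly_mapping_eqI) (auto simp: lookup_add lookup_minus lookup_unit_exp)
    have Q: "slice V f (m + unit_exp i0)"
    proof -
      have "keys (m + unit_exp i0 - f) \<subseteq> insert i0 (keys (m - f))"
        by (auto simp: in_keys_iff lookup_add lookup_minus lookup_unit_exp split: if_splits)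
      moreover have "f \<preceq> m + unit_exp i0"
        using fm divides_exp_add(1) divides_exp_trans by blast
      ultimately show ?thesis
        using m(2) i0 by (auto simp: slice_def)
    qed
    \<comment> \<open>Only indices in \<open>keys (m - f)\<close> contribute: for any other index, a
      nonzero coefficient would belong to a monomial on the slice by \<open>cl\<close>, yet with a
      smaller exponent at \<open>i\<close> than \<open>f\<close>.\<close>
    have summand: "ksign i U * (if 0 < lookup (m + unit_exp i0) i
        then lookup (z (insert i U)) (m + unit_exp i0 - unit_exp i) else 0) =
      (if i \<in> keys (m - f) then ksign i U * lookup (z (insert i U)) (m - unit_exp i + unit_exp i0) else 0)"
      if i: "i \<in> {1..n} - T" for i
    proof (cases "i \<in> keys (m - f)")
      case True
      then have "0 < lookup m i"
        by (simp add: in_keys_iff lookup_minus)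
      then show ?thesis
        using True comm[of i] by (simp add: lookup_add)
    next
      case False
      have "i \<noteq> i0"
        using i \<open>i0 \<in> T\<close> by blast
      have "lookup (z (insert i U)) (m + unit_exp i0 - unit_exp i) = 0" if pos: "0 < lookup (m + unit_exp i0) i"
      proof (rule ccontr)
        let ?k = "m + unit_exp i0 - unit_exp i"
        assume "lookup (z (insert i U)) ?k \<noteq> 0"
        then have "?k \<in> keys (z (insert i U))"
          by (simp add: in_keys_iff)
        moreover have "?k + unit_exp i = m + unit_exp i0"
          using pos by (simp add: divides_exp_diff_add unit_exp_divides_iff)
        ultimately have "slice V f ?k"
          using cl[of "insert i U" ?k i] i U(4) Q by simp
        then have "lookup f i \<le> lookup ?k i"
          by (simp add: slice_def divides_exp_def)
        then show False
          using False pos \<open>i \<noteq> i0\<close>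
          by (simp add: in_keys_iff lookup_minus lookup_add lookup_unit_exp)
      qed
      then show ?thesis
        using False by simp
    qed
    have "{1..n} - U = insert i0 ({1..n} - T)"
      using U i0n by auto
    moreover have "lookup (koszul n z U) (m + unit_exp i0) = 0"
      using cyc[OF U(4)] by simp
    \<comment> \<open>The summand of \<open>i0\<close> in the cycle condition is, up to sign, the
      wanted coefficient of \<open>z T\<close>; the remaining ones form \<open>s\<close>.\<close>
    ultimately have "0 = ksign i0 U * lookup (z T) m + (\<Sum>i\<in>{1..n} - T. ksign i U *
        (if 0 < lookup (m + unit_exp i0) i then lookup (z (insert i U)) (m + unit_exp i0 - unit_exp i) else 0))"
      using True by (simp add: lookup_koszul lookup_add lookup_unit_exp U(2)[symmetric])
    also have "\<dots> = ksign i0 U * lookup (z T) m + s"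
      unfolding s_def by (simp only: summand cong: sum.cong)
    finally have s: "s = - (ksign i0 U * lookup (z T) m)"
      by (simp add: eq_neg_iff_add_eq_0 add.commute)
    have "lookup (koszul n (homotopy V f z) T) m = (\<Sum>i\<in>{1..n} - T. - ksign i0 U *
        (if i \<in> keys (m - f) then ksign i U * lookup (z (insert i U)) (m - unit_exp i + unit_exp i0) else 0))"
      unfolding LHS
    proof (rule sum.cong[OF refl])
      fix i assume i: "i \<in> {1..n} - T"
      then have ne: "i \<noteq> i0" "i \<notin> U"
        using U by auto
      have ins: "insert i T - {i0} = insert i U"
        using ne U by auto
      have "ksign i0 U * ksign i T = - (ksign i U * ksign i0 (insert i U) :: 'k)"
        unfolding U(2) by (rule ksign_swap) (use U ne in auto)
      then have "ksign i0 U * (ksign i0 U * ksign i T) * ksign i0 (insert i U) =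
          - ksign i0 U * ksign i U * (ksign i0 (insert i U) * ksign i0 (insert i U) :: 'k)"
        by (simp add: mult_ac del: ksign_square ksign_square_left)
      then have "ksign i T * ksign i0 (insert i U) = (- ksign i0 U * ksign i U :: 'k)"
        by simp
      then have eq: "ksign i T * (ksign i0 (insert i U) * c) = - ksign i0 U * (ksign i U * c)" for c :: 'k
        by (metis mult.assoc)
      show "ksign i T * (if i \<in> keys (m - f) \<and> i0 \<in> insert i T
       then ksign i0 (insert i T - {i0}) * lookup (z (insert i T - {i0})) (m - unit_exp i + unit_exp i0) else 0) =
        - ksign i0 U * (if i \<in> keys (m - f)
          then ksign i U * lookup (z (insert i U)) (m - unit_exp i + unit_exp i0) else 0)"
        using True unfolding ins by (simp add: eq)
    qed
    also have "\<dots> = - ksign i0 U * s"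
      by (simp add: s_def sum_distrib_left)
    also have "\<dots> = lookup (z T) m"
      unfolding s by simp
    finally show ?thesis .
  qed
qed

text \<open>By induction on the number of generators: the contraction clears the slice of the last
  generator \<open>f\<close> and leaves a cycle supported on the earlier ones. The hypothesis
  \<open>q \<noteq> d\<close> keeps \<open>f\<close> itself out of the support of \<open>z\<close>,
  the one place where the contraction breaks down.\<close>

lemma koszul_exact_linear_quotients:
  fixes z :: "nat set \<Rightarrow> 'k::field mpoly"
  assumes lq: "linear_quotient_order es" and es: "set es \<subseteq> exps n"
    and deg: "\<And>a. a \<in> set es \<Longrightarrow> exp_degree a = d" and q: "q \<noteq> d"
  shows "r \<le> length es \<Longrightarrow> (\<And>S. S \<subseteq> {1..n} \<Longrightarrow> keys (z S) \<subseteq> upset n (set (take r es))) \<Longrightarrow>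
    (\<And>S. S \<subseteq> {1..n} \<Longrightarrow> homogeneous q (z S)) \<Longrightarrow>
    (\<And>S. S \<subseteq> {1..n} \<Longrightarrow> koszul n z S = 0) \<Longrightarrow>
    \<exists>y. (\<forall>S\<subseteq>{1..n}. keys (y S) \<subseteq> upset n (set (take r es))) \<and> (\<forall>T\<subseteq>{1..n}. koszul n y T = z T)"
proof (induction r arbitrary: z)
  case 0
  then have "\<forall>T\<subseteq>{1..n}. z T = 0"
    by (simp add: upset_def)
  then show ?case
    by (intro exI[of _ "\<lambda>_. 0"]) simp
next
  case (Suc r)
  define f where "f = es ! r"
  define P where "P = upset n (set (take r es))"
  define V where "V = {i \<in> {1..n}. \<exists>k<r. es ! k \<preceq> f + unit_exp i}"
  have r: "r < length es"
    using Suc.prems(1) by simp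
  have f: "f \<in> exps n" "exp_degree f = d"
    using r es deg by (auto simp: f_def)
  have P: "m \<in> P \<longleftrightarrow> m \<in> exps n \<and> (\<exists>k<r. es ! k \<preceq> m)" for m
    using r by (fastforce simp: P_def upset_def in_set_conv_nth)
  have P': "m \<in> upset n (set (take (Suc r) es)) \<longleftrightarrow> m \<in> P \<or> m \<in> exps n \<and> f \<preceq> m" for m
    using r by (auto simp: P_def upset_def take_Suc_conv_app_nth f_def)
  \<comment> \<open>For a multiple \<open>m\<close> of \<open>f\<close> off the slice,
    \<open>m - f\<close> involves a variable of \<open>V\<close>, so an earlier generator divides
    \<open>m\<close>.\<close>
  have split: "m \<in> P \<or> slice V f m" if "m \<in> upset n (set (take (Suc r) es))" for m
  proof (rule ccontr)
    assume *: "\<not> (m \<in> P \<or> slice V f m)"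
    then have m: "m \<in> exps n" "f \<preceq> m"
      using that P'[of m] by auto
    then obtain i where i: "i \<in> keys (m - f)" "i \<in> V"
      using * by (auto simp: slice_def)
    then obtain k where "k < r" "es ! k \<preceq> f + unit_exp i"
      by (auto simp: V_def)
    moreover have "f + unit_exp i \<preceq> m"
      using m(2) i(1) by (auto simp: divides_exp_def lookup_add lookup_unit_exp in_keys_iff lookup_minus
          Suc_le_eq)
    ultimately have "\<exists>k<r. es ! k \<preceq> m"
      using divides_exp_trans by blast
    then have "m \<in> P"
      using m P[of m] by blast
    then show False
      using * by simp
  qed
  \<comment> \<open>This is where linear quotients enter: an earlier generator dividing
    \<open>m\<close> forces a variable of \<open>V\<close> into \<open>m - f\<close>.\<close>
  have disj: "\<not> slice V f m" if mP: "m \<in> P" for m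
  proof
    assume s: "slice V f m"
    obtain k where k: "k < r" "es ! k \<preceq> m"
      using mP P[of m] by blast
    then obtain p k' where p: "lookup f p < lookup (es ! k) p" "k' < r" "es ! k' \<preceq> f + unit_exp p"
      using lq r unfolding linear_quotient_order_def f_def by blast
    have "es ! k \<in> exps n"
      using es k r by auto
    then have "p \<in> {1..n}"
      using p(1) by (force simp: exps_iff)
    then have "p \<in> V"
      using p by (auto simp: V_def)
    moreover have "p \<in> keys (m - f)"
      using k(2) p(1) by (auto simp: in_keys_iff lookup_minus divides_exp_def dest: spec[of _ p])
    ultimately show False
      using s by (auto simp: slice_def)
  qed
  have Pup: "k + unit_exp i \<in> P" if "k \<in> P" "i \<in> {1..n}" for k i
    using that upset_add[of k n _ "unit_exp i"] by (simp add: P_def unit_exp_in_exps_iff add.commute)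
  let ?h = "homotopy V f z"
  have fin: "finite S" if "S \<subseteq> {1..n}" for S
    using that finite_subset by blast
  have keysh: "k \<in> exps n \<and> f \<preceq> k \<and> exp_degree k + 1 = q" if k: "k \<in> keys (?h S)" and S: "S \<subseteq> {1..n}" for k S
  proof -
    obtain i where i: "slice V f k" "i \<in> S" "k + unit_exp i \<in> keys (z (S - {i}))"
      using keys_homotopy[OF fin[OF S] k] by blast
    have S': "S - {i} \<subseteq> {1..n}"
      using S by blast
    then have "k + unit_exp i \<in> exps n" "exp_degree (k + unit_exp i) = q"
      using Suc.prems(2)[OF S'] Suc.prems(3)[OF S'] i(3) by (auto simp: upset_def homogeneous_def)
    then show ?thesis
      using i(1) by (simp add: exps_add_iff exp_degree_add slice_def)
  qed
  \<comment> \<open>Subtracting a boundary of the same degree preserves the cycle condition and the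
    degree, and clears the slice.\<close>
  define z' where "z' S = z S - koszul n ?h S" for S
  have keysz': "k \<in> keys (z S) \<or> (k \<in> exps n \<and> f \<preceq> k \<and> exp_degree k = q)"
    if k: "k \<in> keys (z' S)" and S: "S \<subseteq> {1..n}" for k S
  proof (cases "k \<in> keys (z S)")
    case False
    then have "k \<in> keys (koszul n ?h S)"
      using k by (simp add: z'_def in_keys_iff lookup_minus)
    then obtain i l where i: "i \<in> {1..n} - S" "l \<in> keys (?h (insert i S))" "k = l + unit_exp i"
      by (rule keys_koszul)
    then have "l \<in> exps n \<and> f \<preceq> l \<and> exp_degree l + 1 = q"
      using keysh[of l "insert i S"] S by simp
    then show ?thesis
      using i divides_exp_add(1) divides_exp_trans
      by (auto simp: exps_add_iff unit_exp_in_exps_iff exp_degree_add)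
  qed simp
  have up: "k \<in> upset n (set (take (Suc r) es))" if "k \<in> keys (z' S)" "S \<subseteq> {1..n}" for k S
    using keysz'[OF that] Suc.prems(2)[OF that(2)] P'[of k] by blast
  have notslice: "\<not> slice V f k" if k: "k \<in> keys (z' S)" and S: "S \<subseteq> {1..n}" for k S
  proof
    assume "slice V f k"
    then have "lookup (koszul n ?h S) k = lookup (z S) k"
    proof (intro koszul_homotopy)
      show "k \<in> exps n"
        using up[OF k S] by (simp add: upset_def)
      show "f \<notin> keys (z S)" if "S \<subseteq> {1..n}" for S
        using Suc.prems(3)[OF that] f(2) q by (auto simp: homogeneous_def)
      show "slice V f k" if "S \<subseteq> {1..n}" "k \<in> keys (z S)" "i \<in> {1..n}" "slice V f (k + unit_exp i)" for S k i
        using split[of k] Suc.prems(2)[OF that(1)] that(2) Pup[OF _ that(3), of k] disj[of "k + unit_exp i"] that(4)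
        by blast
    qed (use S Suc.prems(4) in auto)
    then show False
      using k by (simp add: z'_def in_keys_iff lookup_minus)
  qed
  have "\<exists>y. (\<forall>S\<subseteq>{1..n}. keys (y S) \<subseteq> upset n (set (take r es))) \<and> (\<forall>T\<subseteq>{1..n}. koszul n y T = z' T)"
  proof (rule Suc.IH)
    fix S :: "nat set" assume S: "S \<subseteq> {1..n}"
    show "keys (z' S) \<subseteq> upset n (set (take r es))"
      using up[OF _ S] split notslice[OF _ S] unfolding P_def[symmetric] by (meson subsetI)
    show "homogeneous q (z' S)"
      using keysz'[OF _ S] Suc.prems(3)[OF S] unfolding homogeneous_def by blast
    show "koszul n z' S = 0"
      using koszul_diff[of n z "koszul n ?h" S] koszul_koszul[OF S, of ?h] Suc.prems(4)[OF S]
      unfolding z'_def by simp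
  qed (use r in simp)
  then obtain y where y: "\<forall>S\<subseteq>{1..n}. keys (y S) \<subseteq> P" "\<forall>T\<subseteq>{1..n}. koszul n y T = z' T"
    unfolding P_def by blast
  have PP: "P \<subseteq> upset n (set (take (Suc r) es))"
    by (simp add: subset_iff P')
  have "keys (y S + ?h S) \<subseteq> upset n (set (take (Suc r) es))" if S: "S \<subseteq> {1..n}" for S
  proof
    fix m assume "m \<in> keys (y S + ?h S)"
    then have "m \<in> keys (y S) \<or> m \<in> keys (?h S)"
      using keys_add[of "y S" "?h S"] by (meson UnE subsetD)
    then show "m \<in> upset n (set (take (Suc r) es))"
    proof
      assume "m \<in> keys (y S)"
      then show ?thesis
        using y(1) S PP by (meson subsetD)
    next
      assume "m \<in> keys (?h S)"
      then show ?thesis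
        using keysh[OF _ S, of m] P'[of m] by simp
    qed
  qed
  moreover have "koszul n (\<lambda>S. y S + ?h S) T = z T" if "T \<subseteq> {1..n}" for T
    using y(2) that by (simp add: koszul_add z'_def)
  ultimately show ?case
    by (intro exI[of _ "\<lambda>S. y S + ?h S"]) blast
qed

text \<open>The slice for \<open>V = {}\<close> and \<open>f = 0\<close> consists of all monomials,
  and the only obstruction to the contraction sits at the monomial 1. Without constant terms the
  contraction is an explicit preimage.\<close>

lemma koszul_exact_ring:
  fixes z :: "nat set \<Rightarrow> 'k::field mpoly"
  assumes keys: "\<And>S. S \<subseteq> {1..n} \<Longrightarrow> keys (z S) \<subseteq> exps n - {0}"
    and cyc: "\<And>S. S \<subseteq> {1..n} \<Longrightarrow> koszul n z S = 0"
    and T: "T \<subseteq> {1..n}"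
  shows "koszul n (homotopy {} 0 z) T = z T"
proof (rule poly_mapping_eqI)
  fix m
  show "lookup (koszul n (homotopy {} 0 z) T) m = lookup (z T) m"
  proof (cases "m \<in> exps n")
    case True
    then show ?thesis
      by (rule koszul_homotopy[OF T]) (use cyc keys in \<open>auto simp: slice_def divides_exp_def\<close>)
  next
    case False
    have "m \<notin> keys (koszul n (homotopy {} 0 z) T)"
    proof
      assume "m \<in> keys (koszul n (homotopy {} 0 z) T)"
      then obtain i k where i: "i \<in> {1..n} - T" "k \<in> keys (homotopy {} 0 z (insert i T))" "m = k + unit_exp i"
        by (rule keys_koszul)
      have fin: "finite (insert i T)" and sub: "insert i T \<subseteq> {1..n}"
        using T i finite_subset by auto
      obtain l where "l \<in> insert i T" "k + unit_exp l \<in> keys (z (insert i T - {l}))"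
        using keys_homotopy[OF fin i(2)] by blast
      moreover have "insert i T - {l} \<subseteq> {1..n}"
        using sub by blast
      ultimately have "k + unit_exp l \<in> exps n"
        using keys by blast
      then show False
        using False i by (auto simp: exps_add_iff unit_exp_in_exps_iff)
    qed
    then show ?thesis
      using False keys[OF T] by (auto simp: in_keys_iff)
  qed
qed

declare split_paired_All [simp del] split_paired_Ex [simp del]

section \<open>Graded free modules\<close>

definition smul :: "'k::field mpoly \<Rightarrow> 'k fvec \<Rightarrow> 'k fvec" where
  "smul r v = (\<lambda>e. r * v e)"

definition basis_vec :: "nat \<times> nat \<Rightarrow> 'k::field fvec" where
  "basis_vec e = (\<lambda>e'. if e' = e then 1 else 0)"

definition finsupp :: "'k::field fvec \<Rightarrow> bool" where
  "finsupp v \<longleftrightarrow> finite {e. v e \<noteq> 0}"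

definition hom_vec :: "nat \<Rightarrow> 'k::field fvec \<Rightarrow> bool" where
  "hom_vec j v \<longleftrightarrow> (\<forall>e. \<forall>m\<in>keys (v e). exp_degree m + fst e = j)"

definition poly_filter :: "((nat \<Rightarrow>\<^sub>0 nat) \<Rightarrow> bool) \<Rightarrow> 'k::field mpoly \<Rightarrow> 'k mpoly" where
  "poly_filter P p = (\<Sum>m\<in>{m \<in> keys p. P m}. Poly_Mapping.single m (lookup p m))"

definition part :: "nat \<Rightarrow> 'k::field fvec \<Rightarrow> 'k fvec" where
  "part j v = (\<lambda>e. poly_filter (\<lambda>m. exp_degree m + fst e = j) (v e))"

lemma fun_sum_apply: "(\<Sum>i\<in>A. f i) x = (\<Sum>i\<in>A. f i x)"
  by (induction A rule: infinite_finite_induct) auto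

lemma smul_apply [simp]: "smul r v e = r * v e"
  by (simp add: smul_def)

lemma lookup_poly_filter [simp]: "lookup (poly_filter P p) m = (if P m then lookup p m else 0)"
proof -
  have "lookup (poly_filter P p) m = (\<Sum>k\<in>{m \<in> keys p. P m}. if k = m then lookup p k else 0)"
    by (simp add: poly_filter_def lookup_sum lookup_single when_def)
  also have "\<dots> = (if P m then lookup p m else 0)"
    by (simp add: sum.delta in_keys_iff)
  finally show ?thesis .
qed

lemma keys_poly_filter: "keys (poly_filter P p) = {m \<in> keys p. P m}"
  by (auto simp: in_keys_iff split: if_splits)

lemma poly_filter_zero [simp]: "poly_filter P 0 = 0"
  by (simp add: poly_filter_def)

lemma poly_filter_add: "poly_filter P (p + q) = poly_filter P p + poly_filter P q"
  by (rule poly_mapping_eqI) (simp add: lookup_add)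

lemma poly_filter_sum: "poly_filter P (\<Sum>i\<in>A. f i) = (\<Sum>i\<in>A. poly_filter P (f i))"
  by (rule poly_mapping_eqI) (simp add: lookup_sum)

lemma poly_filter_all: "(\<And>m. m \<in> keys p \<Longrightarrow> P m) \<Longrightarrow> poly_filter P p = p"
  by (rule poly_mapping_eqI) (auto simp: in_keys_iff)

lemma poly_filter_none: "(\<And>m. m \<in> keys p \<Longrightarrow> \<not> P m) \<Longrightarrow> poly_filter P p = 0"
  by (rule poly_mapping_eqI) (auto simp: in_keys_iff)

lemma poly_filter_mult:
  fixes p h :: "'k::field mpoly"
  assumes "\<And>a m. m \<in> keys h \<Longrightarrow> P a \<longleftrightarrow> Q (a + m)"
  shows "poly_filter Q (p * h) = poly_filter P p * h"
proof -
  have "p = poly_filter P p + poly_filter (\<lambda>m. \<not> P m) p"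
    by (rule poly_mapping_eqI) (simp add: lookup_add)
  then have "p * h = poly_filter P p * h + poly_filter (\<lambda>m. \<not> P m) p * h"
    by (metis distrib_right)
  then have "poly_filter Q (p * h) =
      poly_filter Q (poly_filter P p * h) + poly_filter Q (poly_filter (\<lambda>m. \<not> P m) p * h)"
    by (simp add: poly_filter_add)
  moreover have "poly_filter Q (poly_filter P p * h) = poly_filter P p * h"
  proof (rule poly_filter_all)
    fix m assume "m \<in> keys (poly_filter P p * h)"
    then obtain a b where "a \<in> keys (poly_filter P p)" "b \<in> keys h" "m = a + b"
      using keys_mult_sub by blast
    then show "Q m"
      using assms by (auto simp: keys_poly_filter)
  qed
  moreover have "poly_filter Q (poly_filter (\<lambda>m. \<not> P m) p * h) = 0"
  proof (rule poly_filter_none)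
    fix m assume "m \<in> keys (poly_filter (\<lambda>m. \<not> P m) p * h)"
    then obtain a b where "a \<in> keys (poly_filter (\<lambda>m. \<not> P m) p)" "b \<in> keys h" "m = a + b"
      using keys_mult_sub by blast
    then show "\<not> Q m"
      using assms by (auto simp: keys_poly_filter)
  qed
  ultimately show ?thesis
    by simp
qed

lemma finsupp_zero [simp]: "finsupp 0"
  by (simp add: finsupp_def)

lemma finsupp_add: "finsupp v \<Longrightarrow> finsupp w \<Longrightarrow> finsupp (v + w)"
  unfolding finsupp_def by (rule finite_subset[of _ "{e. v e \<noteq> 0} \<union> {e. w e \<noteq> 0}"]) auto

lemma finsupp_smul: "finsupp v \<Longrightarrow> finsupp (smul r v)"
  unfolding finsupp_def by (rule finite_subset[of _ "{e. v e \<noteq> 0}"]) auto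

lemma finsupp_part: "finsupp v \<Longrightarrow> finsupp (part j v)"
  unfolding finsupp_def by (rule finite_subset[of _ "{e. v e \<noteq> 0}"]) (auto simp: part_def)

lemma lin_to_ring_superset:
  assumes "finite A" "{e. v e \<noteq> 0} \<subseteq> A"
  shows "lin_to_ring g v = (\<Sum>e\<in>A. v e * g e)"
  unfolding lin_to_ring_def by (rule sum.mono_neutral_left) (use assms in auto)

lemma lin_to_ring_zero [simp]: "lin_to_ring g 0 = 0"
  by (simp add: lin_to_ring_def)

lemma lin_to_ring_add:
  assumes "finsupp v" "finsupp w"
  shows "lin_to_ring g (v + w) = lin_to_ring g v + lin_to_ring g w"
proof -
  let ?A = "{e. v e \<noteq> 0} \<union> {e. w e \<noteq> 0}"
  have A: "finite ?A"
    using assms by (simp add: finsupp_def)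
  have "lin_to_ring g (v + w) = (\<Sum>e\<in>?A. (v + w) e * g e)"
    by (rule lin_to_ring_superset[OF A]) auto
  also have "\<dots> = (\<Sum>e\<in>?A. v e * g e) + (\<Sum>e\<in>?A. w e * g e)"
    by (simp add: distrib_right sum.distrib)
  also have "\<dots> = lin_to_ring g v + lin_to_ring g w"
    by (simp add: lin_to_ring_superset[OF A])
  finally show ?thesis .
qed

lemma lin_to_ring_smul:
  assumes "finsupp v"
  shows "lin_to_ring g (smul r v) = r * lin_to_ring g v"
proof -
  have A: "finite {e. v e \<noteq> 0}"
    using assms by (simp add: finsupp_def)
  have "lin_to_ring g (smul r v) = (\<Sum>e\<in>{e. v e \<noteq> 0}. smul r v e * g e)"
    by (rule lin_to_ring_superset[OF A]) auto
  also have "\<dots> = r * lin_to_ring g v"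
    by (simp add: lin_to_ring_def sum_distrib_left mult.assoc)
  finally show ?thesis .
qed

lemma lin_to_free_apply: "lin_to_free D v e' = lin_to_ring (\<lambda>e. D e e') v"
  by (simp add: lin_to_free_def lin_to_ring_def)

lemma lin_to_free_zero [simp]: "lin_to_free D 0 = 0"
  by (rule ext) (simp add: lin_to_free_apply)

lemma lin_to_free_add:
  "finsupp v \<Longrightarrow> finsupp w \<Longrightarrow> lin_to_free D (v + w) = lin_to_free D v + lin_to_free D w"
  by (rule ext) (simp add: lin_to_free_apply lin_to_ring_add)

lemma lin_to_free_smul:
  "finsupp v \<Longrightarrow> lin_to_free D (smul r v) = smul r (lin_to_free D v)"
  by (rule ext) (simp add: lin_to_free_apply lin_to_ring_smul)

lemma finsupp_sum: "(\<And>i. i \<in> A \<Longrightarrow> finsupp (f i)) \<Longrightarrow> finsupp (\<Sum>i\<in>A. f i)"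
  by (induction A rule: infinite_finite_induct) (auto intro: finsupp_add)

lemma lin_to_free_sum:
  "(\<And>i. i \<in> A \<Longrightarrow> finsupp (f i)) \<Longrightarrow> lin_to_free D (\<Sum>i\<in>A. f i) = (\<Sum>i\<in>A. lin_to_free D (f i))"
  by (induction A rule: infinite_finite_induct) (auto simp: lin_to_free_add finsupp_sum)

lemma lin_to_ring_sum:
  "(\<And>i. i \<in> A \<Longrightarrow> finsupp (f i)) \<Longrightarrow> lin_to_ring D (\<Sum>i\<in>A. f i) = (\<Sum>i\<in>A. lin_to_ring D (f i))"
  by (induction A rule: infinite_finite_induct) (auto simp: lin_to_ring_add finsupp_sum)

lemma smul_minus_one: "smul (- 1) v = - v"
  by (rule ext) simp

lemma finsupp_uminus: "finsupp v \<Longrightarrow> finsupp (- v)"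
  using finsupp_smul[of v "- 1"] by (simp add: smul_minus_one)

lemma lin_to_free_diff:
  "finsupp v \<Longrightarrow> finsupp w \<Longrightarrow> lin_to_free D (v - w) = lin_to_free D v - lin_to_free D w"
  using lin_to_free_add[of v "smul (- 1) w" D] lin_to_free_smul[of w D "- 1"]
  by (simp add: smul_minus_one finsupp_smul finsupp_uminus)

lemma lin_to_ring_diff:
  "finsupp v \<Longrightarrow> finsupp w \<Longrightarrow> lin_to_ring D (v - w) = lin_to_ring D v - lin_to_ring D w"
  using lin_to_ring_add[of v "smul (- 1) w" D] lin_to_ring_smul[of w D "- 1"]
  by (simp add: smul_minus_one finsupp_smul finsupp_uminus)

lemma lin_to_free_basis_vec [simp]: "lin_to_free D (basis_vec e) = D e"
proof
  fix e'
  have "lin_to_free D (basis_vec e) e' = (\<Sum>x\<in>{e}. basis_vec e x * D x e')"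
    unfolding lin_to_free_apply by (rule lin_to_ring_superset) (auto simp: basis_vec_def)
  then show "lin_to_free D (basis_vec e) e' = D e e'"
    by (simp add: basis_vec_def)
qed

lemma graded_free_iff:
  "v \<in> graded_free n b \<longleftrightarrow> finsupp v \<and> (\<forall>e. keys (v e) \<subseteq> exps n) \<and> (\<forall>j k. b j \<le> k \<longrightarrow> v (j, k) = 0)"
  by (simp add: graded_free_def finsupp_def in_poly_ring_iff)

lemma graded_free_index: "v \<in> graded_free n b \<Longrightarrow> v (j, k) \<noteq> 0 \<Longrightarrow> k < b j"
  by (meson graded_free_iff not_le)

lemma graded_free_finsupp: "v \<in> graded_free n b \<Longrightarrow> finsupp v"
  by (simp add: graded_free_iff)

lemma graded_free_zero [simp]: "0 \<in> graded_free n b"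
  by (simp add: graded_free_iff)

lemma graded_free_add: "v \<in> graded_free n b \<Longrightarrow> w \<in> graded_free n b \<Longrightarrow> v + w \<in> graded_free n b"
proof -
  assume v: "v \<in> graded_free n b" and w: "w \<in> graded_free n b"
  have "keys (v e + w e) \<subseteq> exps n" for e
    using v w keys_add[of "v e" "w e"] unfolding graded_free_iff by blast
  then show ?thesis
    using v w by (simp add: graded_free_iff finsupp_add)
qed

lemma exps_keys_mult:
  fixes p q :: "'k::field mpoly"
  assumes "keys p \<subseteq> exps n" "keys q \<subseteq> exps n"
  shows "keys (p * q) \<subseteq> exps n"
proof
  fix m assume "m \<in> keys (p * q)"
  then obtain a b where "a \<in> keys p" "b \<in> keys q" "m = a + b"
    using keys_mult_sub by blast
  then show "m \<in> exps n"
    using assms by (auto simp: exps_add_iff)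
qed

lemma graded_free_smul: "v \<in> graded_free n b \<Longrightarrow> keys r \<subseteq> exps n \<Longrightarrow> smul r v \<in> graded_free n b"
  by (simp add: graded_free_iff finsupp_smul exps_keys_mult)

lemma graded_free_part: "v \<in> graded_free n b \<Longrightarrow> part j v \<in> graded_free n b"
  by (auto simp: graded_free_iff finsupp_part) (auto simp: part_def keys_poly_filter)

lemma graded_free_sum: "(\<And>i. i \<in> A \<Longrightarrow> f i \<in> graded_free n b) \<Longrightarrow> (\<Sum>i\<in>A. f i) \<in> graded_free n b"
  by (induction A rule: infinite_finite_induct) (auto intro: graded_free_add)

lemma graded_free_diff: "v \<in> graded_free n b \<Longrightarrow> w \<in> graded_free n b \<Longrightarrow> v - w \<in> graded_free n b"
  using graded_free_add[of v n b "smul (- 1) w"] graded_free_smul[of w n b "- 1"]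
  by (simp add: smul_minus_one)

lemma graded_free_basis_vec: "k < b j \<Longrightarrow> basis_vec (j, k) \<in> graded_free n b"
  by (auto simp: graded_free_iff basis_vec_def finsupp_def)

lemma hom_vec_part: "hom_vec j (part j v)"
  by (simp add: hom_vec_def part_def keys_poly_filter)

lemma part_hom_vec: "hom_vec j v \<Longrightarrow> part j v = v"
  by (rule ext) (simp add: hom_vec_def part_def poly_filter_all)

lemma part_zero [simp]: "part j 0 = 0"
  by (rule ext) (simp add: part_def)

lemma hom_vec_zero [simp]: "hom_vec j 0"
  by (simp add: hom_vec_def)

lemma sum_parts:
  assumes "finsupp v"
  obtains N where "v = (\<Sum>j\<le>N. part j v)"
proof -
  let ?J = "\<Union>e\<in>{e. v e \<noteq> 0}. (\<lambda>m. exp_degree m + fst e) ` keys (v e)"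
  have "finite ?J"
    using assms by (auto simp: finsupp_def)
  then obtain N where N: "\<And>j. j \<in> ?J \<Longrightarrow> j \<le> N"
    by (meson finite_nat_set_iff_bounded_le)
  have "v e = (\<Sum>j\<le>N. part j v) e" for e
  proof (rule poly_mapping_eqI)
    fix m
    have "lookup ((\<Sum>j\<le>N. part j v) e) m = (\<Sum>j\<le>N. if exp_degree m + fst e = j then lookup (v e) m else 0)"
      by (simp add: fun_sum_apply lookup_sum part_def)
    also have "\<dots> = (if exp_degree m + fst e \<le> N then lookup (v e) m else 0)"
      by simp
    also have "\<dots> = lookup (v e) m"
    proof (cases "m \<in> keys (v e)")
      case True
      then have "v e \<noteq> 0"
        by auto
      then have "exp_degree m + fst e \<in> ?J"
        using True by blast
      then show ?thesis
        using N by simp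
    qed (simp add: in_keys_iff)
    finally show "lookup (v e) m = lookup ((\<Sum>j\<le>N. part j v) e) m" ..
  qed
  then show ?thesis
    using that by blast
qed

lemma part_lin_to_free:
  assumes v: "finsupp v" and D: "\<And>e. v e \<noteq> 0 \<Longrightarrow> hom_vec (fst e) (D e)"
  shows "part j (lin_to_free D v) = lin_to_free D (part j v)"
proof
  fix e'
  let ?A = "{e. v e \<noteq> 0}"
  have A: "finite ?A"
    using v by (simp add: finsupp_def)
  have "part j (lin_to_free D v) e' =
      (\<Sum>e\<in>?A. poly_filter (\<lambda>m. exp_degree m + fst e' = j) (v e * D e e'))"
    by (simp add: part_def lin_to_free_def poly_filter_sum)
  also have "\<dots> = (\<Sum>e\<in>?A. part j v e * D e e')"
  proof (rule sum.cong[OF refl])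
    fix e assume "e \<in> ?A"
    then have "exp_degree m + fst e' = fst e" if "m \<in> keys (D e e')" for m
      using D[of e] that by (simp add: hom_vec_def)
    then show "poly_filter (\<lambda>m. exp_degree m + fst e' = j) (v e * D e e') = part j v e * D e e'"
      unfolding part_def by (intro poly_filter_mult) (metis add.assoc exp_degree_add)
  qed
  also have "\<dots> = lin_to_free D (part j v) e'"
    unfolding lin_to_free_apply
    by (rule lin_to_ring_superset[OF A, symmetric]) (auto simp: part_def)
  finally show "part j (lin_to_free D v) e' = lin_to_free D (part j v) e'" .
qed

section \<open>Minimal covers of graded submodules\<close>

definition graded_submodule :: "nat \<Rightarrow> (nat \<Rightarrow> nat) \<Rightarrow> 'k::field fvec set \<Rightarrow> bool" where
  "graded_submodule n b M \<longleftrightarrow> M \<subseteq> graded_free n b \<and> 0 \<in> M \<and> (\<forall>v\<in>M. \<forall>w\<in>M. v + w \<in> M) \<and>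
     (\<forall>v\<in>M. \<forall>r. keys r \<subseteq> exps n \<longrightarrow> smul r v \<in> M) \<and> (\<forall>v\<in>M. \<forall>j. part j v \<in> M)"

definition hom_gens :: "(nat \<Rightarrow> nat) \<Rightarrow> (nat \<times> nat \<Rightarrow> 'k::field fvec) \<Rightarrow> bool" where
  "hom_gens b D \<longleftrightarrow> (\<forall>j k. k < b j \<longrightarrow> hom_vec j (D (j, k)))"

definition lin_kernel :: "nat \<Rightarrow> (nat \<Rightarrow> nat) \<Rightarrow> (nat \<times> nat \<Rightarrow> 'k::field fvec) \<Rightarrow> 'k fvec set" where
  "lin_kernel n b D = {v \<in> graded_free n b. lin_to_free D v = 0}"

text \<open>Minimality is put on the kernel rather than on the matrix of the next map, so that a
  single cover can be treated before the next one is chosen.\<close>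

definition minimal_cover ::
  "nat \<Rightarrow> 'k::field fvec set \<Rightarrow> (nat \<Rightarrow> nat) \<Rightarrow> (nat \<times> nat \<Rightarrow> 'k fvec) \<Rightarrow> bool" where
  "minimal_cover n M b D \<longleftrightarrow> hom_gens b D \<and> lin_to_free D ` graded_free n b = M \<and>
     (\<forall>v\<in>lin_kernel n b D. \<forall>e. lookup (v e) 0 = 0)"

lemma hom_gens_hom_vec:
  assumes "hom_gens b D" "v \<in> graded_free n b" "v e \<noteq> 0"
  shows "hom_vec (fst e) (D e)"
  using assms graded_free_index[OF assms(2)] by (cases e) (auto simp: hom_gens_def)

lemma part_lin_to_free': "hom_gens b D \<Longrightarrow> v \<in> graded_free n b \<Longrightarrow>
    part j (lin_to_free D v) = lin_to_free D (part j v)"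
  by (rule part_lin_to_free) (auto simp: graded_free_finsupp intro: hom_gens_hom_vec)

lemma graded_submodule_lin_kernel:
  assumes "hom_gens b D"
  shows "graded_submodule n b (lin_kernel n b D)"
  unfolding graded_submodule_def lin_kernel_def
proof (intro conjI ballI allI impI)
  fix v :: "'a fvec" and j assume v: "v \<in> {v \<in> graded_free n b. lin_to_free D v = 0}"
  then have "lin_to_free D (part j v) = 0"
    using part_lin_to_free'[OF assms, of v n j] by simp
  then show "part j v \<in> {v \<in> graded_free n b. lin_to_free D v = 0}"
    using v by (simp add: graded_free_part)
qed (auto simp: graded_free_add graded_free_smul lin_to_free_add lin_to_free_smul graded_free_finsupp
    fun_eq_iff)

lemma subspace_lin_image:
  fixes D :: "nat \<times> nat \<Rightarrow> 'k::field fvec"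
  shows "v \<in> lin_to_free D ` graded_free n b \<Longrightarrow> w \<in> lin_to_free D ` graded_free n b \<Longrightarrow>
    v + w \<in> lin_to_free D ` graded_free n b"
    and "v \<in> lin_to_free D ` graded_free n b \<Longrightarrow> keys r \<subseteq> exps n \<Longrightarrow>
    smul r v \<in> lin_to_free D ` graded_free n b"
proof -
  assume "v \<in> lin_to_free D ` graded_free n b" "w \<in> lin_to_free D ` graded_free n b"
  then obtain v' w' where "v' \<in> graded_free n b" "w' \<in> graded_free n b"
    "v = lin_to_free D v'" "w = lin_to_free D w'"
    by blast
  then show "v + w \<in> lin_to_free D ` graded_free n b"
    by (intro image_eqI[of _ _ "v' + w'"]) (simp_all add: lin_to_free_add graded_free_finsupp graded_free_add)
next
  assume "v \<in> lin_to_free D ` graded_free n b" and r: "keys r \<subseteq> exps n"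
  then obtain v' where "v' \<in> graded_free n b" "v = lin_to_free D v'"
    by blast
  then show "smul r v \<in> lin_to_free D ` graded_free n b"
    using r by (intro image_eqI[of _ _ "smul r v'"])
      (simp_all add: lin_to_free_smul graded_free_finsupp graded_free_smul)
qed

section \<open>Graded pieces as vector spaces over the field\<close>

definition kscale :: "'k::field \<Rightarrow> 'k fvec \<Rightarrow> 'k fvec" where
  "kscale c v = smul (Poly_Mapping.single 0 c) v"

global_interpretation fvec: vector_space "kscale :: 'k::field \<Rightarrow> 'k fvec \<Rightarrow> 'k fvec"
  by unfold_locales
    (auto simp: kscale_def fun_eq_iff algebra_simps single_add mult_single[of 0 _ 0, simplified, symmetric])

text \<open>An element of degree \<open>j\<close> involves only basis elements and monomials of
  degree at most \<open>j\<close>, of which there are finitely many.\<close>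

lemma finite_dimensional_degree:
  fixes M :: "'k::field fvec set"
  assumes "M \<subseteq> {v \<in> graded_free n b. hom_vec j v}"
  obtains B where "finite B" "B \<subseteq> M" "M \<subseteq> fvec.span B"
proof -
  define W where "W = (\<lambda>(m, e). smul (monom m) (basis_vec e) :: 'k fvec) `
    ({m \<in> exps n. exp_degree m \<le> j} \<times> (SIGMA i:{..j}. {..<b i}))"
  have finW: "finite W"
    unfolding W_def by (intro finite_imageI finite_SigmaI finite_exps_degree) auto
  have "v \<in> fvec.span W" if v: "v \<in> graded_free n b" "hom_vec j v" for v
  proof -
    have supp: "finite {e. v e \<noteq> 0}"
      using v(1) by (simp add: graded_free_iff finsupp_def)
    have "v = (\<Sum>e\<in>{e. v e \<noteq> 0}. \<Sum>m\<in>keys (v e). kscale (lookup (v e) m) (smul (monom m) (basis_vec e)))"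
    proof
      fix x
      have "(\<Sum>e\<in>{e. v e \<noteq> 0}. \<Sum>m\<in>keys (v e). kscale (lookup (v e) m) (smul (monom m) (basis_vec e))) x =
          (\<Sum>e\<in>{e. v e \<noteq> 0}. if x = e then v e else 0)"
        unfolding fun_sum_apply
      proof (intro sum.cong refl)
        fix e
        have "(\<Sum>m\<in>keys (v e). kscale (lookup (v e) m) (smul (monom m) (basis_vec e)) x) =
            (\<Sum>m\<in>keys (v e). if x = e then Poly_Mapping.single m (lookup (v e) m) else 0)"
          by (rule sum.cong) (simp_all add: kscale_def basis_vec_def mult_single)
        then show "(\<Sum>m\<in>keys (v e). kscale (lookup (v e) m) (smul (monom m) (basis_vec e)) x) =
            (if x = e then v e else 0)"
          by (simp add: sum_single_keys)
      qed
      also have "\<dots> = v x"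
        using supp by (simp add: sum.delta)
      finally show "v x = (\<Sum>e\<in>{e. v e \<noteq> 0}. \<Sum>m\<in>keys (v e).
          kscale (lookup (v e) m) (smul (monom m) (basis_vec e))) x" ..
    qed
    moreover have "kscale (lookup (v e) m) (smul (monom m) (basis_vec e)) \<in> fvec.span W"
      if e: "e \<in> {e. v e \<noteq> 0}" and m: "m \<in> keys (v e)" for e m
    proof -
      obtain i k where ik: "e = (i, k)"
        by (cases e)
      have "exp_degree m + i = j"
        using v(2) m ik unfolding hom_vec_def by (metis fst_conv)
      moreover have "k < b i"
        using graded_free_index[OF v(1)] e ik by blast
      moreover have "m \<in> exps n"
        using v(1) m by (auto simp: graded_free_iff)
      ultimately have "smul (monom m) (basis_vec e) \<in> W"
        unfolding W_def ik by (intro image_eqI[of _ _ "(m, (i, k))"]) auto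
      then show ?thesis
        by (intro fvec.span_scale fvec.span_base)
    qed
    ultimately show ?thesis
      by (metis (no_types, lifting) fvec.span_sum)
  qed
  then have MW: "M \<subseteq> fvec.span W"
    using assms by blast
  \<comment> \<open>\<open>W\<close> need not lie in \<open>M\<close>; a maximal independent subset
    of \<open>M\<close> does, and it is no larger than \<open>W\<close>.\<close>
  obtain B where B: "B \<subseteq> M" "fvec.independent B" "M \<subseteq> fvec.span B"
    using fvec.maximal_independent_subset[of M] by blast
  have "finite B"
    using fvec.independent_span_bound[OF finW B(2)] B(1) MW by blast
  then show ?thesis
    using that B by blast
qed

text \<open>Modulo \<open>N\<close>, the elements of a spanning set of least cardinality are linearly independent.\<close>

lemma minimal_generators:
  fixes M N :: "'k::field fvec set"
  assumes "M \<subseteq> {v \<in> graded_free n b. hom_vec j v}"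
  obtains B where "finite B" "B \<subseteq> M" "M \<subseteq> fvec.span (N \<union> B)"
    "\<And>x. x \<in> B \<Longrightarrow> x \<notin> fvec.span (N \<union> (B - {x}))"
proof -
  let ?P = "\<lambda>c. \<exists>B. finite B \<and> B \<subseteq> M \<and> M \<subseteq> fvec.span (N \<union> B) \<and> card B = c"
  obtain B0 where "finite B0" "B0 \<subseteq> M" "M \<subseteq> fvec.span B0"
    using finite_dimensional_degree[OF assms] .
  moreover have "fvec.span B0 \<subseteq> fvec.span (N \<union> B0)"
    by (rule fvec.span_mono) simp
  ultimately have "?P (card B0)"
    by blast
  then obtain c where c: "?P c" "\<forall>c'<c. \<not> ?P c'"
    using exists_least_iff[of ?P] by blast
  then obtain B where B: "finite B" "B \<subseteq> M" "M \<subseteq> fvec.span (N \<union> B)" "card B = c"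
    by blast
  have "x \<notin> fvec.span (N \<union> (B - {x}))" if x: "x \<in> B" for x
  proof
    assume "x \<in> fvec.span (N \<union> (B - {x}))"
    then have "fvec.span (insert x (N \<union> (B - {x}))) = fvec.span (N \<union> (B - {x}))"
      by (rule fvec.span_redundant)
    moreover have "insert x (N \<union> (B - {x})) = N \<union> B"
      using x by blast
    ultimately have "M \<subseteq> fvec.span (N \<union> (B - {x}))"
      using B(3) by simp
    moreover have "card (B - {x}) < c"
      using B(1,4) x card_Diff1_less by metis
    ultimately show False
      using c(2) B(1,2) by blast
  qed
  then show ?thesis
    using that B by blast
qed

lemma lin_to_free_eq_sum: "lin_to_free D v = (\<Sum>e | v e \<noteq> 0. smul (v e) (D e))"
  by (rule ext) (simp add: lin_to_free_def fun_sum_apply)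

lemma smul_smul: "smul r (smul s v) = smul (r * s) v"
  by (rule ext) (simp add: mult.assoc)

lemma smul_eq_sum: "smul p w = (\<Sum>m\<in>keys p. smul (Poly_Mapping.single m (lookup p m)) w)"
proof
  fix e
  show "smul p w e = (\<Sum>m\<in>keys p. smul (Poly_Mapping.single m (lookup p m)) w) e"
    by (subst sum_single_keys[of p, symmetric]) (simp only: smul_apply fun_sum_apply sum_distrib_right)
qed

lemma hom_vec_smul:
  assumes "\<And>m. m \<in> keys r \<Longrightarrow> exp_degree m = q" "hom_vec j v"
  shows "hom_vec (q + j) (smul r v)"
  unfolding hom_vec_def
proof (intro allI ballI)
  fix e m assume "m \<in> keys (smul r v e)"
  then obtain a c where "a \<in> keys r" "c \<in> keys (v e)" "m = a + c"
    using keys_mult_sub[of m r "v e"] by auto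
  then show "exp_degree m + fst e = q + j"
    using assms by (auto simp: hom_vec_def exp_degree_add)
qed

lemma graded_submodule_sum:
  assumes "graded_submodule n b M" "\<And>i. i \<in> A \<Longrightarrow> f i \<in> M"
  shows "(\<Sum>i\<in>A. f i) \<in> M"
  using assms(2) by (induction A rule: infinite_finite_induct)
    (use assms(1) in \<open>auto simp: graded_submodule_def\<close>)

lemma keys_const:
  assumes "\<And>m. m \<in> keys p \<Longrightarrow> exp_degree m = 0"
  shows "p = Poly_Mapping.single 0 (lookup p 0)"
proof (rule poly_mapping_eqI)
  fix m
  show "lookup p m = lookup (Poly_Mapping.single 0 (lookup p 0)) m"
    using assms[of m] by (auto simp: lookup_single when_def exp_degree_eq_0_iff in_keys_iff)
qed

text \<open>Graded Nakayama: in each degree \<open>j\<close> finitely many generators are chosen,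
  minimally modulo \<open>N j\<close>, the elements of degree \<open>j\<close> obtained from degree
  \<open>j - 1\<close> by multiplication with a variable.\<close>

lemma exists_minimal_cover:
  fixes M :: "'k::field fvec set"
  assumes M: "graded_submodule n b M"
  shows "\<exists>b' D. minimal_cover n M b' D \<and> (\<forall>j k. \<not> k < b' j \<longrightarrow> D (j, k) = 0)"
proof -
  define Mj where "Mj j = {v \<in> M. hom_vec j v}" for j
  define N where "N j = {smul (var i) w |i w. i \<in> {1..n} \<and> w \<in> M \<and> (\<exists>q. hom_vec q w \<and> Suc q = j)}" for j
  have MG: "M \<subseteq> graded_free n b" and M0: "0 \<in> M"
    and Madd: "v + w \<in> M" if "v \<in> M" "w \<in> M" for v w
    using M that by (auto simp: graded_submodule_def)
  have Msmul: "smul r v \<in> M" if "v \<in> M" "keys r \<subseteq> exps n" for v r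
    using M that by (simp add: graded_submodule_def)
  have Mpart: "part j v \<in> M" if "v \<in> M" for j v
    using M that by (simp add: graded_submodule_def)
  have "\<exists>B. finite B \<and> B \<subseteq> Mj j \<and> Mj j \<subseteq> fvec.span (N j \<union> B) \<and>
      (\<forall>x\<in>B. x \<notin> fvec.span (N j \<union> (B - {x})))" for j
  proof -
    have "Mj j \<subseteq> {v \<in> graded_free n b. hom_vec j v}"
      using MG by (auto simp: Mj_def)
    then show ?thesis
      by (rule minimal_generators[of _ n b j "N j"]) blast
  qed
  then obtain B where B: "\<And>j. finite (B j)" "\<And>j. B j \<subseteq> Mj j" "\<And>j. Mj j \<subseteq> fvec.span (N j \<union> B j)"
      "\<And>j x. x \<in> B j \<Longrightarrow> x \<notin> fvec.span (N j \<union> (B j - {x}))"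
    by metis
  define b' where "b' j = card (B j)" for j
  have "\<exists>f. bij_betw f {0..<b' j} (B j)" for j
    unfolding b'_def by (rule ex_bij_betw_nat_finite[OF B(1)])
  then obtain f where f: "\<And>j. bij_betw (f j) {0..<b' j} (B j)"
    by metis
  \<comment> \<open>The value 0 outside the index set keeps every \<open>D e\<close> in
    \<open>M\<close>; for an ideal, this later allows all values to be written as ring
    elements.\<close>
  define D where "D = (\<lambda>(j, k). if k < b' j then f j k else 0)"
  have DB: "D (j, k) \<in> B j" if "k < b' j" for j k
    using that f[of j] by (auto simp: D_def bij_betw_def)
  have Dinj: "k = k'" if "k < b' j" "k' < b' j" "D (j, k) = D (j, k')" for j k k'
    using that f[of j] by (auto simp: D_def bij_betw_def inj_on_def)
  have Dsurj: "\<exists>k<b' j. x = D (j, k)" if "x \<in> B j" for j x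
    using that f[of j] by (force simp: D_def bij_betw_def)
  have DM: "D (j, k) \<in> M" "hom_vec j (D (j, k))" if "k < b' j" for j k
    using DB[OF that] B(2)[of j] by (auto simp: Mj_def)
  have homD: "hom_gens b' D"
    using DM(2) by (simp add: hom_gens_def)
  let ?im = "lin_to_free D ` graded_free n b'"
  have im_sub: "?im \<subseteq> M"
  proof clarify
    fix v :: "'k fvec" assume v: "v \<in> graded_free n b'"
    show "lin_to_free D v \<in> M"
      unfolding lin_to_free_eq_sum
    proof (rule graded_submodule_sum[OF M])
      fix e assume "e \<in> {e. v e \<noteq> 0}"
      then have "D e \<in> M"
        using graded_free_index[OF v] DM(1) by (cases e) auto
      then show "smul (v e) (D e) \<in> M"
        using v by (intro Msmul) (auto simp: graded_free_iff)
    qed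
  qed
  have sub: "fvec.subspace ?im"
  proof (rule fvec.subspaceI)
    show "0 \<in> ?im"
      by (rule image_eqI[of _ _ 0]) simp_all
    show "kscale c x \<in> ?im" if "x \<in> ?im" for c x
      unfolding kscale_def using that by (rule subspace_lin_image(2)) simp
  qed (rule subspace_lin_image(1))
  \<comment> \<open>Strong induction on the degree: \<open>N j\<close> consists of multiples of
    elements of lower degree, which are already in the image.\<close>
  have im_sup: "Mj j \<subseteq> ?im" for j
  proof (induction j rule: less_induct)
    case (less j)
    have "N j \<subseteq> ?im"
    proof
      fix x assume "x \<in> N j"
      then obtain i w q where i: "x = smul (var i) w" "i \<in> {1..n}" "w \<in> M" "hom_vec q w" "Suc q = j"
        by (auto simp: N_def)
      then have "w \<in> ?im"
        using less[of q] by (auto simp: Mj_def)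
      then show "x \<in> ?im"
        unfolding i(1) by (rule subspace_lin_image(2)) (use i(2) in \<open>simp add: var_monom unit_exp_in_exps_iff\<close>)
    qed
    moreover have "B j \<subseteq> ?im"
    proof
      fix x assume "x \<in> B j"
      then obtain k where "k < b' j" "x = D (j, k)"
        using Dsurj by blast
      then show "x \<in> ?im"
        by (intro image_eqI[of _ _ "basis_vec (j, k)"]) (simp_all add: graded_free_basis_vec)
    qed
    ultimately have "fvec.span (N j \<union> B j) \<subseteq> ?im"
      by (intro fvec.span_minimal sub) simp
    then show ?case
      using B(3) by blast
  qed
  have "M \<subseteq> ?im"
  proof
    fix v assume v: "v \<in> M"
    have "finsupp v"
      using v MG graded_free_finsupp by blast
    then obtain K where K: "v = (\<Sum>j\<le>K. part j v)"
      using sum_parts by blast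
    have "part j v \<in> ?im" for j
      using im_sup[of j] Mpart[OF v] hom_vec_part[of j v] by (auto simp: Mj_def)
    then have "(\<Sum>j\<le>K. part j v) \<in> ?im"
      by (intro fvec.subspace_sum[OF sub])
    then show "v \<in> ?im"
      using K by simp
  qed
  then have im: "?im = M"
    using im_sub by blast
  have Nspan: "smul p w \<in> fvec.span (N j)"
    if p: "keys p \<subseteq> exps n" "\<And>m. m \<in> keys p \<Longrightarrow> exp_degree m + j' = j" and j': "j' < j"
      and w: "w \<in> M" "hom_vec j' w" for p w j j'
  proof -
    have "smul (Poly_Mapping.single m (lookup p m)) w \<in> fvec.span (N j)" if m: "m \<in> keys p" for m
    proof -
      have deg: "exp_degree m + j' = j"
        using p(2) m by blast
      then have "m \<noteq> 0"
        using j' exp_degree_zero by (metis add.left_neutral less_irrefl)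
      then obtain i a where a: "m = unit_exp i + a" "0 < lookup m i"
        by (rule exp_nonzero_split)
      have ex: "i \<in> {1..n}" "a \<in> exps n"
        using p(1) m a exps_add_iff unit_exp_in_exps_iff by blast+
      let ?u = "smul (Poly_Mapping.single a (lookup p m)) w"
      have "smul (Poly_Mapping.single m (lookup p m)) w = smul (var i) ?u"
        by (simp add: smul_smul var_monom mult_single a(1)[symmetric])
      moreover have "?u \<in> M"
        using w(1) ex(2) by (intro Msmul) auto
      moreover have "hom_vec (exp_degree a + j') ?u"
        using w(2) by (intro hom_vec_smul) (auto split: if_splits)
      moreover have "Suc (exp_degree a + j') = j"
        using deg a(1) by (simp add: exp_degree_add)
      ultimately have "smul (Poly_Mapping.single m (lookup p m)) w \<in> N j"
        using ex(1) unfolding N_def by blast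
      then show ?thesis
        by (rule fvec.span_base)
    qed
    then show ?thesis
      by (subst smul_eq_sum) (rule fvec.span_sum)
  qed
  \<comment> \<open>A constant entry at a generator would express it through \<open>N j\<close> and
    the other generators of its degree, against their minimality modulo \<open>N j\<close>.\<close>
  have const_free: "lookup (v e) 0 = 0" if v: "v \<in> graded_free n b'" "lin_to_free D v = 0" for v e
  proof (rule ccontr)
    assume c0: "lookup (v e) 0 \<noteq> 0"
    obtain j k where e: "e = (j, k)"
      by (cases e)
    \<comment> \<open>In the part of degree \<open>j\<close>, the entries at generators of degree
      \<open>j\<close> are constants, and generators of lower degree occur with entries of positive
      degree.\<close>
    define v' where "v' = part j v"
    have v': "v' \<in> graded_free n b'" "hom_vec j v'"
      unfolding v'_def by (rule graded_free_part[OF v(1)], rule hom_vec_part)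
    have lv': "lin_to_free D v' = 0"
      using part_lin_to_free'[OF homD v(1), of j] v(2) by (simp add: v'_def)
    have c: "lookup (v' (j, k)) 0 \<noteq> 0"
      using c0 by (simp add: v'_def part_def e)
    then have ne: "v' (j, k) \<noteq> 0"
      by auto
    then have k: "k < b' j"
      using graded_free_index[OF v'(1)] by blast
    let ?x = "D (j, k)"
    let ?S = "fvec.span (N j \<union> (B j - {?x}))"
    let ?A = "{e. v' e \<noteq> 0}"
    have A: "finite ?A" "(j, k) \<in> ?A"
      using v'(1) ne by (auto simp: graded_free_iff finsupp_def)
    have "smul (v' (j, k)) ?x + (\<Sum>e\<in>?A - {(j, k)}. smul (v' e) (D e)) = 0"
      using lv' sum.remove[OF A, of "\<lambda>e. smul (v' e) (D e)"] by (simp add: lin_to_free_eq_sum)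
    then have eq: "smul (v' (j, k)) ?x = - (\<Sum>e\<in>?A - {(j, k)}. smul (v' e) (D e))"
      by (rule eq_neg_iff_add_eq_0[THEN iffD2])
    have mem: "smul (v' e) (D e) \<in> ?S" if e: "e \<in> ?A - {(j, k)}" for e
    proof -
      obtain j' k' where e': "e = (j', k')"
        by (cases e)
      have k': "k' < b' j'"
        using graded_free_index[OF v'(1)] e e' by blast
      have deg: "exp_degree m + j' = j" if "m \<in> keys (v' e)" for m
        using v'(2) that e' unfolding hom_vec_def by (metis fst_conv)
      have "keys (v' e) \<noteq> {}"
        using e by simp
      then have "j' \<le> j"
        using deg by (metis ex_in_conv le_add2)
      then consider "j' = j" | "j' < j"
        by linarith
      then show ?thesis
      proof cases
        case 1
        have "v' e = Poly_Mapping.single 0 (lookup (v' e) 0)"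
          by (rule keys_const) (use deg 1 in simp)
        then have "smul (v' e) (D e) = kscale (lookup (v' e) 0) (D e)"
          by (simp add: kscale_def)
        moreover have "D e \<in> B j - {?x}"
          using DB[OF k'] Dinj[of k j k'] k k' e e' 1 by auto
        ultimately show ?thesis
          by (auto intro: fvec.span_scale fvec.span_base)
      next
        case 2
        have "smul (v' e) (D e) \<in> fvec.span (N j)"
          using v'(1) deg 2 DM[OF k'] e' by (intro Nspan[of _ j' j]) (auto simp: graded_free_iff)
        then show ?thesis
          using fvec.span_mono[of "N j" "N j \<union> (B j - {?x})"] by blast
      qed
    qed
    have "smul (v' (j, k)) ?x \<in> ?S"
      unfolding eq by (intro fvec.span_neg fvec.span_sum mem)
    moreover have "v' (j, k) = Poly_Mapping.single 0 (lookup (v' (j, k)) 0)"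
    proof (rule keys_const)
      fix m assume "m \<in> keys (v' (j, k))"
      then have "exp_degree m + fst (j, k) = j"
        using v'(2) unfolding hom_vec_def by blast
      then show "exp_degree m = 0"
        by simp
    qed
    ultimately have "kscale (lookup (v' (j, k)) 0) ?x \<in> ?S"
      by (simp add: kscale_def)
    then have "kscale (inverse (lookup (v' (j, k)) 0)) (kscale (lookup (v' (j, k)) 0) ?x) \<in> ?S"
      by (rule fvec.span_scale)
    then have "?x \<in> ?S"
      using c by simp
    then show False
      using B(4)[OF DB[OF k]] by blast
  qed
  have "minimal_cover n M b' D"
    using homD im const_free by (simp add: minimal_cover_def lin_kernel_def)
  then show ?thesis
    by (intro exI[of _ b'] exI[of _ D]) (simp add: D_def)
qed


section \<open>Minimal resolutions as sequences of covers\<close>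

definition cover_sequence :: "nat \<Rightarrow> 'k::field fvec set \<Rightarrow> (nat \<Rightarrow> nat \<Rightarrow> nat) \<Rightarrow>
    (nat \<Rightarrow> nat \<times> nat \<Rightarrow> 'k fvec) \<Rightarrow> bool" where
  "cover_sequence n M b D \<longleftrightarrow> minimal_cover n M (b 0) (D 0) \<and>
     (\<forall>i. minimal_cover n (lin_kernel n (b i) (D i)) (b (Suc i)) (D (Suc i)))"

text \<open>The ring as the free module with one generator, of degree 0 and with index \<open>(0, 0)\<close>.\<close>

definition rank_one :: "nat \<Rightarrow> nat" where
  "rank_one j = (if j = 0 then 1 else 0)"

definition ring_vec :: "'k::field mpoly \<Rightarrow> 'k fvec" where
  "ring_vec p = smul p (basis_vec (0, 0))"

lemma ring_vec_apply: "ring_vec p e = (if e = (0, 0) then p else 0)"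
  by (simp add: ring_vec_def basis_vec_def)

lemma ring_vec_eq_iff [simp]: "ring_vec p = ring_vec q \<longleftrightarrow> p = q"
  by (auto simp: ring_vec_apply fun_eq_iff)

lemma ring_vec_zero [simp]: "ring_vec 0 = 0"
  by (rule ext) (simp add: ring_vec_apply)

lemma ring_vec_eq_0_iff [simp]: "ring_vec p = 0 \<longleftrightarrow> p = 0"
  using ring_vec_eq_iff[of p 0] by simp

lemma ring_vec_add: "ring_vec (p + q) = ring_vec p + ring_vec q"
  by (rule ext) (simp add: ring_vec_apply)

lemma smul_ring_vec: "smul r (ring_vec p) = ring_vec (r * p)"
  by (rule ext) (simp add: ring_vec_apply)

lemma part_ring_vec: "part j (ring_vec p) = ring_vec (poly_filter (\<lambda>m. exp_degree m = j) p)"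
  by (rule ext) (auto simp: part_def ring_vec_apply)

lemma hom_vec_ring_vec_iff: "hom_vec j (ring_vec p) \<longleftrightarrow> homogeneous j p"
  by (auto simp: hom_vec_def homogeneous_def ring_vec_apply)

lemma ring_vec_in_graded_free_iff: "ring_vec p \<in> graded_free n rank_one \<longleftrightarrow> keys p \<subseteq> exps n"
proof -
  have "finsupp (ring_vec p)"
    unfolding finsupp_def by (rule finite_subset[of _ "{(0, 0)}"]) (auto simp: ring_vec_apply split: if_splits)
  then show ?thesis
    by (auto simp: graded_free_iff ring_vec_apply rank_one_def split: if_splits)
qed

lemma lin_to_free_ring_vec: "lin_to_free (\<lambda>e. ring_vec (g e)) v = ring_vec (lin_to_ring g v)"
  by (rule ext) (simp add: lin_to_free_def lin_to_ring_def ring_vec_apply)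

lemma graded_submodule_mon_ideal: "graded_submodule n rank_one (ring_vec ` mon_ideal n E)"
proof -
  have sub: "keys p \<subseteq> exps n" if "p \<in> mon_ideal n E" for p :: "'a mpoly"
    using that by (auto simp: mon_ideal_def upset_def)
  have add: "p + q \<in> mon_ideal n E" if "p \<in> mon_ideal n E" "q \<in> mon_ideal n E" for p q :: "'a mpoly"
    using that keys_add[of p q] by (auto simp: mon_ideal_def)
  have mult: "r * p \<in> mon_ideal n E" if "p \<in> mon_ideal n E" "keys r \<subseteq> exps n" for r p :: "'a mpoly"
  proof -
    have "m \<in> upset n E" if m: "m \<in> keys (r * p)" for m
      using keys_mult_sub[OF m] \<open>p \<in> mon_ideal n E\<close> \<open>keys r \<subseteq> exps n\<close> upset_add
      by (fastforce simp: mon_ideal_def)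
    then show ?thesis
      by (auto simp: mon_ideal_def)
  qed
  have filt: "poly_filter P p \<in> mon_ideal n E" if "p \<in> mon_ideal n E" for P and p :: "'a mpoly"
    using that by (auto simp: mon_ideal_def keys_poly_filter)
  have zero: "(0 :: 'a mpoly) \<in> mon_ideal n E"
    by (simp add: mon_ideal_def)
  show ?thesis
    unfolding graded_submodule_def
    using sub mult filt zero
    by (auto simp: ring_vec_in_graded_free_iff smul_ring_vec part_ring_vec ring_vec_add[symmetric] add
        image_iff intro: bexI[of _ 0])
qed

lemma minimal_cover_gen:
  "minimal_cover n M b D \<Longrightarrow> k < b j \<Longrightarrow> D (j, k) \<in> M"
  unfolding minimal_cover_def by (metis graded_free_basis_vec image_eqI lin_to_free_basis_vec)

lemma exists_cover_sequence:
  fixes M :: "'k::field fvec set"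
  assumes "graded_submodule n b0 M"
  shows "\<exists>b D. cover_sequence n M b D \<and> (\<forall>j k. \<not> k < b 0 j \<longrightarrow> D 0 (j, k) = 0)"
proof -
  \<comment> \<open>The invariant \<open>hom_gens\<close> makes the next kernel a graded submodule;
    the clause for \<open>i = 0\<close> carries the initial conditions through the dependent
    choice.\<close>
  let ?P = "\<lambda>i (x :: (nat \<Rightarrow> nat) \<times> (nat \<times> nat \<Rightarrow> 'k fvec)). hom_gens (fst x) (snd x) \<and>
    (i = 0 \<longrightarrow> minimal_cover n M (fst x) (snd x) \<and> (\<forall>j k. \<not> k < fst x j \<longrightarrow> snd x (j, k) = 0))"
  let ?Q = "\<lambda>(i::nat) (x :: (nat \<Rightarrow> nat) \<times> (nat \<times> nat \<Rightarrow> 'k fvec)) y.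
    minimal_cover n (lin_kernel n (fst x) (snd x)) (fst y) (snd y)"
  have "\<exists>F. \<forall>i. ?P i (F i) \<and> ?Q i (F i) (F (Suc i))"
  proof (rule dependent_nat_choice[of ?P ?Q])
    obtain b D where bD: "minimal_cover n M b D" "\<forall>j k. \<not> k < b j \<longrightarrow> D (j, k) = 0"
      using exists_minimal_cover[OF assms] by blast
    then have "?P 0 (b, D)"
      by (simp add: minimal_cover_def)
    then show "\<exists>x. ?P 0 x" ..
  next
    fix x and i :: nat assume "?P i x"
    then have "graded_submodule n (fst x) (lin_kernel n (fst x) (snd x))"
      by (intro graded_submodule_lin_kernel) simp
    then obtain b D where "minimal_cover n (lin_kernel n (fst x) (snd x)) b D"
      using exists_minimal_cover by blast
    then show "\<exists>y. ?P (Suc i) y \<and> ?Q i x y"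
      by (intro exI[of _ "(b, D)"]) (simp add: minimal_cover_def)
  qed
  then obtain F where "\<forall>i. ?P i (F i)" "\<forall>i. ?Q i (F i) (F (Suc i))"
    by blast
  then show ?thesis
    by (intro exI[of _ "\<lambda>i. fst (F i)"] exI[of _ "\<lambda>i. snd (F i)"]) (simp add: cover_sequence_def)
qed

lemma lookup_mult_zero:
  fixes p q :: "'k::field mpoly"
  assumes "lookup q 0 = 0"
  shows "lookup (p * q) 0 = 0"
proof (rule ccontr)
  assume "lookup (p * q) 0 \<noteq> 0"
  then obtain a b where "b \<in> keys q" "0 = a + b"
    using keys_mult_sub[of 0 p q] by (auto simp: in_keys_iff)
  then have "exp_degree b = 0"
    by (metis add_is_0 exp_degree_add exp_degree_zero)
  then show False
    using assms \<open>b \<in> keys q\<close> by (simp add: exp_degree_eq_0_iff in_keys_iff)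
qed

text \<open>The augmentation becomes a map into the free module of rank one, hence one more
  differential. The two forms of minimality agree because the columns of each differential generate
  the kernel of the map before it: columns without constant terms yield kernel elements without
  constant terms, and the columns are kernel elements themselves.\<close>

lemma minimal_graded_free_resolution_iff:
  fixes J :: "'k::field mpoly set"
  assumes J: "J \<subseteq> carrier (poly_ring n)"
  shows "minimal_graded_free_resolution n J b g D \<longleftrightarrow>
    cover_sequence n (ring_vec ` J) b (case_nat (\<lambda>e. ring_vec (g e)) D)" (is "_ \<longleftrightarrow> cover_sequence n ?M b ?D")
proof -
  have ker0: "lin_kernel n (b 0) (?D 0) = {v \<in> graded_free n (b 0). lin_to_ring g v = 0}"
    by (simp add: lin_kernel_def lin_to_free_ring_vec)
  have kerS: "lin_kernel n (b (Suc i)) (?D (Suc i)) =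
      {v \<in> graded_free n (b (Suc i)). lin_to_free (D i) v = (\<lambda>_. 0)}" for i
    by (simp add: lin_kernel_def zero_fun_def)
  have im0: "lin_to_free (?D 0) ` graded_free n (b 0) = ?M \<longleftrightarrow> lin_to_ring g ` graded_free n (b 0) = J"
  proof -
    have "lin_to_free (?D 0) ` graded_free n (b 0) = ring_vec ` lin_to_ring g ` graded_free n (b 0)"
      by (simp add: lin_to_free_ring_vec image_image)
    then show ?thesis
      by (simp add: inj_image_eq_iff inj_def)
  qed
  have homS: "hom_gens b' E \<longleftrightarrow> (\<forall>j k. k < b' j \<longrightarrow>
      (\<forall>j' k'. \<forall>m\<in>keys (E (j, k) (j', k')). exp_degree m + j' = j))"
    for b' and E :: "nat \<times> nat \<Rightarrow> 'k fvec"
    by (simp add: hom_gens_def hom_vec_def split_paired_All)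
  show ?thesis
  proof
    assume res: "minimal_graded_free_resolution n J b g D"
    have im: "lin_to_free (D i) ` graded_free n (b (Suc i)) = lin_kernel n (b i) (?D i)" for i
      using res ker0 kerS unfolding minimal_graded_free_resolution_def by (cases i) (simp_all only: One_nat_def)
    have const: "lookup (D i (j, k) e) 0 = 0" if "k < b (Suc i) j" for i j k e
      using res[unfolded minimal_graded_free_resolution_def, THEN conjunct2, THEN conjunct1,
          rule_format, OF that, THEN conjunct2, rule_format, of "fst e" "snd e"] by simp
    have cf: "lookup (v e) 0 = 0" if v: "v \<in> lin_kernel n (b i) (?D i)" for i v e
    proof -
      have "v \<in> lin_to_free (D i) ` graded_free n (b (Suc i))"
        using v im[of i] by simp
      then obtain w where w: "w \<in> graded_free n (b (Suc i))" "v = lin_to_free (D i) w"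
        by blast
      have "lookup (w x * D i x e) 0 = 0" if "w x \<noteq> 0" for x
      proof -
        have "snd x < b (Suc i) (fst x)"
          using graded_free_index[OF w(1), of "fst x" "snd x"] that by simp
        then show ?thesis
          using const[of "snd x" i "fst x" e] by (intro lookup_mult_zero) simp
      qed
      then show ?thesis
        unfolding w(2) lin_to_free_def lookup_sum by (intro sum.neutral) simp
    qed
    have "minimal_cover n ?M (b 0) (?D 0)"
      unfolding minimal_cover_def im0 using res cf[of _ 0]
      by (simp add: minimal_graded_free_resolution_def hom_gens_def hom_vec_ring_vec_iff)
    moreover have "minimal_cover n (lin_kernel n (b i) (?D i)) (b (Suc i)) (?D (Suc i))" for i
      unfolding minimal_cover_def using res cf[of _ "Suc i"] im[of i]
      by (auto simp: minimal_graded_free_resolution_def homS)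
    ultimately show "cover_sequence n ?M b ?D"
      unfolding cover_sequence_def by blast
  next
    assume cs: "cover_sequence n ?M b ?D"
    then have c0: "minimal_cover n ?M (b 0) (?D 0)"
      and cS: "minimal_cover n (lin_kernel n (b i) (?D i)) (b (Suc i)) (D i)" for i
      unfolding cover_sequence_def by auto
    have g: "g (j, k) \<in> carrier (poly_ring n) \<and> homogeneous j (g (j, k))" if "k < b 0 j" for j k
    proof -
      have "ring_vec (g (j, k)) \<in> ?M"
        using minimal_cover_gen[OF c0 that] by simp
      then show ?thesis
        using J c0 that by (auto simp: minimal_cover_def hom_gens_def hom_vec_ring_vec_iff)
    qed
    have Dk: "D i (j, k) \<in> lin_kernel n (b i) (?D i)" if "k < b (Suc i) j" for i j k
      using minimal_cover_gen[OF cS that] .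
    have cf: "lookup (v e) 0 = 0" if "v \<in> lin_kernel n (b i) (?D i)" for i v e
      using that c0 cS by (cases i) (auto simp: minimal_cover_def)
    have im: "lin_to_free (D i) ` graded_free n (b (Suc i)) = lin_kernel n (b i) (?D i)" for i
      using cS[of i] by (simp add: minimal_cover_def)
    have "D i (j, k) \<in> graded_free n (b i) \<and>
        (\<forall>j' k'. (\<forall>m\<in>keys (D i (j, k) (j', k')). exp_degree m + j' = j) \<and>
          lookup (D i (j, k) (j', k')) 0 = 0)" if k: "k < b (Suc i) j" for i j k
      using Dk[OF k] cf[OF Dk[OF k]] cS[of i] k
      by (simp add: minimal_cover_def homS lin_kernel_def)
    moreover have "lin_to_ring g ` graded_free n (b 0) = J"
      using c0 im0 by (simp add: minimal_cover_def)
    ultimately show "minimal_graded_free_resolution n J b g D"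
      unfolding minimal_graded_free_resolution_def
      using g im[of 0] im[of "Suc _"] ker0 kerS by simp
  qed
qed

text \<open>This makes the numbers selected by \<open>graded_betti\<close> those of an actual
  resolution.\<close>

lemma exists_minimal_graded_free_resolution:
  "\<exists>b g D. minimal_graded_free_resolution n (mon_ideal n E :: 'k::field mpoly set) b g D"
proof -
  let ?J = "mon_ideal n E :: 'k mpoly set"
  obtain b D where bD: "cover_sequence n (ring_vec ` ?J) b D" "\<forall>j k. \<not> k < b 0 j \<longrightarrow> D 0 (j, k) = 0"
    using exists_cover_sequence[OF graded_submodule_mon_ideal] by blast
  \<comment> \<open>All values of \<open>D 0\<close> lie in the copy of the ring, so the coordinate
    at \<open>(0, 0)\<close> recovers them.\<close>
  define g where "g e = D 0 e (0, 0)" for e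
  have "D 0 e = ring_vec (g e)" for e
  proof -
    obtain j k where e: "e = (j, k)"
      by (cases e)
    have "\<exists>p. D 0 e = ring_vec p"
    proof (cases "k < b 0 j")
      case True
      then show ?thesis
        using minimal_cover_gen[of n "ring_vec ` ?J" "b 0" "D 0" k j] bD(1) e
        by (auto simp: cover_sequence_def)
    next
      case False
      then show ?thesis
        using bD(2) e by (metis ring_vec_zero)
    qed
    then show ?thesis
      by (auto simp: g_def ring_vec_apply)
  qed
  then have "D 0 = (\<lambda>e. ring_vec (g e))"
    by blast
  then have "case_nat (\<lambda>e. ring_vec (g e)) (\<lambda>i. D (Suc i)) = D"
    by (simp add: fun_eq_iff split: nat.split)
  moreover have "?J \<subseteq> carrier (poly_ring n)"
    by (auto simp: mon_ideal_def upset_def in_poly_ring_iff)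
  ultimately show ?thesis
    using bD(1) minimal_graded_free_resolution_iff by metis
qed

section \<open>Vanishing of graded Betti numbers\<close>

definition koszul_vec :: "nat \<Rightarrow> (nat set \<Rightarrow> 'k::field fvec) \<Rightarrow> nat set \<Rightarrow> 'k fvec" where
  "koszul_vec n z T = (\<lambda>e. koszul n (\<lambda>S. z S e) T)"

text \<open>The Koszul homology of \<open>M\<close> vanishes wherever the coefficients have degree \<open>q\<close>.\<close>

definition koszul_exact :: "nat \<Rightarrow> 'k::field fvec set \<Rightarrow> nat \<Rightarrow> bool" where
  "koszul_exact n M q \<longleftrightarrow> (\<forall>z. (\<forall>S\<subseteq>{1..n}. z S \<in> M \<and> hom_vec q (z S) \<and> koszul_vec n z S = 0) \<longrightarrow>
     (\<exists>y. \<forall>S\<subseteq>{1..n}. y S \<in> M \<and> koszul_vec n y S = z S))"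

lemma koszul_exactE:
  assumes "koszul_exact n M q"
    and "\<forall>S\<subseteq>{1..n}. z S \<in> M \<and> hom_vec q (z S) \<and> koszul_vec n z S = 0"
  obtains y where "\<forall>S\<subseteq>{1..n}. y S \<in> M \<and> koszul_vec n y S = z S"
  using assms(1)[unfolded koszul_exact_def, THEN spec, THEN mp, OF assms(2)] by (elim exE)

lemma koszul_vec_eq_sum: "koszul_vec n z T =
    (\<Sum>i\<in>{1..n} - T. smul (Poly_Mapping.single 0 (ksign i T) * var i) (z (insert i T)))"
  by (rule ext) (simp add: koszul_vec_def koszul_def fun_sum_apply mult.assoc)

lemma koszul_vec_cong:
  assumes "\<And>S. S \<subseteq> {1..n} \<Longrightarrow> z S = w S" "T \<subseteq> {1..n}"
  shows "koszul_vec n z T = koszul_vec n w T"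
  unfolding koszul_vec_def by (rule ext, rule koszul_cong) (use assms in auto)

lemma koszul_vec_diff: "koszul_vec n (\<lambda>S. z S - w S) T = koszul_vec n z T - koszul_vec n w T"
  by (rule ext) (simp add: koszul_vec_def koszul_diff)

lemma koszul_vec_koszul_vec: "T \<subseteq> {1..n} \<Longrightarrow> koszul_vec n (koszul_vec n z) T = 0"
  by (rule ext) (simp add: koszul_vec_def koszul_koszul)

lemma keys_sign_var: "i \<in> {1..n} \<Longrightarrow>
    keys (Poly_Mapping.single 0 c * var i :: 'k::field mpoly) \<subseteq> exps n"
  by (auto simp: var_monom mult_single unit_exp_in_exps_iff)

lemma koszul_vec_graded_free:
  assumes "\<And>S. S \<subseteq> {1..n} \<Longrightarrow> z S \<in> graded_free n b" "T \<subseteq> {1..n}"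
  shows "koszul_vec n z T \<in> graded_free n b"
  unfolding koszul_vec_eq_sum
  by (intro graded_free_sum graded_free_smul keys_sign_var assms(1)) (use assms(2) in auto)

lemma lin_to_free_koszul_vec:
  assumes "\<And>S. S \<subseteq> {1..n} \<Longrightarrow> z S \<in> graded_free n b" "T \<subseteq> {1..n}"
  shows "lin_to_free D (koszul_vec n z T) = koszul_vec n (\<lambda>S. lin_to_free D (z S)) T"
proof -
  have fin: "finsupp (z (insert i T))" if "i \<in> {1..n} - T" for i
    by (rule graded_free_finsupp[OF assms(1)]) (use assms(2) that in auto)
  show ?thesis
    unfolding koszul_vec_eq_sum
    by (subst lin_to_free_sum) (auto intro!: finsupp_smul sum.cong lin_to_free_smul fin)
qed

lemma hom_vec_lin_to_free:
  assumes "hom_gens b D" "v \<in> graded_free n b" "hom_vec q v"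
  shows "hom_vec q (lin_to_free D v)"
  using part_lin_to_free'[OF assms(1,2), of q] part_hom_vec[OF assms(3)] hom_vec_part by metis

text \<open>Dimension shifting along \<open>0 \<rightarrow> ker \<rightarrow> F \<rightarrow> M \<rightarrow> 0\<close>.\<close>

lemma koszul_exact_lin_kernel:
  assumes cover: "minimal_cover n M b D" and ex: "koszul_exact n M q"
  shows "koszul_exact n (lin_kernel n b D) (Suc q)"
  unfolding koszul_exact_def
proof (intro allI impI)
  fix z assume z: "\<forall>S\<subseteq>{1..n}. z S \<in> lin_kernel n b D \<and> hom_vec (Suc q) (z S) \<and> koszul_vec n z S = 0"
  have zg: "z S \<in> graded_free n b" and zk: "lin_to_free D (z S) = 0" if "S \<subseteq> {1..n}" for S
    using z that by (auto simp: lin_kernel_def)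
  have zc: "keys (z S e) \<subseteq> exps n - {0}" if S: "S \<subseteq> {1..n}" for S e
  proof -
    have "lookup (z S e) 0 = 0"
      using cover z S unfolding minimal_cover_def by blast
    then show ?thesis
      using zg[OF S] by (auto simp: graded_free_iff in_keys_iff)
  qed
  have fin: "finite S" if "S \<subseteq> {1..n}" for S :: "nat set"
    using that finite_subset by blast
  \<comment> \<open>By minimality, kernel elements have no constant terms, so the contraction of the
    ring, applied coordinatewise, bounds the cycle in the free module. It lowers degrees by one,
    whence the shift from \<open>Suc q\<close> to \<open>q\<close>.\<close>
  define w where "w S = (\<lambda>e. homotopy {} 0 (\<lambda>S. z S e) S)" for S
  have wkeys: "\<exists>i. S - {i} \<subseteq> {1..n} \<and> m + unit_exp i \<in> keys (z (S - {i}) e)"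
    if S: "S \<subseteq> {1..n}" and m: "m \<in> keys (w S e)" for S e m
  proof -
    have "m \<in> keys (homotopy {} 0 (\<lambda>S. z S e) S)"
      using m by (simp add: w_def)
    then obtain i where "m + unit_exp i \<in> keys (z (S - {i}) e)"
      using keys_homotopy[OF fin[OF S]] by blast
    then show ?thesis
      using S by blast
  qed
  have wg: "w S \<in> graded_free n b" and wh: "hom_vec q (w S)" if S: "S \<subseteq> {1..n}" for S
  proof -
    have "{e. w S e \<noteq> 0} \<subseteq> (\<Union>T\<in>Pow {1..n}. {e. z T e \<noteq> 0})"
    proof
      fix e assume "e \<in> {e. w S e \<noteq> 0}"
      then obtain m where "m \<in> keys (w S e)"
        by (metis (mono_tags) ex_in_conv keys_eq_empty mem_Collect_eq)
      then obtain i where "S - {i} \<subseteq> {1..n}" "m + unit_exp i \<in> keys (z (S - {i}) e)"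
        using wkeys[OF S] by blast
      then show "e \<in> (\<Union>T\<in>Pow {1..n}. {e. z T e \<noteq> 0})"
        by (intro UN_I[of "S - {i}"]) auto
    qed
    moreover have "finite (\<Union>T\<in>Pow {1..n}. {e. z T e \<noteq> 0})"
      using zg by (auto simp: graded_free_iff finsupp_def)
    ultimately have "finsupp (w S)"
      unfolding finsupp_def by (rule finite_subset)
    moreover have "keys (w S e) \<subseteq> exps n" for e
    proof
      fix m assume "m \<in> keys (w S e)"
      then obtain i where "S - {i} \<subseteq> {1..n}" "m + unit_exp i \<in> keys (z (S - {i}) e)"
        using wkeys[OF S] by blast
      then have "m + unit_exp i \<in> exps n"
        using zc by blast
      then show "m \<in> exps n"
        by (simp add: exps_add_iff)
    qed
    moreover have "w S (j, k) = 0" if jk: "b j \<le> k" for j k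
    proof (rule ccontr)
      assume "w S (j, k) \<noteq> 0"
      then obtain m where "m \<in> keys (w S (j, k))"
        by (metis ex_in_conv keys_eq_empty)
      then obtain i where "S - {i} \<subseteq> {1..n}" "m + unit_exp i \<in> keys (z (S - {i}) (j, k))"
        using wkeys[OF S] by blast
      then show False
        using zg[of "S - {i}"] jk by (simp add: graded_free_iff)
    qed
    ultimately show "w S \<in> graded_free n b"
      by (simp add: graded_free_iff)
    show "hom_vec q (w S)"
      unfolding hom_vec_def
    proof (intro allI ballI)
      fix e m assume "m \<in> keys (w S e)"
      then obtain i where i: "S - {i} \<subseteq> {1..n}" "m + unit_exp i \<in> keys (z (S - {i}) e)"
        using wkeys[OF S] by blast
      have "hom_vec (Suc q) (z (S - {i}))"
        using z i(1) by blast
      then have "exp_degree (m + unit_exp i) + fst e = Suc q"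
        using i(2) by (simp add: hom_vec_def)
      then show "exp_degree m + fst e = q"
        by (simp add: exp_degree_add)
    qed
  qed
  have wz: "koszul_vec n w T = z T" if T: "T \<subseteq> {1..n}" for T
  proof
    fix e
    have "koszul n (homotopy {} 0 (\<lambda>S. z S e)) T = z T e"
    proof (rule koszul_exact_ring[OF _ _ T])
      fix S :: "nat set" assume S: "S \<subseteq> {1..n}"
      show "keys (z S e) \<subseteq> exps n - {0}"
        by (rule zc[OF S])
      have "koszul_vec n z S e = 0"
        using z S by simp
      then show "koszul n (\<lambda>S. z S e) S = 0"
        by (simp add: koszul_vec_def)
    qed
    then show "koszul_vec n w T e = z T e"
      by (simp add: koszul_vec_def w_def)
  qed
  have image: "lin_to_free D ` graded_free n b = M" and hom: "hom_gens b D"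
    using cover by (simp_all add: minimal_cover_def)
  \<comment> \<open>This is the connecting map: \<open>w\<close> need not lie in the kernel, but its
    image is a cycle in \<open>M\<close> of degree \<open>q\<close>.\<close>
  have "\<forall>S\<subseteq>{1..n}. lin_to_free D (w S) \<in> M \<and> hom_vec q (lin_to_free D (w S)) \<and>
      koszul_vec n (\<lambda>S. lin_to_free D (w S)) S = 0"
  proof (intro allI impI conjI)
    fix S :: "nat set" assume S: "S \<subseteq> {1..n}"
    show "lin_to_free D (w S) \<in> M"
      using wg[OF S] image by blast
    show "hom_vec q (lin_to_free D (w S))"
      by (rule hom_vec_lin_to_free[OF hom wg[OF S] wh[OF S]])
    have "koszul_vec n (\<lambda>S. lin_to_free D (w S)) S = lin_to_free D (koszul_vec n w S)"
      by (rule lin_to_free_koszul_vec[OF wg S, symmetric])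
    then show "koszul_vec n (\<lambda>S. lin_to_free D (w S)) S = 0"
      using wz[OF S] zk[OF S] by simp
  qed
  then obtain y' where y': "\<forall>S\<subseteq>{1..n}. y' S \<in> M \<and> koszul_vec n y' S = lin_to_free D (w S)"
    by (rule koszul_exactE[OF ex])
  have im: "y' S \<in> lin_to_free D ` graded_free n b" if "S \<subseteq> {1..n}" for S
    using y' that by (simp add: image)
  define y where "y S = inv_into (graded_free n b) (lin_to_free D) (y' S)" for S
  have y: "y S \<in> graded_free n b" "lin_to_free D (y S) = y' S" if "S \<subseteq> {1..n}" for S
    unfolding y_def by (rule inv_into_into[OF im[OF that]], rule f_inv_into_f[OF im[OF that]])
  \<comment> \<open>The boundary of the lift \<open>y\<close> has the same image in \<open>M\<close>
    as \<open>w\<close>. Subtracting it moves \<open>w\<close> into the kernel and leaves its own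
    boundary unchanged.\<close>
  define w' where "w' S = w S - koszul_vec n y S" for S
  have "w' S \<in> lin_kernel n b D \<and> koszul_vec n w' S = z S" if S: "S \<subseteq> {1..n}" for S
  proof
    have ky: "koszul_vec n y S \<in> graded_free n b"
      by (rule koszul_vec_graded_free[OF y(1) S])
    have "lin_to_free D (koszul_vec n y S) = koszul_vec n (\<lambda>S. lin_to_free D (y S)) S"
      by (rule lin_to_free_koszul_vec[OF y(1) S])
    also have "\<dots> = koszul_vec n y' S"
      by (rule koszul_vec_cong[OF y(2) S])
    also have "\<dots> = lin_to_free D (w S)"
      using y' S by blast
    finally show "w' S \<in> lin_kernel n b D"
      using wg[OF S] ky
      by (simp add: lin_kernel_def w'_def graded_free_diff lin_to_free_diff graded_free_finsupp)
    show "koszul_vec n w' S = z S"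
      unfolding w'_def using koszul_vec_diff[of n w "koszul_vec n y" S] koszul_vec_koszul_vec[OF S, of y] wz[OF S]
      by simp
  qed
  then show "\<exists>y. \<forall>S\<subseteq>{1..n}. y S \<in> lin_kernel n b D \<and> koszul_vec n y S = z S"
    by blast
qed

text \<open>In degree 0 all coefficients are constants, and minimality leaves only zero. Dimension
  shifting, which lands in degrees \<open>Suc q\<close>, does not reach this case.\<close>

lemma koszul_exact_lin_kernel_0:
  assumes cover: "minimal_cover n M b D"
  shows "koszul_exact n (lin_kernel n b D) 0"
  unfolding koszul_exact_def
proof (intro allI impI)
  fix z assume z: "\<forall>S\<subseteq>{1..n}. z S \<in> lin_kernel n b D \<and> hom_vec 0 (z S) \<and> koszul_vec n z S = 0"
  have "z S = 0" if S: "S \<subseteq> {1..n}" for S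
  proof
    fix e
    have "lookup (z S e) 0 = 0"
      using cover z S unfolding minimal_cover_def by blast
    moreover have "z S e = Poly_Mapping.single 0 (lookup (z S e) 0)"
      by (rule keys_const) (use z S in \<open>auto simp: hom_vec_def\<close>)
    ultimately show "z S e = 0 e"
      by simp
  qed
  then have "\<forall>S\<subseteq>{1..n}. z S \<in> lin_kernel n b D \<and> koszul_vec n (\<lambda>_. 0) S = z S"
    using z by (simp add: koszul_vec_def fun_eq_iff)
  moreover have "(0 :: 'a fvec) \<in> lin_kernel n b D"
    by (simp add: lin_kernel_def)
  ultimately show "\<exists>y. \<forall>S\<subseteq>{1..n}. y S \<in> lin_kernel n b D \<and> koszul_vec n y S = z S"
    by (intro exI[of _ "\<lambda>_. 0"]) simp
qed

text \<open>A generator of degree \<open>l\<close>, placed on the empty set, is a cycle. If it is a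
  boundary, it is a combination of elements of \<open>M\<close> with variables as coefficients, and
  lifting this relation gives a kernel element with constant term 1 at that generator.\<close>

lemma minimal_cover_no_generators:
  fixes M :: "'k::field fvec set"
  assumes cover: "minimal_cover n M b D" and ex: "koszul_exact n M l"
  shows "b l = 0"
proof (rule ccontr)
  assume "b l \<noteq> 0"
  then have pos: "0 < b l"
    by simp
  let ?e = "(l, 0 :: nat)"
  have image: "lin_to_free D ` graded_free n b = M" and hom: "hom_gens b D"
    using cover by (simp_all add: minimal_cover_def)
  have DM: "D ?e \<in> M"
    by (rule minimal_cover_gen[OF cover pos])
  have M0: "0 \<in> M"
    unfolding image[symmetric] by (rule image_eqI[of _ _ 0]) simp_all
  define z where "z S = (if S = {} then D ?e else 0)" for S :: "nat set"
  have "koszul_vec n z S = 0" for S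
    unfolding koszul_vec_eq_sum by (rule sum.neutral) (simp add: z_def fun_eq_iff)
  then have "\<forall>S\<subseteq>{1..n}. z S \<in> M \<and> hom_vec l (z S) \<and> koszul_vec n z S = 0"
    using DM M0 hom pos by (simp add: z_def hom_gens_def)
  then obtain y' where y': "\<forall>S\<subseteq>{1..n}. y' S \<in> M \<and> koszul_vec n y' S = z S"
    by (rule koszul_exactE[OF ex])
  have im: "y' S \<in> lin_to_free D ` graded_free n b" if "S \<subseteq> {1..n}" for S
    using y' that by (simp add: image)
  define y where "y S = inv_into (graded_free n b) (lin_to_free D) (y' S)" for S
  have y: "y S \<in> graded_free n b" "lin_to_free D (y S) = y' S" if "S \<subseteq> {1..n}" for S
    unfolding y_def by (rule inv_into_into[OF im[OF that]], rule f_inv_into_f[OF im[OF that]])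
  have ky: "koszul_vec n y {} \<in> graded_free n b"
    by (rule koszul_vec_graded_free[OF y(1)]) simp_all
  have "lin_to_free D (koszul_vec n y {}) = koszul_vec n (\<lambda>S. lin_to_free D (y S)) {}"
    by (rule lin_to_free_koszul_vec[OF y(1)]) simp_all
  also have "\<dots> = koszul_vec n y' {}"
    by (rule koszul_vec_cong[OF y(2)]) simp_all
  also have "\<dots> = D ?e"
    using y' by (simp add: z_def)
  finally have "basis_vec ?e - koszul_vec n y {} \<in> lin_kernel n b D"
    using ky graded_free_basis_vec[of 0 b l n, where 'a = 'k] pos
    by (simp add: lin_kernel_def graded_free_diff lin_to_free_diff graded_free_finsupp)
  then have "lookup ((basis_vec ?e - koszul_vec n y {}) ?e) 0 = 0"
    using cover unfolding minimal_cover_def by blast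
  \<comment> \<open>The Koszul differential multiplies by variables and so produces no constant
    terms.\<close>
  moreover have "lookup (koszul_vec n y {} ?e) 0 = 0"
    by (simp add: koszul_vec_def lookup_koszul)
  ultimately show False
    by (simp add: basis_vec_def lookup_minus)
qed

lemma koszul_exact_mon_ideal:
  assumes lq: "linear_quotient_order es" and es: "set es \<subseteq> exps n"
    and deg: "\<And>a. a \<in> set es \<Longrightarrow> exp_degree a = d" and q: "q \<noteq> d"
  shows "koszul_exact n (ring_vec ` mon_ideal n (set es) :: 'k::field fvec set) q"
  unfolding koszul_exact_def
proof (intro allI impI)
  fix z :: "nat set \<Rightarrow> 'k fvec"
  assume z: "\<forall>S\<subseteq>{1..n}. z S \<in> ring_vec ` mon_ideal n (set es) \<and> hom_vec q (z S) \<and> koszul_vec n z S = 0"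
  define p where "p S = z S (0, 0)" for S
  have zp: "z S = ring_vec (p S)" "p S \<in> mon_ideal n (set es)" if S: "S \<subseteq> {1..n}" for S
  proof -
    have "z S \<in> ring_vec ` mon_ideal n (set es)"
      using z S by simp
    then obtain r where "z S = ring_vec r" "r \<in> mon_ideal n (set es)"
      by (rule imageE)
    then show "z S = ring_vec (p S)" "p S \<in> mon_ideal n (set es)"
      by (simp_all add: p_def ring_vec_apply)
  qed
  have "\<exists>y. (\<forall>S\<subseteq>{1..n}. keys (y S) \<subseteq> upset n (set (take (length es) es))) \<and>
      (\<forall>T\<subseteq>{1..n}. koszul n y T = p T)"
  proof (rule koszul_exact_linear_quotients[OF lq es deg q])
    fix S :: "nat set" assume S: "S \<subseteq> {1..n}"
    show "keys (p S) \<subseteq> upset n (set (take (length es) es))"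
      using zp(2)[OF S] by (simp add: mon_ideal_def)
    have "hom_vec q (ring_vec (p S))"
      using z S zp(1) by metis
    then show "homogeneous q (p S)"
      by (simp add: hom_vec_ring_vec_iff)
    have "koszul_vec n z S (0, 0) = 0"
      using z S by simp
    then show "koszul n p S = 0"
      by (simp add: koszul_vec_def p_def[abs_def])
  qed simp_all
  then obtain y where y: "\<forall>S\<subseteq>{1..n}. keys (y S) \<subseteq> upset n (set es)" "\<forall>T\<subseteq>{1..n}. koszul n y T = p T"
    by auto
  have "koszul_vec n (\<lambda>S. ring_vec (y S)) T = z T" if T: "T \<subseteq> {1..n}" for T
  proof
    fix e
    show "koszul_vec n (\<lambda>S. ring_vec (y S)) T e = z T e"
      using y(2) T zp(1)[OF T] by (cases "e = (0, 0)") (simp_all add: koszul_vec_def ring_vec_apply)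
  qed
  moreover have "ring_vec (y S) \<in> ring_vec ` mon_ideal n (set es)" if "S \<subseteq> {1..n}" for S
    using y(1) that by (simp add: mon_ideal_def)
  ultimately show "\<exists>y. \<forall>S\<subseteq>{1..n}. y S \<in> ring_vec ` mon_ideal n (set es) \<and> koszul_vec n y S = z S"
    by (intro exI[of _ "\<lambda>S. ring_vec (y S)"]) blast
qed

lemma graded_betti_resolution:
  obtains g D where "minimal_graded_free_resolution n (mon_ideal n E :: 'k::field mpoly set)
    (graded_betti n (mon_ideal n E :: 'k mpoly set)) g D"
  using someI_ex[OF exists_minimal_graded_free_resolution[of n E, where 'k = 'k]]
  unfolding graded_betti_def[symmetric] by blast

lemma mon_ideal_subset_carrier: "mon_ideal n E \<subseteq> carrier (poly_ring n)"
  by (auto simp: mon_ideal_def upset_def in_poly_ring_iff)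

lemma linear_quotients_linear_resolution:
  assumes lq: "linear_quotient_order es" and es: "set es \<subseteq> exps n"
    and deg: "\<And>a. a \<in> set es \<Longrightarrow> exp_degree a = d"
  shows "has_linear_resolution n (mon_ideal n (set es) :: 'k::field mpoly set)"
proof -
  let ?J = "mon_ideal n (set es) :: 'k mpoly set"
  let ?b = "graded_betti n ?J"
  obtain g D where "minimal_graded_free_resolution n ?J ?b g D"
    by (rule graded_betti_resolution)
  then have cs: "cover_sequence n (ring_vec ` ?J) ?b (case_nat (\<lambda>e. ring_vec (g e)) D)"
    using minimal_graded_free_resolution_iff[OF mon_ideal_subset_carrier] by blast
  let ?D = "case_nat (\<lambda>e. ring_vec (g e)) D"
  \<comment> \<open>\<open>M i\<close> is the module covered by the \<open>i\<close>-th free module: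
    the ideal, then the successive kernels.\<close>
  define M where "M = case_nat (ring_vec ` ?J) (\<lambda>i. lin_kernel n (?b i) (?D i))"
  have cover: "minimal_cover n (M i) (?b i) (?D i)" for i
    using cs by (cases i) (auto simp: cover_sequence_def M_def)
  \<comment> \<open>Linear quotients settle \<open>i = 0\<close>; passing to a kernel moves the
    exceptional degree up by one, with degree 0 treated separately.\<close>
  have ex: "koszul_exact n (M i) q" if "q \<noteq> i + d" for i q
    using that
  proof (induction i arbitrary: q)
    case 0
    then show ?case
      using koszul_exact_mon_ideal[OF lq es deg, of q, where 'k = 'k] by (simp add: M_def)
  next
    case (Suc i)
    show ?case
    proof (cases q)
      case 0
      then show ?thesis
        using koszul_exact_lin_kernel_0[OF cover[of i]] by (simp add: M_def)
    next
      case (Suc q')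
      then have "koszul_exact n (M i) q'"
        using Suc.IH Suc.prems by simp
      then show ?thesis
        using koszul_exact_lin_kernel[OF cover[of i]] Suc by (simp add: M_def)
    qed
  qed
  have "?b i l = 0" if "l \<noteq> i + d" for i l
    by (rule minimal_cover_no_generators[OF cover ex[OF that]])
  moreover have "monomial_ideal_generated_in_degree n d ?J"
    unfolding monomial_ideal_generated_in_degree_def
    using es deg Idl_monom[OF es, where 'k = 'k]
    by (intro exI[of _ "monom ` set es"]) (auto simp: monomials_eq homogeneous_def)
  ultimately show ?thesis
    unfolding has_linear_resolution_def by blast
qed

section \<open>From linear resolutions to linear relations\<close>

text \<open>The definition of a linear resolution leaves its degree open; this ties it to the degree
  of the generators. The zero ideal is generated in every degree, hence
  \<open>E \<noteq> {}\<close>.\<close>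

lemma generated_in_degree_unique:
  assumes E: "E \<subseteq> exps n" "E \<noteq> {}" and deg: "\<And>a. a \<in> E \<Longrightarrow> exp_degree a = d"
    and gen: "monomial_ideal_generated_in_degree n d' (mon_ideal n E :: 'k::field mpoly set)"
  shows "d' = d"
proof -
  obtain M :: "'k mpoly set" where M: "M \<subseteq> monomials n" "\<forall>u\<in>M. homogeneous d' u"
      "mon_ideal n E = Idl\<^bsub>poly_ring n\<^esub> M"
    using gen unfolding monomial_ideal_generated_in_degree_def by blast
  then obtain F where F: "M = monom ` F" "F \<subseteq> exps n"
    unfolding monomials_eq by (meson subset_imageE)
  have degF: "exp_degree a = d'" if "a \<in> F" for a
    using M(2) F that by (auto simp: homogeneous_def)
  have "(mon_ideal n E :: 'k mpoly set) = mon_ideal n F"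
    using M(3) F Idl_monom[OF F(2), where 'k = 'k] by simp
  then have up: "m \<in> upset n E \<longleftrightarrow> m \<in> upset n F" for m
    using monom_in_mon_ideal_iff[where 'k = 'k] by metis
  obtain a where a: "a \<in> E"
    using E(2) by blast
  then have "a \<in> upset n F"
    using up subset_upset[OF E(1)] by blast
  then obtain c where c: "c \<in> F" "c \<preceq> a"
    by (auto simp: upset_def)
  then have "c \<in> upset n E"
    using up subset_upset[OF F(2)] by blast
  then obtain a' where "a' \<in> E" "a' \<preceq> c"
    by (auto simp: upset_def)
  then show ?thesis
    using c a deg degF divides_exp_degree_le le_antisym by metis
qed

text \<open>The relation between two generators is a combination of linear relations; its coefficient
  at \<open>u\<close> exhibits a linear relation that involves \<open>u\<close>.\<close>

lemma linear_resolution_linear_steps: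
  assumes E: "E \<subseteq> exps n" "E \<noteq> {}" and deg: "\<And>a. a \<in> E \<Longrightarrow> exp_degree a = d"
    and lin: "has_linear_resolution n (mon_ideal n E :: 'k::field mpoly set)"
  shows "linear_steps E"
proof -
  let ?J = "mon_ideal n E :: 'k mpoly set"
  let ?b = "graded_betti n ?J"
  obtain d' where d': "monomial_ideal_generated_in_degree n d' ?J" "\<And>i l. l \<noteq> i + d' \<Longrightarrow> ?b i l = 0"
    using lin unfolding has_linear_resolution_def by blast
  then have b: "?b i l = 0" if "l \<noteq> i + d" for i l
    using generated_in_degree_unique[OF E deg d'(1)] that by blast
  obtain g D where "minimal_graded_free_resolution n ?J ?b g D"
    by (rule graded_betti_resolution)
  then have cs: "cover_sequence n (ring_vec ` ?J) ?b (case_nat (\<lambda>e. ring_vec (g e)) D)"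
    using minimal_graded_free_resolution_iff[OF mon_ideal_subset_carrier] by blast
  then have c0: "minimal_cover n (ring_vec ` ?J) (?b 0) (\<lambda>e. ring_vec (g e))"
    and c1: "minimal_cover n (lin_kernel n (?b 0) (\<lambda>e. ring_vec (g e))) (?b 1) (D 0)"
    unfolding cover_sequence_def by (metis nat.case(1), metis One_nat_def nat.case)
  let ?F = "graded_free n (?b 0)"
  have finE: "finite E"
    by (rule finite_subset[OF _ finite_exps_degree[of n d]]) (use E deg in auto)
  have gkeys: "keys (g e) \<subseteq> E" if "x \<in> ?F" "x e \<noteq> 0" for x e
  proof -
    obtain j k where e: "e = (j, k)"
      by (cases e)
    have k: "k < ?b 0 j"
      using graded_free_index that e by blast
    then have j: "j = d"
      using b[of j 0] by force
    have "ring_vec (g e) \<in> ring_vec ` ?J" "hom_vec j (ring_vec (g e))"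
      using minimal_cover_gen[OF c0 k] c0 k e by (auto simp: minimal_cover_def hom_gens_def)
    then have g: "keys (g e) \<subseteq> upset n E" "homogeneous d (g e)"
      by (auto simp: mon_ideal_def hom_vec_ring_vec_iff j)
    show ?thesis
    proof
      fix m assume m: "m \<in> keys (g e)"
      then obtain a where a: "a \<in> E" "a \<preceq> m"
        using g(1) by (auto simp: upset_def)
      moreover have "exp_degree m \<le> exp_degree a"
        using g(2) m deg[OF a(1)] by (simp add: homogeneous_def)
      ultimately show "m \<in> E"
        using divides_exp_degree_eq by metis
    qed
  qed
  \<comment> \<open>All basis elements of \<open>?F\<close> have degree \<open>d\<close>, so each
    \<open>g e\<close> is a constant combination of monomials in \<open>E\<close>, and
    \<open>\<kappa> w\<close> collects the coefficient at \<open>w\<close>. This translates the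
    unknown basis of the chosen resolution into the monomial generators.\<close>
  define \<kappa> where "\<kappa> w = lin_to_ring (\<lambda>e. Poly_Mapping.single 0 (lookup (g e) w))" for w
  have expand: "lin_to_ring g x = (\<Sum>w\<in>E. \<kappa> w x * monom w)" if x: "x \<in> ?F" for x
  proof -
    have "lin_to_ring g x = (\<Sum>e | x e \<noteq> 0. \<Sum>w\<in>E. x e * Poly_Mapping.single 0 (lookup (g e) w) * monom w)"
      unfolding lin_to_ring_def
    proof (rule sum.cong[OF refl])
      fix e assume "e \<in> {e. x e \<noteq> 0}"
      then have "keys (g e) \<subseteq> E"
        using gkeys[OF x] by simp
      have "g e = (\<Sum>w\<in>keys (g e). Poly_Mapping.single w (lookup (g e) w))"
        by (simp add: sum_single_keys)
      also have "\<dots> = (\<Sum>w\<in>E. Poly_Mapping.single w (lookup (g e) w))"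
        by (rule sum.mono_neutral_left) (use finE \<open>keys (g e) \<subseteq> E\<close> in \<open>auto simp: in_keys_iff\<close>)
      finally have "g e = (\<Sum>w\<in>E. Poly_Mapping.single 0 (lookup (g e) w) * monom w)"
        by (simp add: mult_single)
      then show "x e * g e = (\<Sum>w\<in>E. x e * Poly_Mapping.single 0 (lookup (g e) w) * monom w)"
        by (metis (no_types, lifting) mult.assoc sum.cong sum_distrib_left)
    qed
    also have "\<dots> = (\<Sum>w\<in>E. \<kappa> w x * monom w)"
      by (subst sum.swap) (simp add: \<kappa>_def lin_to_ring_def sum_distrib_right)
    finally show ?thesis .
  qed
  have kdeg: "exp_degree m + d = j" if x: "x \<in> ?F" "hom_vec j x" and m: "m \<in> keys (\<kappa> w x)" for x j m w
  proof -
    have "\<exists>e. x e \<noteq> 0 \<and> m \<in> keys (x e * Poly_Mapping.single 0 (lookup (g e) w))"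
      using m keys_sum[of "\<lambda>e. x e * Poly_Mapping.single 0 (lookup (g e) w)" "{e. x e \<noteq> 0}"]
      unfolding \<kappa>_def lin_to_ring_def by blast
    then obtain e where e: "x e \<noteq> 0" "m \<in> keys (x e * Poly_Mapping.single 0 (lookup (g e) w))"
      by blast
    then have "m \<in> keys (x e)"
      by (metis in_keys_iff lookup_const_mult mult.commute mult_zero_right)
    then have "exp_degree m + fst e = j"
      using x(2) by (simp add: hom_vec_def)
    moreover have "snd e < ?b 0 (fst e)"
      using graded_free_index[OF x(1), of "fst e" "snd e"] e(1) by simp
    then have "fst e = d"
      using b[of "fst e" 0] by force
    ultimately show ?thesis
      by simp
  qed
  \<comment> \<open>In degree \<open>d\<close> the coordinates \<open>\<kappa>\<close> are
    constants, and distinct monomials are linearly independent over the field; so a lift of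
    \<open>u\<close> of degree \<open>d\<close> has the coordinates of a unit vector.\<close>
  have lift: "\<exists>x\<in>?F. lin_to_ring g x = monom u \<and> (\<forall>w\<in>E. \<kappa> w x = (if w = u then 1 else 0))"
    if u: "u \<in> E" for u
  proof -
    have "ring_vec (monom u) \<in> ring_vec ` ?J"
      using subset_upset[OF E(1)] u by (auto simp: monom_in_mon_ideal_iff)
    then have "ring_vec (monom u) \<in> lin_to_free (\<lambda>e. ring_vec (g e)) ` ?F"
      using c0 by (simp add: minimal_cover_def)
    then obtain x0 where x0: "x0 \<in> ?F" "lin_to_free (\<lambda>e. ring_vec (g e)) x0 = ring_vec (monom u)"
      by (elim imageE) auto
    define x where "x = part d x0"
    have x: "x \<in> ?F" "hom_vec d x"
      unfolding x_def by (rule graded_free_part[OF x0(1)], rule hom_vec_part)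
    have "hom_vec d (ring_vec (monom u) :: 'k fvec)"
      using deg[OF u] by (simp add: hom_vec_ring_vec_iff homogeneous_def)
    then have "lin_to_free (\<lambda>e. ring_vec (g e)) x = ring_vec (monom u)"
      using part_lin_to_free'[of "?b 0" "\<lambda>e. ring_vec (g e)" x0 n d] c0 x0
      by (simp add: minimal_cover_def x_def part_hom_vec)
    then have gx: "lin_to_ring g x = monom u"
      by (simp add: lin_to_free_ring_vec)
    have const: "\<kappa> w x = Poly_Mapping.single 0 (lookup (\<kappa> w x) 0)" for w
      by (rule keys_const) (use kdeg[OF x] in force)
    have "\<kappa> w x = (if w = u then 1 else 0)" if w: "w \<in> E" for w
    proof -
      have "lookup (monom u :: 'k mpoly) w = (\<Sum>v\<in>E. lookup (\<kappa> v x * monom v) w)"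
        unfolding gx[symmetric] expand[OF x(1)] lookup_sum ..
      also have "\<dots> = (\<Sum>v\<in>E. if v = w then lookup (\<kappa> v x) 0 else 0)"
      proof (rule sum.cong[OF refl])
        fix v
        show "lookup (\<kappa> v x * monom v) w = (if v = w then lookup (\<kappa> v x) 0 else 0)"
          by (subst const) (simp add: mult_single lookup_single when_def)
      qed
      also have "\<dots> = lookup (\<kappa> w x) 0"
        using finE w by simp
      finally have "lookup (\<kappa> w x) 0 = (if w = u then 1 else 0)"
        by (auto simp: lookup_single when_def)
      then show ?thesis
        using const[of w] by (auto simp: single_one)
    qed
    then show ?thesis
      using x gx by blast
  qed
  show ?thesis
    unfolding linear_steps_def
  proof (intro ballI)
    fix u v assume u: "u \<in> E" and v: "v \<in> E - {u}"
    obtain xu where xu: "xu \<in> ?F" "lin_to_ring g xu = monom u" "\<And>w. w \<in> E \<Longrightarrow> \<kappa> w xu = (if w = u then 1 else 0)"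
      using lift[OF u] by blast
    obtain xv where xv: "xv \<in> ?F" "lin_to_ring g xv = monom v" "\<And>w. w \<in> E \<Longrightarrow> \<kappa> w xv = (if w = v then 1 else 0)"
      using lift[of v] v by blast
    \<comment> \<open>Truncated subtraction makes these the exponents of
      \<open>lcm(u, v) / u\<close> and \<open>lcm(u, v) / v\<close>.\<close>
    let ?a = "v - u" and ?c = "u - v"
    define r where "r = smul (monom ?a) xu - smul (monom ?c) xv"
    have ac: "?a + u = ?c + v"
      by (rule poly_mapping_eqI) (simp add: lookup_add lookup_minus)
    have ex: "?a \<in> exps n" "?c \<in> exps n"
      using u v E(1) by (auto intro!: exps_diff)
    have fin: "finsupp xu" "finsupp xv"
      using xu(1) xv(1) by (auto intro: graded_free_finsupp)
    have F: "smul (monom ?a) xu \<in> ?F" "smul (monom ?c) xv \<in> ?F"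
      using xu(1) xv(1) ex by (auto intro: graded_free_smul)
    have "lin_to_ring g r = 0"
      unfolding r_def using fin
      by (simp add: lin_to_ring_diff lin_to_ring_smul finsupp_smul xu(2) xv(2) monom_mult ac)
    then have "r \<in> lin_kernel n (?b 0) (\<lambda>e. ring_vec (g e))"
      using F by (simp add: lin_kernel_def lin_to_free_ring_vec r_def graded_free_diff)
    then have "r \<in> lin_to_free (D 0) ` graded_free n (?b 1)"
      using c1 by (simp add: minimal_cover_def)
    then obtain s where s: "s \<in> graded_free n (?b 1)" "r = lin_to_free (D 0) s"
      by (elim imageE) auto
    have DF: "D 0 l \<in> ?F" "lin_to_ring g (D 0 l) = 0" "hom_vec (Suc d) (D 0 l)" if "s l \<noteq> 0" for l
    proof -
      obtain j k where l: "l = (j, k)"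
        by (cases l)
      have k: "k < ?b 1 j"
        using graded_free_index[OF s(1)] that l by blast
      then have j: "j = Suc d"
        using b[of j 1] by force
      have "D 0 l \<in> lin_kernel n (?b 0) (\<lambda>e. ring_vec (g e))"
        using minimal_cover_gen[OF c1 k] l by simp
      then show "D 0 l \<in> ?F" "lin_to_ring g (D 0 l) = 0"
        by (simp_all add: lin_kernel_def lin_to_free_ring_vec)
      show "hom_vec (Suc d) (D 0 l)"
        using c1 k unfolding minimal_cover_def hom_gens_def l j by blast
    qed
    \<comment> \<open>The lift of \<open>v\<close> has coordinate 0 at \<open>u\<close>, so a single
      monomial remains. Some linear relation in the expansion of \<open>r\<close> must then have, in
      its coordinate at \<open>u\<close>, a variable dividing this monomial.\<close>
    have "\<kappa> u r = monom ?a"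
      unfolding r_def \<kappa>_def using fin xu(3)[OF u] xv(3)[OF u] v
      by (auto simp: lin_to_ring_diff lin_to_ring_smul finsupp_smul \<kappa>_def)
    moreover have "\<kappa> u r = (\<Sum>l | s l \<noteq> 0. s l * \<kappa> u (D 0 l))"
    proof -
      have fD: "finsupp (D 0 l)" if "s l \<noteq> 0" for l
        by (rule graded_free_finsupp[OF DF(1)[OF that]])
      have "\<kappa> u r = (\<Sum>l | s l \<noteq> 0. \<kappa> u (smul (s l) (D 0 l)))"
        unfolding s(2) lin_to_free_eq_sum \<kappa>_def
        by (rule lin_to_ring_sum) (use fD in \<open>auto intro: finsupp_smul\<close>)
      also have "\<dots> = (\<Sum>l | s l \<noteq> 0. s l * \<kappa> u (D 0 l))"
        unfolding \<kappa>_def by (rule sum.cong[OF refl], rule lin_to_ring_smul) (use fD in auto)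
      finally show ?thesis .
    qed
    ultimately have "?a \<in> keys (\<Sum>l | s l \<noteq> 0. s l * \<kappa> u (D 0 l))"
      by (metis keys_monom insertI1)
    then obtain l where l: "s l \<noteq> 0" "?a \<in> keys (s l * \<kappa> u (D 0 l))"
      using keys_sum[of "\<lambda>l. s l * \<kappa> u (D 0 l)" "{l. s l \<noteq> 0}"] by blast
    then obtain a1 a2 where a12: "a2 \<in> keys (\<kappa> u (D 0 l))" "?a = a1 + a2"
      using keys_mult_sub by blast
    have "exp_degree a2 + d = Suc d"
      using kdeg[OF DF(1,3)[OF l(1)] a12(1)] .
    then have dega2: "exp_degree a2 = 1"
      by simp
    then have "a2 \<noteq> 0"
      by auto
    then obtain p c where p: "a2 = unit_exp p + c"
      by (rule exp_nonzero_split)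
    then have "exp_degree c = 0"
      using dega2 by (simp add: exp_degree_add)
    then have a2: "a2 = unit_exp p"
      using p exp_degree_eq_0_iff by simp
    have "lookup ?a p \<noteq> 0"
      using a12(2) a2 by (simp add: lookup_add lookup_unit_exp)
    then have lt: "lookup u p < lookup v p"
      by (simp add: lookup_minus)
    \<comment> \<open>The term \<open>x_p\<close> of the coordinate at \<open>u\<close> contributes
      the monomial \<open>?m\<close> to a sum that vanishes, so another generator must contribute to
      \<open>?m\<close> as well and hence divides it.\<close>
    let ?m = "u + unit_exp p"
    have "(\<Sum>w\<in>E. lookup (\<kappa> w (D 0 l) * monom w) ?m) = 0"
      unfolding lookup_sum[symmetric] expand[OF DF(1)[OF l(1)], symmetric] DF(2)[OF l(1)] by simp
    moreover have "lookup (\<kappa> u (D 0 l) * monom u) ?m \<noteq> 0"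
      using a12(1) a2 lookup_single_mult[of u 1 "\<kappa> u (D 0 l)" ?m] by (simp add: mult.commute in_keys_iff)
    ultimately have "(\<Sum>w\<in>E - {u}. lookup (\<kappa> w (D 0 l) * monom w) ?m) \<noteq> 0"
      using sum.remove[OF finE u, of "\<lambda>w. lookup (\<kappa> w (D 0 l) * monom w) ?m"] by force
    then have "\<exists>w\<in>E - {u}. lookup (\<kappa> w (D 0 l) * monom w) ?m \<noteq> 0"
      by (rule contrapos_np) (simp add: sum.neutral)
    then obtain w where w: "w \<in> E - {u}" "lookup (\<kappa> w (D 0 l) * monom w) ?m \<noteq> 0"
      by blast
    then have "w \<preceq> ?m"
      using lookup_single_mult[of w 1 "\<kappa> w (D 0 l)" ?m] by (simp add: mult.commute split: if_splits)
    then show "\<exists>p. lookup u p < lookup v p \<and> (\<exists>w\<in>E - {u}. w \<preceq> u + unit_exp p)"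
      using lt w(1) by blast
  qed
qed

section \<open>The equivalences\<close>

theorem theorem2p2:
  fixes n t :: nat and I :: "'k::field mpoly set"
  assumes "2 \<le> t" and "t \<le> n"
    and "I = line_path_ideal n t"
  shows "((\<exists>s\<ge>1. has_linear_resolution n (ideal_power n I s)) \<longleftrightarrow>
          (\<forall>s\<ge>1. has_linear_resolution n (ideal_power n I s))) \<and>
         ((\<forall>s\<ge>1. has_linear_resolution n (ideal_power n I s)) \<longleftrightarrow>
          t \<le> n \<and> n \<le> 2 * t) \<and>
         (t \<le> n \<and> n \<le> 2 * t \<longleftrightarrow>
          (\<exists>s\<ge>1. has_linear_quotients n (ideal_power n I s))) \<and>
         ((\<exists>s\<ge>1. has_linear_quotients n (ideal_power n I s)) \<longleftrightarrow>
          (\<forall>s\<ge>1. has_linear_quotients n (ideal_power n I s))) \<and>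
         ((\<forall>s\<ge>1. has_linear_quotients n (ideal_power n I s)) \<longleftrightarrow>
          (\<exists>s\<ge>1. quasi_linear n (ideal_power n I s))) \<and>
         ((\<exists>s\<ge>1. quasi_linear n (ideal_power n I s)) \<longleftrightarrow>
          (\<forall>s\<ge>1. quasi_linear n (ideal_power n I s)))"
proof -
  define G where "G = path_exp t ` {1..n - t + 1}"
  define E where "E s = sums_of G s" for s
  have G: "G \<subseteq> exps n"
    using assms(2) by (auto simp: G_def intro!: path_exp_in_exps)
  have E: "E s \<subseteq> exps n" for s
    unfolding E_def by (rule sums_of_exps[OF G])
  have deg: "exp_degree a = s * t" if "a \<in> E s" for a s
    by (rule exp_degree_sums_of[of G]) (use that in \<open>auto simp: E_def G_def\<close>)
  have ne: "E s \<noteq> {}" for s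
  proof (induction s)
    case (Suc s)
    then show ?case
      using sums_of_SucI[of _ G s "path_exp t 1"] by (auto simp: E_def G_def)
  qed (simp add: E_def)
  have I: "ideal_power n I s = mon_ideal n (E s)" for s
    unfolding assms(3) line_path_ideal_eq[OF assms(2)] E_def G_def[symmetric]
    by (rule ideal_power_mon_ideal[OF G])
  have ql: "quasi_linear n (ideal_power n I s) \<longleftrightarrow> linear_steps (E s)" for s
    unfolding I by (rule quasi_linear_mon_ideal_iff[OF E deg])
  have lq: "has_linear_quotients n (ideal_power n I s) \<longleftrightarrow>
      (\<exists>es. distinct es \<and> set es = E s \<and> linear_quotient_order es)" for s
    unfolding I by (rule has_linear_quotients_mon_ideal_iff[OF E deg])
  have lq_ql: "linear_steps (E s)" if "has_linear_quotients n (ideal_power n I s)" for s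
    using that linear_quotient_order_linear_steps deg unfolding lq by metis
  have lr_ql: "linear_steps (E s)" if "has_linear_resolution n (ideal_power n I s)" for s
    using linear_resolution_linear_steps[OF E ne deg] that unfolding I by blast
  show ?thesis
  \<comment> \<open>Each of the three properties, for any single power, implies
    \<open>linear_steps\<close>, which fails for every \<open>s \<ge> 1\<close> beyond the bound;
    within the bound all three hold for every \<open>s\<close>. Hence "some" and "all"
    coincide.\<close>
  proof (cases "n \<le> 2 * t")
    case True
    have es: "\<exists>es. distinct es \<and> set es = E s \<and> linear_quotient_order es" for s
      unfolding E_def G_def by (rule ex_linear_quotient_order_path[OF assms(2) True])
    then have "has_linear_quotients n (ideal_power n I s)" for s
      unfolding lq by blast
    moreover have "has_linear_resolution n (ideal_power n I s)" for s
    proof -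
      obtain es where "set es = E s" "linear_quotient_order es"
        using es by blast
      then show ?thesis
        using linear_quotients_linear_resolution[of es n "s * t", where 'k = 'k] E deg by (simp add: I)
    qed
    ultimately show ?thesis
      using True assms(2) lq_ql ql by blast
  next
    case False
    then have "\<not> linear_steps (E s)" if "1 \<le> s" for s
      unfolding E_def G_def using assms(1) that by (intro not_linear_steps_path) simp_all
    then show ?thesis
      using False lq_ql lr_ql ql by blast
  qed
qed

end
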